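(* For $\delta\in\mathbb{R}$, $\delta<0$, with $|\delta|$ small, $$d(\delta)=1-\frac{\sqrt6}{3\,\pi\log 2}\sqrt{|\delta|}+o(\sqrt{|\delta|})\qquad(\delta\to0^-).$$
   Context: For $\delta\in\mathbb{C}$ let $f_\delta(z)=z^2-2+\delta$, let $\mathcal{J}_\delta$ be its Julia set (the boundary of $\{z\in\mathbb{C}: f_\delta^n(z)\nrightarrow\infty\}$), and let $d(\delta)$ be the Hausdorff dimension of $\mathcal{J}_\delta$. *)

theory Defs
  imports "HOL-Analysis.Analysis" "HOL-Library.Landau_Symbols"
begin

text \<open>
  Cost of a single covering set, with the usual conventions in dimension 0: the empty
  set costs 0 and every nonempty set costs 1 (HOL itself has \<open>0 powr 0 = 0\<close>).
\<close>

definition hausdorff_gauge :: "real \<Rightarrow> 'a::metric_space set \<Rightarrow> ennreal" where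
  "hausdorff_gauge s U =
     (if U = {} then 0 else if s = 0 then 1 else ennreal (diameter U powr s))"

text \<open>
  Boundedness of the covering sets is required explicitly because the value of
  \<open>diameter\<close> on an unbounded set is unspecified.
  If there is no admissible cover, the infimum is \<open>\<infinity>\<close>.
\<close>

definition hausdorff_premeasure :: "real \<Rightarrow> real \<Rightarrow> 'a::metric_space set \<Rightarrow> ennreal" where
  "hausdorff_premeasure s \<epsilon> A =
     (INF U \<in> {U :: nat \<Rightarrow> 'a set.
                 A \<subseteq> (\<Union>i. U i) \<and> (\<forall>i. bounded (U i) \<and> diameter (U i) \<le> \<epsilon>)}.
        \<Sum>i. hausdorff_gauge s (U i))"

definition hausdorff_measure :: "real \<Rightarrow> 'a::metric_space set \<Rightarrow> ennreal" where
  "hausdorff_measure s A = (SUP \<epsilon> \<in> {0<..}. hausdorff_premeasure s \<epsilon> A)"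

definition hausdorff_dim :: "'a::metric_space set \<Rightarrow> ennreal" where
  "hausdorff_dim A = Inf {ennreal s | s. 0 \<le> s \<and> hausdorff_measure s A = 0}"

definition quad_map :: "complex \<Rightarrow> complex \<Rightarrow> complex" where
  "quad_map \<delta> z = z\<^sup>2 - 2 + \<delta>"

definition filled_julia_set :: "complex \<Rightarrow> complex set" where
  "filled_julia_set \<delta> =
     {z. \<not> filterlim (\<lambda>n. (quad_map \<delta> ^^ n) z) at_infinity sequentially}"

definition julia_set :: "complex \<Rightarrow> complex set" where
  "julia_set \<delta> = frontier (filled_julia_set \<delta>)"

text \<open>
  The dimension of a subset of the plane is at most 2, so \<open>enn2real\<close> never meets \<open>\<infinity>\<close> here.
\<close>

definition julia_dim :: "complex \<Rightarrow> real" where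
  "julia_dim \<delta> = enn2real (hausdorff_dim (julia_set \<delta>))"

end

theory Submission
  imports Defs "HOL-Real_Asymp.Real_Asymp"
begin

text \<open>
  Write \<open>\<delta> = - \<epsilon>\<close> and let \<open>\<beta>\<close> be the repelling fixed point of \<open>f x = x\<^sup>2 - 2 - \<epsilon>\<close> near 2.  An expansion
  estimate for \<open>\<bar>z - \<beta>\<bar> + \<bar>z + \<beta>\<bar>\<close> shows that the Julia set is the real Cantor set of points whose
  orbit stays in \<open>[-\<beta>, \<beta>]\<close>.  The substitution \<open>x = \<beta> cos (2 u)\<close> turns the two inverse branches into
  \<open>g u = arcsin (sin u / \<kappa>) / 2\<close> and \<open>\<pi>/2 - g u\<close> on \<open>[0, \<pi>/2]\<close>, where \<open>\<kappa>\<^sup>2 = \<beta>/2 = 1 + \<tau>\<^sup>2\<close> and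
  \<open>\<tau> \<sim> sqrt (\<epsilon>/6)\<close>.  Both contract by a factor of at most 1/2, so at level \<open>n\<close> there are \<open>2\<^sup>n\<close> cylinders of length at
  most about \<open>2\<^bsup>-n\<^esup>\<close>, and the dimension is governed by the Lebesgue measure \<open>a n\<close> of their union.  If
  \<open>a (n+1) \<le> \<lambda> a n\<close>, concavity of \<open>t \<mapsto> t\<^sup>s\<close> bounds the sum of the \<open>s\<close>-th powers of the lengths by
  \<open>(2\<^bsup>1-s\<^esup> \<lambda>\<^sup>s)\<^sup>n\<close>.  If \<open>a (n+1) \<ge> 2\<^bsup>s-1\<^esup> a n\<close>, bounded distortion (the critical value lies outside
  \<open>[-\<beta>, \<beta>]\<close>) makes normalised Lebesgue measure on the cylinders a Frostman measure of exponent \<open>s\<close>.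
  Hence \<open>1 - d\<close> is to first order the escape rate divided by \<open>ln 2\<close>.  The surviving set
  equidistributes down to the scale \<open>\<tau>\<close>, so in every step it loses the same proportion as the whole
  interval does in the first step, namely \<open>(2/\<pi>) arctan \<tau>\<close>.
\<close>

section \<open>The inverse branches in the angular coordinate\<close>

text \<open>The loss in one step is the integral of \<open>1 - wr v\<close> over the surviving set,
  and this weight is concentrated at distance O(\<open>\<tau>\<close>) from \<open>v = 0\<close>.
  Equidistribution up to an absolute error is thus of no use unless that error is
  o(\<open>\<tau>\<close>), while the argument over the whole interval yields an error of order sqrt
  \<open>\<tau>\<close>. There is also a circle: equidistribution needs a bound on the loss, and the
  loss is governed by the mass near 0. A strong induction breaks the circle: cutting at distance
  about sqrt \<open>\<tau>\<close> from 0 bounds the loss by \<open>\<theta> * a n\<close>, with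
  \<open>\<theta>\<close> of order sqrt \<open>\<tau>\<close>, and this suffices for
  equidistribution with error \<open>8 * \<theta>\<close>. Since 0 is a fixed point of
  \<open>g\<close> with slope nearly 1/2, about 2 log2(1 / sqrt \<open>\<tau>\<close>) pull-backs
  bring the additive error down to order \<open>\<theta> * \<tau>\<close>. Each of them costs a
  factor 1 + O(\<open>\<theta>\<close>), and the product of these factors still tends to 1, because
  their number is only logarithmic in 1 / \<open>\<tau>\<close>.\<close>

locale perturbed_tent =
  fixes \<tau> :: real
  assumes tau_pos: "0 < \<tau>"
begin

definition \<kappa> :: real where "\<kappa> = sqrt (1 + \<tau>\<^sup>2)"

definition g :: "real \<Rightarrow> real" where "g u = arcsin (sin u / \<kappa>) / 2"

definition w :: "real \<Rightarrow> real" where "w u = cos u / sqrt (\<tau>\<^sup>2 + (cos u)\<^sup>2)"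

lemma kappa_gt_1: "1 < \<kappa>"
  unfolding \<kappa>_def using tau_pos by (simp add: real_less_rsqrt)

lemma kappa_sq: "\<kappa>\<^sup>2 = 1 + \<tau>\<^sup>2"
  unfolding \<kappa>_def by (simp add: add_nonneg_nonneg)

lemma sin_div_kappa: "\<bar>sin u / \<kappa>\<bar> < 1"
proof -
  have "\<bar>sin u\<bar> < \<kappa>" using abs_sin_le_one[of u] kappa_gt_1 by linarith
  then show ?thesis using kappa_gt_1 by (simp add: abs_divide)
qed

lemma w_denom_pos: "0 < \<tau>\<^sup>2 + (cos u)\<^sup>2"
  using tau_pos by (simp add: add_pos_nonneg)

lemma g_deriv: "(g has_real_derivative w u / 2) (at u within S)"
proof -
  have eq: "1 - (sin u / \<kappa>)\<^sup>2 = (\<tau>\<^sup>2 + (cos u)\<^sup>2) / \<kappa>\<^sup>2"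
  proof -
    have "1 - (sin u / \<kappa>)\<^sup>2 = (\<kappa>\<^sup>2 - (sin u)\<^sup>2) / \<kappa>\<^sup>2"
      using kappa_gt_1 by (simp add: diff_divide_distrib power_divide)
    then show ?thesis by (simp add: kappa_sq sin_squared_eq)
  qed
  have s: "sqrt (1 - (sin u / \<kappa>)\<^sup>2) = sqrt (\<tau>\<^sup>2 + (cos u)\<^sup>2) / \<kappa>"
    unfolding eq using kappa_gt_1 by (simp add: real_sqrt_divide)
  have r: "- 1 < sin u / \<kappa>" "sin u / \<kappa> < 1" using sin_div_kappa[of u] by linarith+
  have "(g has_real_derivative inverse (sqrt (1 - (sin u / \<kappa>)\<^sup>2)) * (cos u / \<kappa>) / 2) (at u)"
    unfolding g_def[abs_def]
    by (intro DERIV_cdivide DERIV_chain2[where f = arcsin] DERIV_arcsin r DERIV_sin)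
  then have "(g has_real_derivative w u / 2) (at u)"
    unfolding s w_def using kappa_gt_1 by (simp add: field_simps)
  then show ?thesis by (rule has_field_derivative_at_within)
qed

lemma g_cont: "continuous_on S g"
  by (rule DERIV_continuous_on[OF g_deriv])

lemma w_cont: "continuous_on S w"
proof -
  have "sqrt (\<tau>\<^sup>2 + (cos u)\<^sup>2) \<noteq> 0" for u
    using w_denom_pos[of u] by (metis less_irrefl real_sqrt_eq_zero_cancel_iff)
  then show ?thesis unfolding w_def by (intro continuous_intros) auto
qed

lemma w_nonneg: "0 \<le> u \<Longrightarrow> u \<le> pi/2 \<Longrightarrow> 0 \<le> w u"
  unfolding w_def by (simp add: cos_ge_zero)

lemma w_le_1: "w u \<le> 1"
proof -
  have "cos u \<le> \<bar>cos u\<bar>" by simp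
  also have "\<dots> = sqrt ((cos u)\<^sup>2)" by simp
  also have "\<dots> \<le> sqrt (\<tau>\<^sup>2 + (cos u)\<^sup>2)" by simp
  finally show ?thesis unfolding w_def using w_denom_pos[of u] by simp
qed

text \<open>This is \<open>w (pi/4)\<close>, the minimum of \<open>w\<close> on
  \<open>[0, pi/4]\<close>; there \<open>g\<close> is halving up to a factor between
  \<open>\<omega>\<close> and 1.\<close>

definition \<omega> :: real where "\<omega> = 1 / sqrt (1 + 2 * \<tau>\<^sup>2)"

lemma omega_pos: "0 < \<omega>" unfolding \<omega>_def by (simp add: add_pos_nonneg)

lemma omega_le_1: "\<omega> \<le> 1" 
proof -
  have 1: "1 \<le> sqrt (1 + 2 * \<tau>\<^sup>2)" by simp
  then have "0 < sqrt (1 + 2 * \<tau>\<^sup>2)" by linarith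
  then show ?thesis unfolding \<omega>_def using 1 by (simp only: divide_le_eq_1_pos)
qed

lemma omega_ge: "1 - \<tau>\<^sup>2 \<le> \<omega>"
proof -
  have "sqrt (1 + 2 * \<tau>\<^sup>2) \<le> 1 + \<tau>\<^sup>2"
  proof (rule real_le_lsqrt)
    have "(1 + \<tau>\<^sup>2)\<^sup>2 = 1 + 2 * \<tau>\<^sup>2 + (\<tau>\<^sup>2)\<^sup>2" by algebra
    then show "1 + 2 * \<tau>\<^sup>2 \<le> (1 + \<tau>\<^sup>2)\<^sup>2" by simp
  qed simp
  moreover have "(1 - \<tau>\<^sup>2) * (1 + \<tau>\<^sup>2) \<le> 1"
    using zero_le_power2[of "\<tau>\<^sup>2"] by (simp add: algebra_simps power2_eq_square)
  ultimately have "(1 - \<tau>\<^sup>2) \<le> 1 / (1 + \<tau>\<^sup>2)" "1 / (1 + \<tau>\<^sup>2) \<le> 1 / sqrt (1 + 2 * \<tau>\<^sup>2)"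
    by (auto simp: pos_le_divide_eq add_pos_nonneg intro!: divide_left_mono mult_pos_pos)
  then show ?thesis unfolding \<omega>_def by linarith
qed

text \<open>The weight \<open>w\<close> read from the other end. Loss occurs where \<open>w\<close>
  is far from 1, namely near \<open>u = pi/2\<close>; in \<open>v = pi/2 - u\<close> this is an
  initial interval, whose mass \<open>G\<close> measures directly.\<close>

definition wr :: "real \<Rightarrow> real" where "wr v = sin v / sqrt (\<tau>\<^sup>2 + (sin v)\<^sup>2)"

definition wr' :: "real \<Rightarrow> real" where
  "wr' v = \<tau>\<^sup>2 * cos v / ((\<tau>\<^sup>2 + (sin v)\<^sup>2) * sqrt (\<tau>\<^sup>2 + (sin v)\<^sup>2))"

lemma wr_w: "wr v = w (pi/2 - v)"
  unfolding wr_def w_def by (simp add: cos_diff)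

lemma w_wr: "w u = wr (pi/2 - u)"
  unfolding wr_w by simp

lemma wr_denom_pos: "0 < \<tau>\<^sup>2 + (sin v)\<^sup>2"
  using tau_pos by (simp add: add_pos_nonneg)

lemma wr_deriv: "(wr has_real_derivative wr' v) (at v within S)"
proof -
  define q where "q = sqrt (\<tau>\<^sup>2 + (sin v)\<^sup>2)"
  have q: "0 < q" "q * q = \<tau>\<^sup>2 + (sin v)\<^sup>2"
    unfolding q_def using wr_denom_pos[of v] by auto
  have "((\<lambda>v. sqrt (\<tau>\<^sup>2 + (sin v)\<^sup>2)) has_real_derivative sin v * cos v / q) (at v)"
    unfolding q_def using wr_denom_pos[of v] by (auto intro!: derivative_eq_intros simp: field_simps)
  from DERIV_divide[OF DERIV_sin this]
  have "(wr has_real_derivative (cos v * q - sin v * (sin v * cos v / q)) / (q * q)) (at v)"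
    unfolding wr_def[abs_def] using q(1) by (simp add: q_def[symmetric])
  moreover have "(cos v * q - sin v * (sin v * cos v / q)) / (q * q) = wr' v"
  proof -
    have t: "\<tau>\<^sup>2 = q * q - (sin v)\<^sup>2" using q by simp
    have "wr' v = \<tau>\<^sup>2 * cos v / (q * q * q)" unfolding wr'_def q_def[symmetric] q(2) ..
    then show ?thesis unfolding t using q(1) by (simp add: field_simps power2_eq_square)
  qed
  ultimately show ?thesis by (simp add: has_field_derivative_at_within)
qed

lemma wr'_nonneg: "0 \<le> v \<Longrightarrow> v \<le> pi/2 \<Longrightarrow> 0 \<le> wr' v"
  unfolding wr'_def using wr_denom_pos[of v] by (simp add: cos_ge_zero)

lemma wr'_cont: "continuous_on S wr'"
proof -
  have "sqrt (\<tau>\<^sup>2 + (sin u)\<^sup>2) \<noteq> 0" "\<tau>\<^sup>2 + (sin u)\<^sup>2 \<noteq> 0" for u using wr_denom_pos[of u] by auto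
  then show ?thesis unfolding wr'_def by (intro continuous_intros) auto
qed

lemma wr_mono: "0 \<le> x \<Longrightarrow> x \<le> y \<Longrightarrow> y \<le> pi/2 \<Longrightarrow> wr x \<le> wr y"
  by (rule DERIV_nonneg_imp_nondecreasing[of x y wr])
     (meson order_trans wr_deriv wr'_nonneg)+

lemma wr_has_integral:
  assumes "0 \<le> x" "x \<le> y"
  shows "(wr' has_integral wr y - wr x) {x..y}"
  using assms wr_deriv
  by (intro fundamental_theorem_of_calculus) (auto simp: has_real_derivative_iff_has_vector_derivative)

lemma w_mono: "0 \<le> x \<Longrightarrow> x \<le> y \<Longrightarrow> y \<le> pi/2 \<Longrightarrow> w y \<le> w x"
  unfolding w_wr by (rule wr_mono) auto

lemma w_ge_omega: "0 \<le> u \<Longrightarrow> u \<le> pi/4 \<Longrightarrow> \<omega> \<le> w u"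
proof -
  assume u: "0 \<le> u" "u \<le> pi/4"
  have "w (pi/4) = \<omega>"
  proof -
    have "w (pi/4) = (sqrt 2 / 2) / sqrt (\<tau>\<^sup>2 + 1/2)"
      unfolding w_def by (simp add: cos_45 power_divide)
    also have "\<tau>\<^sup>2 + 1/2 = (1 + 2 * \<tau>\<^sup>2) / 2" by simp
    also have "(sqrt 2 / 2) / sqrt ((1 + 2 * \<tau>\<^sup>2) / 2) = \<omega>"
      unfolding \<omega>_def real_sqrt_divide by (simp add: field_simps)
    finally show ?thesis .
  qed
  then show ?thesis using w_mono[of u "pi/4"] u by auto
qed

text \<open>With \<open>x = \<tau>^2 / (sin v)^2\<close> the weight is
  \<open>1 / sqrt (1 + x)\<close>, and \<open>sqrt (1 + x) \<le> 1 + x/2\<close>. So the loss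
  density decays quadratically beyond distance \<open>\<tau>\<close>.\<close>

lemma one_minus_wr_le:
  assumes "0 < v" "v \<le> pi/2"
  shows "1 - wr v \<le> \<tau>\<^sup>2 / (2 * (sin v)\<^sup>2)"
proof -
  have s: "0 < sin v" using assms sin_gt_zero[of v] by auto
  define x where "x = \<tau>\<^sup>2 / (sin v)\<^sup>2"
  have x: "0 \<le> x" unfolding x_def by simp
  have "\<tau>\<^sup>2 + (sin v)\<^sup>2 = (sin v)\<^sup>2 * (1 + x)" unfolding x_def using s by (simp add: field_simps)
  then have "sqrt (\<tau>\<^sup>2 + (sin v)\<^sup>2) = sin v * sqrt (1 + x)" using s by (simp add: real_sqrt_mult)
  then have wr: "wr v = 1 / sqrt (1 + x)" unfolding wr_def using s by simp
  have "sqrt (1 + x) \<le> 1 + x / 2"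
    by (rule real_le_lsqrt) (use x in \<open>auto simp: power2_eq_square algebra_simps\<close>)
  then have "1 / (1 + x/2) \<le> 1 / sqrt (1 + x)" using x by (intro divide_left_mono mult_pos_pos) auto
  moreover have "1 - x / 2 \<le> 1 / (1 + x/2)"
    using x by (simp add: field_simps)
  ultimately show ?thesis unfolding wr x_def by simp
qed

lemma g_0 [simp]: "g 0 = 0" unfolding g_def by simp

text \<open>Half the width of the gap: the images of the two branches end at
  \<open>pi/4 - hh\<close> and start at \<open>pi/4 + hh\<close>.\<close>

definition hh :: real where "hh = arctan \<tau> / 2"

lemma hh_bounds: "0 < hh" "hh \<le> \<tau> / 2" "hh < pi/4"
  unfolding hh_def using tau_pos arctan_ubound[of \<tau>] arctan_le_self[of \<tau>] by auto

lemma g_pi_half: "g (pi/2) = pi/4 - hh"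
proof -
  have "sin (pi/2 - arctan \<tau>) = 1 / \<kappa>"
    by (simp add: sin_diff cos_arctan \<kappa>_def)
  then have "arcsin (1/\<kappa>) = pi/2 - arctan \<tau>"
    using arctan_bounded[of \<tau>] tau_pos zero_less_arctan_iff[of \<tau>] pi_gt_zero
    by (intro arcsin_unique) linarith+
  then show ?thesis unfolding g_def hh_def by (simp add: field_simps)
qed

lemma g_lt: assumes "0 \<le> x" "x < y" "y \<le> pi/2" shows "g x < g y"
proof -
  have "sin x < sin y" by (rule sin_monotone_2pi) (use assms in auto)
  then have "sin x / \<kappa> < sin y / \<kappa>" using kappa_gt_1 by (simp add: divide_strict_right_mono)
  then show ?thesis unfolding g_def using sin_div_kappa[of x] sin_div_kappa[of y]
    by (auto simp: arcsin_less_mono abs_less_iff)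
qed

lemma g_le: assumes "0 \<le> x" "x \<le> y" "y \<le> pi/2" shows "g x \<le> g y"
  using g_lt[of x y] assms by (cases "x = y") auto

lemma g_le_iff: "x \<in> {0..pi/2} \<Longrightarrow> y \<in> {0..pi/2} \<Longrightarrow> g x \<le> g y \<longleftrightarrow> x \<le> y"
  using g_lt[of y x] g_le[of x y] by fastforce

lemma g_inj: "inj_on g {0..pi/2}"
  by (rule linorder_inj_onI) (auto dest: g_lt)

lemma g_diff_le:
  assumes "0 \<le> x" "x \<le> y" "y \<le> pi/2"
  shows "g y - g x \<le> (y - x) / 2"
proof -
  have "(\<lambda>u. u/2 - g u) x \<le> (\<lambda>u. u/2 - g u) y"
  proof (rule DERIV_nonneg_imp_nondecreasing[OF assms(2)])
    fix u assume "x \<le> u" "u \<le> y"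
    have "((\<lambda>u. u/2 - g u) has_real_derivative 1/2 - w u/2) (at u)"
      by (rule DERIV_diff[OF DERIV_cdivide[OF DERIV_ident] g_deriv])
    then show "\<exists>z. ((\<lambda>u. u/2 - g u) has_real_derivative z) (at u) \<and> 0 \<le> z"
      using w_le_1[of u] by (intro exI[of _ "1/2 - w u/2"]) auto
  qed
  then show ?thesis by (simp add: field_simps)
qed

text \<open>The defect \<open>u/2 - g u\<close> is nondecreasing and equals \<open>hh\<close> at
  \<open>pi/2\<close>; this is the third bound.\<close>

lemma g_bounds:
  assumes "0 \<le> u" "u \<le> pi/2"
  shows "0 \<le> g u" "g u \<le> u / 2" "u / 2 - hh \<le> g u" "g u \<le> pi/4 - hh"
  using g_le[of 0 u] g_diff_le[of 0 u] g_diff_le[of u "pi/2"] g_le[of u "pi/2"] assms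
  by (auto simp: g_pi_half field_simps)

lemma g_ge_omega:
  assumes "0 \<le> u" "u \<le> pi/4"
  shows "\<omega> * u / 2 \<le> g u"
proof -
  have "(\<lambda>u. g u - \<omega> * u / 2) 0 \<le> (\<lambda>u. g u - \<omega> * u / 2) u"
  proof (rule DERIV_nonneg_imp_nondecreasing[OF assms(1)])
    fix v assume v: "0 \<le> v" "v \<le> u"
    have "((\<lambda>u. g u - \<omega> * u / 2) has_real_derivative w v/2 - \<omega> / 2) (at v)"
      by (rule DERIV_diff[OF g_deriv]) (auto intro!: derivative_eq_intros)
    then show "\<exists>z. ((\<lambda>u. g u - \<omega> * u / 2) has_real_derivative z) (at v) \<and> 0 \<le> z"
      using w_ge_omega[of v] v assms by (intro exI[of _ "w v/2 - \<omega> / 2"]) auto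
  qed
  then show ?thesis by simp
qed

end

section \<open>Lebesgue measure of the surviving sets\<close>

lemma measure_differentiable_image_compact:
  fixes f f' :: "real \<Rightarrow> real"
  assumes S: "compact S"
    and der: "\<And>x. x \<in> S \<Longrightarrow> (f has_real_derivative f' x) (at x within S)"
    and cont: "continuous_on S f'" and inj: "inj_on f S"
  shows "measure lebesgue (f ` S) = integral S (\<lambda>x. \<bar>f' x\<bar>)"
proof -
  have "set_integrable lborel S (\<lambda>x. \<bar>f' x\<bar>)"
    unfolding set_integrable_def using S cont by (intro borel_integrable_compact continuous_intros)
  then have "(\<lambda>x. \<bar>f' x\<bar>) absolutely_integrable_on S"
    by (auto simp: set_integrable_def integrable_completion)
  \<comment> \<open>The factor 1 gives the integrand the shape required by the change of variables
    for the constant function 1.\<close>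
  then have "(\<lambda>x. \<bar>f' x\<bar> * 1) absolutely_integrable_on S \<and>
     integral S (\<lambda>x. \<bar>f' x\<bar> * 1) = integral S (\<lambda>x. \<bar>f' x\<bar>)" by simp
  then have "integral (f ` S) (\<lambda>_. 1 :: real) = integral S (\<lambda>x. \<bar>f' x\<bar>)"
    using has_absolute_integral_change_of_variables_1'[of S f f' "\<lambda>_. 1", OF _ der inj] S
    by (auto simp: fmeasurableD lmeasurable_compact)
  moreover have "f ` S \<in> lmeasurable"
    using S der by (intro lmeasurable_compact compact_continuous_image DERIV_continuous_on) auto
  ultimately show ?thesis by (simp add: lmeasure_integral)
qed

text \<open>Fubini on the pairs \<open>v \<le> x\<close> with \<open>v\<close> in \<open>A\<close>:
  integrating \<open>f x\<close> over \<open>x\<close> first gives \<open>F b - F v\<close>,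
  integrating over \<open>v\<close> first gives the measure of
  \<open>A \<inter> {0..x}\<close>.\<close>

lemma integral_layer_cake:
  fixes F f :: "real \<Rightarrow> real"
  assumes A: "compact A" "A \<subseteq> {0..b}"
    and der: "\<And>x. x \<in> {0..b} \<Longrightarrow> (F has_real_derivative f x) (at x within {0..b})"
    and cont: "continuous_on {0..b} f"
  shows "integral A (\<lambda>v. F b - F v) = integral {0..b} (\<lambda>x. f x * measure lebesgue (A \<inter> {0..x}))"
proof -
  define T where "T = (A \<times> {0..b}) \<inter> {p. fst p \<le> (snd p :: real)}"
  define h where "h v x = indicator T (v, x) *\<^sub>R f x" for v x
  have "compact T" unfolding T_def using A
    by (intro compact_Int_closed compact_Times) (auto intro!: closed_Collect_le continuous_intros)
  moreover have "continuous_on T (\<lambda>p. f (snd p))"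
    by (rule continuous_on_compose2[OF cont]) (auto simp: T_def intro!: continuous_intros)
  ultimately have "integrable lborel (\<lambda>p. indicator T p *\<^sub>R f (snd p))"
    by (rule borel_integrable_compact)
  then have "integrable (lborel \<Otimes>\<^sub>M lborel) (case_prod h)"
    unfolding lborel_prod h_def by (simp add: case_prod_unfold)
  then have "(LINT x|lborel. LINT v|lborel. h v x) = (LINT v|lborel. LINT x|lborel. h v x)"
    by (rule lborel_pair.Fubini_integral)
  moreover have "(LINT v|lborel. h v x) = indicator {0..b} x *\<^sub>R (f x * measure lebesgue (A \<inter> {0..x}))" for x
  proof -
    have "h v x = indicator (A \<inter> {0..x}) v *\<^sub>R (indicator {0..b} x *\<^sub>R f x)" for v
      using A(2) unfolding h_def T_def by (auto simp: indicator_def)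
    moreover have "A \<inter> {0..x} \<in> sets lborel" "emeasure lborel (A \<inter> {0..x}) < \<infinity>"
      using A(1) compact_Int_closed[of A "{0..x}"] emeasure_compact_finite[of "A \<inter> {0..x}"]
      by (auto intro: borel_compact simp: top.not_eq_extremum)
    ultimately show ?thesis by (simp add: measure_completion)
  qed
  moreover have "(LINT x|lborel. h v x) = indicator A v *\<^sub>R (F b - F v)" for v
  proof (cases "v \<in> A")
    case True
    then have v: "0 \<le> v" "v \<le> b" using A(2) by auto
    have eq: "h v x = indicator {v..b} x *\<^sub>R f x" for x
      unfolding h_def T_def using True v by (auto simp: indicator_def)
    have c: "continuous_on {v..b} f" by (rule continuous_on_subset[OF cont]) (use v in auto)
    have i: "set_integrable lborel {v..b} f"
      unfolding set_integrable_def by (intro borel_integrable_compact c) auto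
    have "(LINT x|lborel. h v x) = (LINT x:{v..b}|lborel. f x)"
      unfolding eq set_lebesgue_integral_def ..
    also have "\<dots> = integral {v..b} f" by (rule set_borel_integral_eq_integral(2)[OF i])
    also have "\<dots> = F b - F v"
      by (intro integral_unique fundamental_theorem_of_calculus v)
         (auto simp: has_real_derivative_iff_has_vector_derivative[symmetric]
               intro!: DERIV_subset[OF der] v order_trans[OF v(1)])
    finally show ?thesis using True by simp
  next
    case False
    then show ?thesis unfolding h_def T_def by simp
  qed
  moreover have "(LINT v|lborel. indicator A v *\<^sub>R (F b - F v)) = integral A (\<lambda>v. F b - F v)"
  proof -
    have "continuous_on A F"
      by (rule continuous_on_subset[OF DERIV_continuous_on[OF der] A(2)])
    then have "set_integrable lborel A (\<lambda>v. F b - F v)"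
      unfolding set_integrable_def by (intro borel_integrable_compact A continuous_intros)
    from set_borel_integral_eq_integral(2)[OF this] show ?thesis
      unfolding set_lebesgue_integral_def .
  qed
  moreover have "(LINT x|lborel. indicator {0..b} x *\<^sub>R (f x * measure lebesgue (A \<inter> {0..x})))
      = integral {0..b} (\<lambda>x. f x * measure lebesgue (A \<inter> {0..x}))"
  proof -
    let ?m = "\<lambda>x. measure lebesgue (A \<inter> {0..x})"
    \<comment> \<open>A monotone function is Borel and, on \<open>{0..b}\<close>, bounded by its
      value at \<open>b\<close>; this yields the integrability needed to pass from the Lebesgue to
      the gauge integral.\<close>
    have mono: "mono ?m"
      using A by (intro monoI measure_mono_fmeasurable)
        (auto intro!: lmeasurable_compact fmeasurableD compact_Int_closed)
    have "set_integrable lborel {0..b} (\<lambda>x. f x * ?m x)"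
    proof -
      have i: "set_integrable lborel {0..b} f"
        unfolding set_integrable_def by (intro borel_integrable_compact cont) auto
      have "integrable lborel (\<lambda>x. (indicator {0..b} x *\<^sub>R f x) * ?m x)"
      proof (rule Bochner_Integration.integrable_bound[where f = "\<lambda>x. ?m b * (indicator {0..b} x *\<^sub>R f x)"])
        show "integrable lborel (\<lambda>x. ?m b * (indicator {0..b} x *\<^sub>R f x))"
          using i unfolding set_integrable_def by simp
        show "(\<lambda>x. (indicator {0..b} x *\<^sub>R f x) * ?m x) \<in> borel_measurable lborel"
        proof (rule borel_measurable_times)
          show "(\<lambda>x. indicator {0..b} x *\<^sub>R f x) \<in> borel_measurable lborel"
            using i unfolding set_integrable_def by (rule borel_measurable_integrable)
          show "?m \<in> borel_measurable lborel" using borel_measurable_mono[OF mono] by simp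
        qed
        show "AE x in lborel. norm (indicator {0..b} x *\<^sub>R f x * ?m x) \<le> norm (?m b * (indicator {0..b} x *\<^sub>R f x))"
        proof (intro AE_I2)
          fix x
          have "x \<le> b \<Longrightarrow> \<bar>?m x\<bar> \<le> \<bar>?m b\<bar>" using monoD[OF mono, of x b] by simp
          then show "norm (indicator {0..b} x *\<^sub>R f x * ?m x) \<le> norm (?m b * (indicator {0..b} x *\<^sub>R f x))"
            by (auto simp: indicator_def abs_mult mult.commute intro!: mult_left_mono)
        qed
      qed
      then show ?thesis unfolding set_integrable_def by (simp add: mult.assoc)
    qed
    from set_borel_integral_eq_integral(2)[OF this] show ?thesis
      unfolding set_lebesgue_integral_def .
  qed
  ultimately show ?thesis by simp
qed

lemma integrable_on_compact:
  fixes f :: "real \<Rightarrow> real"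
  assumes "compact S" "continuous_on S f" shows "f integrable_on S"
  using set_borel_integral_eq_integral(1)[of S f] borel_integrable_compact[OF assms]
  unfolding set_integrable_def by simp

lemma integral_const_lmeasurable:
  assumes "S \<in> lmeasurable" shows "integral S (\<lambda>_. c :: real) = c * measure lebesgue S"
    and "(\<lambda>_. c :: real) integrable_on S"
  using integral_mult_right[of S c "\<lambda>_. 1 :: real"] assms
  by (simp_all add: lmeasure_integral integrable_on_const)

section \<open>Surviving sets, their distribution functions and the loss in one step\<close>

context perturbed_tent
begin

text \<open>The angular copy of the set \<open>X n\<close> below, built by pulling back along both
  branches.\<close>

fun A :: "nat \<Rightarrow> real set" where
  "A 0 = {0..pi/2}"
| "A (Suc n) = g ` A n \<union> (\<lambda>u. pi/2 - g u) ` A n"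

definition G :: "nat \<Rightarrow> real \<Rightarrow> real" where "G n t = measure lebesgue (A n \<inter> {0..t})"

definition a :: "nat \<Rightarrow> real" where "a n = measure lebesgue (A n)"

lemma A_subset: "A n \<subseteq> {0..pi/2}"
proof (induction n)
  case (Suc n)
  have "g u \<in> {0..pi/2} \<and> pi/2 - g u \<in> {0..pi/2}" if "u \<in> A n" for u
    using g_bounds[of u] that Suc hh_bounds by auto
  then show ?case by auto
qed simp

lemma A_bounds:
  assumes "u \<in> A n" shows "0 \<le> u" "u \<le> pi/2"
  using A_subset[of n] assms by auto

lemma A_compact: "compact (A n)"
proof (induction n)
  case (Suc n)
  then show ?case
    by (auto intro!: compact_Un compact_continuous_image continuous_intros g_cont)
qed simp

lemma A_lmeasurable [simp]: "A n \<in> lmeasurable" "A n \<inter> {x..y} \<in> lmeasurable"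
  by (auto intro!: lmeasurable_compact A_compact compact_Int_closed)

lemma A_refl: "(\<lambda>u. pi/2 - u) ` A n = A n"
proof (cases n)
  case 0
  have "{0..pi/2} \<subseteq> (\<lambda>u. pi/2 - u) ` {0..pi/2}"
    by (rule subsetI, rule_tac x = "pi/2 - x" in image_eqI) auto
  then show ?thesis using 0 by auto
next
  case (Suc m)
  then show ?thesis by (auto simp: image_Un image_image)
qed

lemma measure_refl:
  assumes "compact S" shows "measure lebesgue ((\<lambda>u. pi/2 - u) ` S) = measure lebesgue S"
proof -
  have "measure lebesgue ((\<lambda>u. pi/2 - u) ` S) = integral S (\<lambda>x. \<bar>- 1 :: real\<bar>)"
    by (rule measure_differentiable_image_compact[OF assms])
       (auto intro!: derivative_eq_intros inj_onI)
  then show ?thesis using assms by (simp add: lmeasure_integral lmeasurable_compact)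
qed

lemma G_nonneg: "0 \<le> G n t" unfolding G_def by simp

lemma G_pi_half: "G n (pi/2) = a n"
  unfolding G_def a_def using A_subset[of n] by (simp add: Int_absorb2)

lemma G_mono: "s \<le> t \<Longrightarrow> G n s \<le> G n t"
  unfolding G_def by (intro measure_mono_fmeasurable) (auto simp: fmeasurableD)

lemma a_nonneg: "0 \<le> a n" unfolding a_def by simp

lemma a_0: "a 0 = pi/2" unfolding a_def by simp

lemma G_0: "0 \<le> t \<Longrightarrow> t \<le> pi/2 \<Longrightarrow> G 0 t = t"
  unfolding G_def by (simp add: Int_atLeastAtMost min_def)

text \<open>Reflection swaps the two branches, so \<open>A n\<close> is symmetric, and the two
  pieces overlap only in the null set \<open>{t}\<close>. Estimates on \<open>[0, pi/4]\<close>
  thereby extend to the whole interval.\<close>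

lemma G_refl:
  assumes "0 \<le> t" "t \<le> pi/2" shows "G n (pi/2 - t) = a n - G n t"
proof -
  have "(\<lambda>u. pi/2 - u) ` (A n \<inter> {t..pi/2}) = (\<lambda>u. pi/2 - u) ` A n \<inter> (\<lambda>u. pi/2 - u) ` {t..pi/2}"
    by (rule image_Int) (auto intro: injI)
  also have "(\<lambda>u. pi/2 - u) ` {t..pi/2} = {0..pi/2 - t}" by simp
  finally have "A n \<inter> {0..pi/2 - t} = (\<lambda>u. pi/2 - u) ` (A n \<inter> {t..pi/2})" by (simp add: A_refl)
  then have "G n (pi/2 - t) = measure lebesgue (A n \<inter> {t..pi/2})"
    unfolding G_def by (simp add: measure_refl A_compact compact_Int_closed)
  moreover have "measure lebesgue (A n \<inter> {0..t} \<inter> (A n \<inter> {t..pi/2})) = 0"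
    by (rule negligible_imp_measure0, rule negligible_subset[of "{t}"]) auto
  moreover have "A n \<inter> {0..t} \<union> (A n \<inter> {t..pi/2}) = A n"
    using A_subset[of n] by force
  ultimately show ?thesis
    using measure_Un3[of "A n \<inter> {0..t}" lebesgue "A n \<inter> {t..pi/2}"] unfolding G_def a_def by simp
qed

lemma g_image_measure:
  assumes "compact S" "S \<subseteq> {0..pi/2}"
  shows "measure lebesgue (g ` S) = integral S (\<lambda>u. w u) / 2"
proof -
  have "measure lebesgue (g ` S) = integral S (\<lambda>u. \<bar>w u / 2\<bar>)"
    using assms g_inj by (intro measure_differentiable_image_compact g_deriv)
      (auto intro!: continuous_intros w_cont intro: inj_on_subset)
  also have "\<dots> = integral S (\<lambda>u. w u / 2)"
    by (rule integral_cong) (use assms(2) w_nonneg in auto)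
  finally show ?thesis by simp
qed

text \<open>Points of the reflected branch lie at or above \<open>pi/4 + hh\<close>, beyond
  \<open>g t\<close>, so only \<open>g\<close> contributes.\<close>

lemma A_Suc_Int_lower:
  assumes "0 \<le> t" "t \<le> pi/2"
  shows "A (Suc n) \<inter> {0..g t} = g ` (A n \<inter> {0..t})"
proof -
  have 1: "pi/2 - g u > g t" if "u \<in> A n" for u
    using g_bounds(4)[of u] g_bounds(4)[of t] assms A_bounds[OF that] hh_bounds(1) by linarith
  have "g u \<in> {0..g t} \<longleftrightarrow> u \<in> {0..t}" if "u \<in> A n" for u
    using g_bounds(1)[of u] g_le_iff[of u t] A_bounds[OF that] assms by auto
  then have "g ` A n \<inter> {0..g t} = g ` (A n \<inter> {0..t})" by blast
  moreover have "(\<lambda>u. pi/2 - g u) ` A n \<inter> {0..g t} = {}" by (auto dest: 1)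
  ultimately show ?thesis by (simp add: Int_Un_distrib2)
qed

lemma A_Suc_Int_left_half: "A (Suc n) \<inter> {0..pi/4} = g ` A n"
proof -
  have 1: "g u \<in> {0..pi/4}" "pi/2 - g u \<notin> {0..pi/4}" if "u \<in> A n" for u
    using g_bounds(1,4)[of u] A_bounds[OF that] hh_bounds(1) by auto
  then have "g ` A n \<inter> {0..pi/4} = g ` A n" "(\<lambda>u. pi/2 - g u) ` A n \<inter> {0..pi/4} = {}" by blast+
  then show ?thesis by (simp add: Int_Un_distrib2)
qed

lemma G_Suc:
  assumes "0 \<le> t" "t \<le> pi/2"
  shows "G (Suc n) (g t) = integral (A n \<inter> {0..t}) w / 2"
  unfolding G_def A_Suc_Int_lower[OF assms] using A_subset[of n]
  by (intro g_image_measure compact_Int_closed A_compact) auto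

lemma a_Suc: "a (Suc n) = integral (A n) w"
proof -
  have "G (Suc n) (pi/4) = integral (A n) w / 2"
    unfolding G_def A_Suc_Int_left_half by (intro g_image_measure A_compact A_subset)
  moreover have "G (Suc n) (pi/4) = a (Suc n) - G (Suc n) (pi/4)"
    using G_refl[of "pi/4" "Suc n"] pi_gt_zero by simp
  ultimately show ?thesis by simp
qed

lemma G_pi_quarter: "G (Suc n) (pi/4) = a (Suc n) / 2"
  using G_refl[of "pi/4" "Suc n"] pi_gt_zero by simp

lemma loss_eq: "a n - a (Suc n) = integral (A n) (\<lambda>u. 1 - w u)"
proof -
  have "integral (A n) (\<lambda>u. 1 - w u) = integral (A n) (\<lambda>u. 1) - integral (A n) w"
    by (intro integral_diff integral_const_lmeasurable integrable_on_compact A_compact w_cont) simp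
  then show ?thesis by (simp add: a_Suc integral_const_lmeasurable) (simp add: a_def)
qed

lemma G_Suc_le:
  assumes "0 \<le> t" "t \<le> pi/2"
  shows "G (Suc n) (g t) \<le> G n t / 2"
proof -
  have "integral (A n \<inter> {0..t}) w \<le> integral (A n \<inter> {0..t}) (\<lambda>_. 1)"
    by (intro integral_le integral_const_lmeasurable integrable_on_compact compact_Int_closed A_compact w_cont)
      (auto intro: w_le_1)
  then show ?thesis unfolding G_Suc[OF assms] by (simp add: integral_const_lmeasurable G_def)
qed

lemma G_Suc_ge_omega:
  assumes "0 \<le> t" "t \<le> pi/4"
  shows "\<omega> * G n t / 2 \<le> G (Suc n) (g t)"
proof -
  have "integral (A n \<inter> {0..t}) (\<lambda>_. \<omega>) \<le> integral (A n \<inter> {0..t}) w"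
    using assms
    by (intro integral_le integral_const_lmeasurable integrable_on_compact compact_Int_closed A_compact w_cont)
      (auto intro: w_ge_omega)
  moreover have "G (Suc n) (g t) = integral (A n \<inter> {0..t}) w / 2"
    by (rule G_Suc) (use assms in auto)
  ultimately show ?thesis by (simp add: integral_const_lmeasurable G_def[of n])
qed

text \<open>The loss inside \<open>[0, t]\<close> is at most the total loss. Unlike the bound with
  \<open>\<omega>\<close>, this one reaches up to \<open>pi/2\<close>.\<close>

lemma G_Suc_ge:
  assumes "0 \<le> t" "t \<le> pi/2"
  shows "(G n t - (a n - a (Suc n))) / 2 \<le> G (Suc n) (g t)"
proof -
  let ?S = "A n \<inter> {0..t}"
  have S: "compact ?S" by (intro compact_Int_closed A_compact) auto
  have i: "(\<lambda>u. 1 - w u) integrable_on T" if "compact T" for T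
    by (intro integrable_on_compact that continuous_intros w_cont)
  have "G n t - integral ?S w = integral ?S (\<lambda>u. 1 - w u)"
    by (subst Henstock_Kurzweil_Integration.integral_diff)
      (auto simp: integral_const_lmeasurable G_def intro!: integrable_on_compact S w_cont)
  also have "\<dots> \<le> integral (A n) (\<lambda>u. 1 - w u)"
    by (intro integral_subset_le i S A_compact) (auto simp: w_le_1)
  finally show ?thesis unfolding G_Suc[OF assms] loss_eq by simp
qed

lemma a_Suc_le: "a (Suc n) \<le> a n"
proof -
  have "0 \<le> integral (A n) (\<lambda>u. 1 - w u)"
    by (intro integral_nonneg integrable_on_compact A_compact continuous_intros w_cont) (simp add: w_le_1)
  then show ?thesis using loss_eq[of n] by simp
qed

lemma g_refl_deriv: "((\<lambda>v. g (pi/2 - v)) has_real_derivative - (wr v / 2)) (at v within S)"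
proof -
  have "((\<lambda>v. pi/2 - v) has_real_derivative - 1) (at v within S)" by (auto intro!: derivative_eq_intros)
  from DERIV_chain2[OF g_deriv this] show ?thesis by (simp add: wr_w)
qed

text \<open>By symmetry of \<open>A n\<close>, \<open>g\<close> and its reflection have the same
  image; the change of variables along the latter produces \<open>wr\<close> instead of
  \<open>w\<close>.\<close>

lemma loss_eq_wr: "a n - a (Suc n) = integral (A n) (\<lambda>v. 1 - wr v)"
proof -
  have "g ` A n = g ` ((\<lambda>u. pi/2 - u) ` A n)" by (simp only: A_refl)
  then have eq: "g ` A n = (\<lambda>v. g (pi/2 - v)) ` A n" by (simp only: image_image)
  have inj: "inj_on (\<lambda>v. g (pi/2 - v)) (A n)"
  proof (rule inj_onI)
    fix x y assume "x \<in> A n" "y \<in> A n" "g (pi/2 - x) = g (pi/2 - y)"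
    then have "pi/2 - x = pi/2 - y" using A_bounds by (auto dest: inj_onD[OF g_inj])
    then show "x = y" by simp
  qed
  have "measure lebesgue ((\<lambda>v. g (pi/2 - v)) ` A n) = integral (A n) (\<lambda>v. \<bar>- (wr v / 2)\<bar>)"
    by (rule measure_differentiable_image_compact[OF A_compact g_refl_deriv _ inj])
      (intro continuous_intros DERIV_continuous_on[OF wr_deriv], simp)
  also have "\<dots> = integral (A n) (\<lambda>v. wr v / 2)"
  proof (rule integral_cong)
    fix v assume "v \<in> A n"
    then have "0 \<le> wr v" unfolding wr_w by (intro w_nonneg) (auto dest: A_bounds)
    then show "\<bar>- (wr v / 2)\<bar> = wr v / 2" by simp
  qed
  finally have "integral (A n) w / 2 = integral (A n) wr / 2"
    by (simp add: eq[symmetric] g_image_measure A_compact A_subset)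
  moreover have "integral (A n) (\<lambda>v. 1 - wr v) = integral (A n) (\<lambda>u. 1) - integral (A n) wr"
    by (intro integral_diff integral_const_lmeasurable integrable_on_compact A_compact
        DERIV_continuous_on[OF wr_deriv]) simp
  ultimately show ?thesis by (simp add: a_Suc integral_const_lmeasurable) (simp add: a_def)
qed

text \<open>Layer cake for \<open>wr (pi/2) - wr v\<close>, the integral of \<open>wr'\<close> from
  \<open>v\<close> to \<open>pi/2\<close>. The loss becomes linear in \<open>G n\<close>, with a
  kernel \<open>wr'\<close> of total mass at most 1 and first moment
  O(\<open>\<tau>\<close>).\<close>

lemma loss_formula:
  "a n - a (Suc n) = (1 - wr (pi/2)) * a n + integral {0..pi/2} (\<lambda>v. wr' v * G n v)"
proof -
  have c: "continuous_on (A n) wr" by (rule DERIV_continuous_on[OF wr_deriv])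
  have "integral (A n) (\<lambda>v. 1 - wr v) = integral (A n) (\<lambda>v. (1 - wr (pi/2)) + (wr (pi/2) - wr v))"
    by (simp add: algebra_simps)
  also have "\<dots> = (1 - wr (pi/2)) * a n + integral (A n) (\<lambda>v. wr (pi/2) - wr v)"
    by (subst Henstock_Kurzweil_Integration.integral_add)
      (auto simp: integral_const_lmeasurable a_def intro!: integrable_on_compact A_compact continuous_intros c)
  also have "integral (A n) (\<lambda>v. wr (pi/2) - wr v) = integral {0..pi/2} (\<lambda>v. wr' v * G n v)"
    unfolding G_def by (rule integral_layer_cake[OF A_compact A_subset wr_deriv wr'_cont])
  finally show ?thesis unfolding loss_eq_wr .
qed

text \<open>The density \<open>1 - wr\<close> is at most 1 before \<open>v\<close> and, as
  \<open>wr\<close> increases, at most \<open>1 - wr v\<close> after it.\<close>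

lemma loss_le_split:
  assumes "0 \<le> v" "v \<le> pi/2"
  shows "a n - a (Suc n) \<le> G n v + (1 - wr v) * a n"
proof -
  have c: "continuous_on S wr" for S by (rule DERIV_continuous_on[OF wr_deriv])
  have eq: "{0..v} \<inter> A n = A n \<inter> {0..v}" by blast
  have "integral (A n) (\<lambda>v. 1 - wr v) \<le> integral (A n) (\<lambda>x. indicator {0..v} x + (1 - wr v))"
  proof (rule integral_le)
    show "(\<lambda>v. 1 - wr v) integrable_on A n"
      by (intro integrable_on_compact A_compact continuous_intros c)
    have "(indicator {0..v} :: real \<Rightarrow> real) integrable_on A n"
      using integrable_on_indicator[of "{0..v}" "A n"] by (simp add: eq)
    then show "(\<lambda>x. indicator {0..v} x + (1 - wr v)) integrable_on A n"
      by (intro integrable_add integral_const_lmeasurable) auto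
    fix x assume "x \<in> A n"
    then have x: "0 \<le> x" "x \<le> pi/2" using A_subset[of n] by auto
    show "1 - wr x \<le> indicator {0..v} x + (1 - wr v)"
    proof (cases "x \<le> v")
      case True
      have "0 \<le> wr x" "wr v \<le> 1" unfolding wr_w using x w_le_1 by (auto intro!: w_nonneg)
      then show ?thesis using True x by simp
    next
      case False
      then have "wr v \<le> wr x" by (intro wr_mono) (use assms x in auto)
      then show ?thesis using False by simp
    qed
  qed
  also have "\<dots> = G n v + (1 - wr v) * a n"
    by (subst Henstock_Kurzweil_Integration.integral_add)
      (auto simp: integral_const_lmeasurable a_def G_def integral_indicator integrable_on_indicator eq)
  finally show ?thesis unfolding loss_eq_wr .
qed

end

section \<open>Equidistribution and the escape rate\<close>

context perturbed_tent
begin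

lemma g_iter_bounds: "0 \<le> (g ^^ k) (pi/2)" "(g ^^ k) (pi/2) \<le> pi/2 / 2 ^ k"
proof (induction k)
  case (Suc k)
  have "pi/2 / 2 ^ k \<le> pi/2" by (simp add: divide_le_eq)
  then have "(g ^^ k) (pi/2) \<le> pi/2" using Suc by linarith
  with Suc g_bounds(1,2)[of "(g ^^ k) (pi/2)"]
  show "0 \<le> (g ^^ Suc k) (pi/2)" "(g ^^ Suc k) (pi/2) \<le> pi/2 / 2 ^ Suc k" by auto
qed auto

lemma g_iter_le_pi_half: "(g ^^ k) (pi/2) \<le> pi/2"
  using g_iter_bounds(2)[of k] by (rule order_trans) (simp add: divide_le_eq)

text \<open>Each pull-back by \<open>g\<close> at most halves the mass and uses up one level. For
  \<open>n < k\<close> the subtraction truncates at level 0, where mass is length and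
  \<open>g_iter_bounds\<close> applies.\<close>

lemma G_iter_le: "G n ((g ^^ k) (pi/2)) \<le> a (n - k) / 2 ^ k"
proof (induction k arbitrary: n)
  case 0
  then show ?case by (simp add: G_pi_half)
next
  case (Suc k)
  show ?case
  proof (cases n)
    case 0
    then show ?thesis
      using G_0[of "(g ^^ Suc k) (pi/2)"] g_iter_bounds[of "Suc k"] g_iter_le_pi_half[of "Suc k"]
      by (simp add: a_0)
  next
    case (Suc m)
    have "G n ((g ^^ Suc k) (pi/2)) \<le> G m ((g ^^ k) (pi/2)) / 2"
      unfolding Suc using G_Suc_le[of "(g ^^ k) (pi/2)" m] g_iter_bounds(1)[of k] g_iter_le_pi_half[of k]
      by simp
    also have "\<dots> \<le> a (m - k) / 2 ^ k / 2" using Suc.IH[of m] by simp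
    finally show ?thesis unfolding Suc by simp
  qed
qed

text \<open>The lower slope \<open>\<omega>/2\<close> holds only on \<open>[0, pi/4]\<close>. The
  first step, from \<open>pi/2\<close> to \<open>pi/4 - hh \<ge> pi/8\<close>, is treated
  separately, which is why \<open>pi/4\<close> stands in place of \<open>pi/2\<close>.\<close>

lemma g_iter_ge:
  assumes "hh \<le> pi/8"
  shows "(\<omega>/2) ^ k * (pi/4) \<le> (g ^^ k) (pi/2)"
proof (induction k)
  case (Suc k)
  show ?case
  proof (cases k)
    case 0
    have "\<omega> * pi \<le> 1 * pi" by (intro mult_right_mono omega_le_1) auto
    then have "\<omega> / 2 * (pi / 4) \<le> g (pi/2)" unfolding g_pi_half using assms by linarith
    then show ?thesis using 0 by simp
  next
    case (Suc m)
    have "(g ^^ k) (pi/2) \<le> pi/4"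
      using g_bounds(4)[of "(g ^^ m) (pi/2)"] g_iter_bounds(1)[of m] g_iter_le_pi_half[of m] hh_bounds(1)
      unfolding Suc by simp
    then have "\<omega> * (g ^^ k) (pi/2) / 2 \<le> (g ^^ Suc k) (pi/2)"
      using g_ge_omega[of "(g ^^ k) (pi/2)"] g_iter_bounds(1)[of k] by simp
    moreover have "\<omega>/2 * ((\<omega>/2) ^ k * (pi/4)) \<le> \<omega>/2 * (g ^^ k) (pi/2)"
      using Suc.IH omega_pos by (intro mult_left_mono) auto
    moreover have "(\<omega>/2) ^ Suc k * (pi/4) = \<omega>/2 * ((\<omega>/2) ^ k * (pi/4))" by simp
    ultimately show ?thesis by linarith
  qed
qed simp

end

lemma half_le_sin: "0 \<le> x \<Longrightarrow> x \<le> pi/3 \<Longrightarrow> x / 2 \<le> sin (x::real)"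
proof -
  assume x: "0 \<le> x" "x \<le> pi/3"
  have "(\<lambda>x. sin x - x / 2) 0 \<le> (\<lambda>x. sin x - x / 2) x"
  proof (rule DERIV_nonneg_imp_nondecreasing[OF x(1)])
    fix y assume y: "0 \<le> y" "y \<le> x"
    have "((\<lambda>x. sin x - x / 2) has_real_derivative cos y - 1/2) (at y)"
      by (auto intro!: derivative_eq_intros)
    moreover have "cos (pi/3) \<le> cos y" using y x by (intro cos_monotone_0_pi_le) auto
    ultimately show "\<exists>z. ((\<lambda>x. sin x - x / 2) has_real_derivative z) (at y) \<and> 0 \<le> z"
      by (auto simp: cos_60)
  qed
  then show ?thesis by simp
qed

lemma power2_ge_linear: "8 \<le> k \<Longrightarrow> 16 * (real k + 1) * 3 / 2 \<le> 2 ^ k"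
proof (induction k rule: dec_induct)
  case (step n)
  then show ?case by (simp add: algebra_simps)
qed simp

section \<open>Crude loss bound and equidistribution at macroscopic scale\<close>

locale perturbed_tent_scale = perturbed_tent +
  fixes k :: nat
  assumes k_ge: "8 \<le> k" and tau_le: "\<tau> \<le> 1 / 4 ^ k" and tau_gt: "1 / 4 ^ Suc k < \<tau>"
begin

text \<open>Comparable to the square root of \<open>\<tau>\<close>: the locale assumptions give
  \<open>4 * sqrt \<tau> \<le> \<theta> < 8 * sqrt \<tau>\<close>. As \<open>g\<close> roughly
  halves distances to 0, about \<open>k\<close> steps lead from scale 1 to
  \<open>sqrt \<tau>\<close> and \<open>2 * k\<close> steps to \<open>\<tau>\<close>. The bound
  \<open>8 \<le> k\<close> makes \<open>6 * (k + 1) * \<theta> \<le> 1\<close>.\<close>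

definition \<theta> :: real where "\<theta> = 4 / 2 ^ k"

lemma theta_pos: "0 < \<theta>" unfolding \<theta>_def by simp

lemma theta_k: "(real k + 1) * 6 * \<theta> \<le> 1"
  using power2_ge_linear[OF k_ge] unfolding \<theta>_def by (simp add: field_simps)

lemma theta_le: "\<theta> \<le> 1 / 54"
proof -
  have "9 * 6 * \<theta> \<le> (real k + 1) * 6 * \<theta>" using k_ge theta_pos by (intro mult_right_mono) auto
  then show ?thesis using theta_k by simp
qed

lemma four_pow: "(4::real) ^ k = 2 ^ k * 2 ^ k" by (simp flip: power_mult_distrib)

lemma tau_le_theta: "\<tau> \<le> \<theta> ^ 2 / 16"
  using tau_le unfolding \<theta>_def four_pow by (simp add: power2_eq_square)

lemma tau_le_theta': "\<tau> \<le> \<theta>"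
proof -
  have "\<theta> * \<theta> \<le> \<theta> * 1" using theta_pos theta_le by (intro mult_left_mono) auto
  then show ?thesis using tau_le_theta theta_pos unfolding power2_eq_square by linarith
qed

lemma tau_sq_le: "\<tau>\<^sup>2 \<le> \<theta>"
proof -
  have "\<tau> * \<tau> \<le> \<tau> * 1" using tau_pos tau_le_theta' theta_le by (intro mult_left_mono) auto
  then show ?thesis using tau_le_theta' by (simp add: power2_eq_square)
qed

lemma hh_le: "hh \<le> \<theta>" "hh \<le> pi/8"
  using hh_bounds tau_le_theta' theta_le tau_pos pi_gt3 by auto

lemma omega_pow: "1 - real m * \<theta> \<le> \<omega> ^ m"
proof -
  have "1 + real m * (- \<theta>) \<le> (1 + - \<theta>) ^ m"
    by (rule Bernoulli_inequality) (use theta_le in auto)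
  also have "\<dots> \<le> \<omega> ^ m"
    using omega_ge tau_sq_le theta_le by (intro power_mono) auto
  finally show ?thesis by simp
qed

text \<open>Cut at \<open>v\<close>, the \<open>k\<close>-th iterate of \<open>pi/2\<close>, of size
  about \<open>\<theta>\<close>. The mass below \<open>v\<close> is at most
  \<open>a (n - k) / 2 ^ k\<close>, and the induction hypothesis over \<open>k\<close> steps gives
  \<open>a (n - k) \<le> 2 * a n\<close>. Above \<open>v\<close> the density is
  O(\<open>\<tau>^2 / v^2\<close>), hence O(\<open>\<theta>^2\<close>). Each part is at most
  \<open>\<theta>/2 * a n\<close>.\<close>

lemma loss_le: "a n - a (Suc n) \<le> \<theta> * a n"
proof (induction n rule: less_induct)
  case (less n)
  have step: "(1 - \<theta>) ^ j * a (n - j) \<le> a n" if "j \<le> n" for j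
    using that
  proof (induction j)
    case (Suc j)
    have "(1 - \<theta>) * a (n - Suc j) \<le> a (n - j)"
      using less.IH[of "n - Suc j"] Suc.prems by (simp add: Suc_diff_Suc algebra_simps)
    then have "(1 - \<theta>) ^ j * ((1 - \<theta>) * a (n - Suc j)) \<le> (1 - \<theta>) ^ j * a (n - j)"
      using theta_le by (intro mult_left_mono) auto
    then show ?case using Suc by (simp add: algebra_simps)
  qed simp
  \<comment> \<open>For \<open>n < k\<close> only \<open>n\<close> steps are available;
    \<open>n - k\<close> is then 0 and the surplus factors \<open>1 - \<theta>\<close> are at most
    1.\<close>
  have "(1 - \<theta>) ^ k * a (n - k) \<le> (1 - \<theta>) ^ (min k n) * a (n - min k n)"
    using theta_pos theta_le a_nonneg by (auto simp: min_def intro!: mult_mono power_decreasing)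
  also have "\<dots> \<le> a n" by (rule step) simp
  finally have "(1 - \<theta>) ^ k * a (n - k) \<le> a n" .
  moreover have "1 / 2 \<le> (1 - \<theta>) ^ k"
  proof -
    have "1 + real k * (- \<theta>) \<le> (1 + - \<theta>) ^ k"
      by (rule Bernoulli_inequality) (use theta_le in auto)
    then show ?thesis using theta_k theta_pos by (simp add: algebra_simps)
  qed
  then have "1/2 * a (n - k) \<le> (1 - \<theta>) ^ k * a (n - k)" by (intro mult_right_mono a_nonneg)
  ultimately have ank: "a (n - k) \<le> 2 * a n" by simp
  define v where "v = (g ^^ k) (pi/2)"
  have G: "G n v \<le> \<theta> / 2 * a n"
  proof -
    have "G n v \<le> a (n - k) / 2 ^ k" unfolding v_def by (rule G_iter_le)
    also have "\<dots> \<le> 2 * a n / 2 ^ k" using ank by (intro divide_right_mono) auto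
    finally show ?thesis unfolding \<theta>_def by simp
  qed
  have vle: "v \<le> pi/3"
  proof -
    have "v \<le> pi/2 / 2 ^ k" unfolding v_def by (rule g_iter_bounds)
    also have "\<dots> \<le> pi/2 / 2 ^ 8" using k_ge by (intro divide_left_mono power_increasing) auto
    also have "\<dots> \<le> pi/3" by simp
    finally show ?thesis .
  qed
  have v_ge: "\<theta> / 12 \<le> v"
  proof -
    have "1 / 2 \<le> \<omega> ^ k" using omega_pow[of k] theta_k theta_pos by (simp add: algebra_simps)
    then have "1 / 2 * (1 / 2 ^ k * (pi/4)) \<le> \<omega> ^ k * (1 / 2 ^ k * (pi/4))"
      by (intro mult_right_mono) auto
    also have "\<dots> = (\<omega>/2) ^ k * (pi/4)" by (simp add: power_divide)
    also have "\<dots> \<le> v" unfolding v_def by (rule g_iter_ge[OF hh_le(2)])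
    finally have "pi / 8 / 2 ^ k \<le> v" by simp
    \<comment> \<open>\<open>\<theta> / 12\<close> is \<open>(1/3) / 2 ^ k\<close>.\<close>
    moreover have "(1/3) / 2 ^ k \<le> pi / 8 / 2 ^ k" using pi_gt3 by (intro divide_right_mono) auto
    ultimately show ?thesis unfolding \<theta>_def by simp
  qed
  have v0: "0 < v" using v_ge theta_pos by linarith
  have "\<theta> / 24 \<le> sin v" using half_le_sin[of v] v_ge v0 vle by linarith
  then have s: "(\<theta> / 24)\<^sup>2 \<le> (sin v)\<^sup>2" using theta_pos by (intro power_mono) auto
  have "1 - wr v \<le> \<tau>\<^sup>2 / (2 * (sin v)\<^sup>2)" using v0 vle pi_gt_zero by (intro one_minus_wr_le) auto
  also have "\<dots> \<le> \<tau>\<^sup>2 / (2 * (\<theta> / 24)\<^sup>2)"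
    using s theta_pos by (intro divide_left_mono mult_left_mono mult_pos_pos) auto
  also have "\<dots> \<le> (\<theta> ^ 2 / 16)\<^sup>2 / (2 * (\<theta> / 24)\<^sup>2)"
    using tau_le_theta tau_pos by (intro divide_right_mono power_mono) auto
  also have "\<dots> = 288 / 256 * \<theta>\<^sup>2" using theta_pos by (simp add: field_simps power2_eq_square)
  also have "\<dots> \<le> \<theta> / 2" using theta_le theta_pos by (simp add: power2_eq_square)
  finally have "(1 - wr v) * a n \<le> \<theta> / 2 * a n" by (intro mult_right_mono a_nonneg)
  moreover have "a n - a (Suc n) \<le> G n v + (1 - wr v) * a n"
    using v0 vle pi_gt_zero by (intro loss_le_split) auto
  ultimately show ?case using G by (simp add: algebra_simps)
qed

lemma a_Suc_ge: "(1 - \<theta>) * a n \<le> a (Suc n)"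
  using loss_le[of n] by (simp add: algebra_simps)

text \<open>One step halves the inherited error and adds at most \<open>2 * \<theta> * a n\<close>:
  one \<open>\<theta>\<close> from the defect \<open>s/2 - g s \<le> hh\<close>, one from the lost
  mass. From 8 this makes \<open>4 + 1 + 1 = 6\<close>, and
  \<open>6 * a n \<le> 8 * a (Suc n)\<close> because
  \<open>a (Suc n) \<ge> (1 - \<theta>) * a n\<close>.\<close>

lemma G_equidistributed:
  assumes "0 \<le> t" "t \<le> pi/2"
  shows "\<bar>G n t - 2/pi * t * a n\<bar> \<le> 8 * \<theta> * a n"
  using assms
proof (induction n arbitrary: t)
  case 0
  then show ?case using theta_pos by (simp add: G_0 a_0)
next
  case (Suc n)
  let ?D = "\<lambda>t. G (Suc n) t - 2/pi * t * a (Suc n)"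
  have e: "6 * \<theta> * a n \<le> 8 * \<theta> * a (Suc n)"
  proof -
    have "6 * \<theta> * a n \<le> 8 * \<theta> * ((1 - \<theta>) * a n)"
    proof -
      have "0 \<le> \<theta> * a n * (2 - 8 * \<theta>)" using theta_pos theta_le a_nonneg[of n] by simp
      then show ?thesis by (simp add: algebra_simps)
    qed
    also have "\<dots> \<le> 8 * \<theta> * a (Suc n)" using theta_pos a_Suc_ge[of n] by (intro mult_left_mono) auto
    finally show ?thesis .
  qed
  have left: "\<bar>?D (g s)\<bar> \<le> 8 * \<theta> * a (Suc n)" if s: "0 \<le> s" "s \<le> pi/2" for s
  proof -
    have IH: "\<bar>G n s - 2/pi * s * a n\<bar> \<le> 8 * \<theta> * a n" by (rule Suc.IH[OF s])
    have p: "0 \<le> 2/pi" "2/pi \<le> 1" using pi_gt3 by (auto simp: divide_le_eq)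
    have gs: "0 \<le> g s" "s / 2 - \<theta> \<le> g s" "g s \<le> s / 2" "g s \<le> pi / 4"
      using g_bounds[OF s] hh_le hh_bounds(1) by auto
    have "?D (g s) \<le> 6 * \<theta> * a n"
    proof -
      have "2/pi * (g s) * ((1 - \<theta>) * a n) \<le> 2/pi * (g s) * a (Suc n)"
        using p gs a_Suc_ge[of n] by (intro mult_left_mono) auto
      then have "?D (g s) \<le> G n s / 2 - 2/pi * (g s) * ((1 - \<theta>) * a n)"
        using G_Suc_le[OF s, of n] by linarith
      also have "\<dots> \<le> 4 * \<theta> * a n + 2/pi * (s/2 - g s) * a n + (2/pi * g s) * (\<theta> * a n)"
        using IH by (simp add: algebra_simps abs_le_iff)
      also have "2/pi * (s/2 - g s) * a n \<le> 1 * \<theta> * a n"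
        using p gs theta_pos by (intro mult_right_mono mult_mono a_nonneg) auto
      also have "(2/pi * g s) * (\<theta> * a n) \<le> 1 * (\<theta> * a n)"
        using gs theta_pos a_nonneg[of n] by (intro mult_right_mono) (auto simp: field_simps)
      finally show ?thesis by (simp add: algebra_simps)
    qed
    moreover have "- (6 * \<theta> * a n) \<le> ?D (g s)"
    proof -
      define X Y T where "X = 2/pi * s * a n" and "Y = 2/pi * g s * a (Suc n)" and "T = \<theta> * a n"
      have "2/pi * (g s) * a (Suc n) \<le> 2/pi * (s/2) * a n"
        using p gs a_Suc_le[of n] a_nonneg s by (intro mult_mono) auto
      then have "Y \<le> X / 2" unfolding X_def Y_def by simp
      moreover have "(G n s - (a n - a (Suc n))) / 2 \<le> G (Suc n) (g s)" by (rule G_Suc_ge[OF s])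
      moreover have "0 \<le> T" unfolding T_def using theta_pos a_nonneg by simp
      moreover have "X - 8 * T \<le> G n s" using IH unfolding X_def T_def by (simp add: abs_le_iff)
      moreover have "a n - a (Suc n) \<le> T" unfolding T_def by (rule loss_le)
      ultimately have "- (6 * T) \<le> G (Suc n) (g s) - Y" by (simp add: field_simps)
      then show ?thesis unfolding T_def Y_def by simp
    qed
    ultimately show ?thesis using e by (simp add: abs_le_iff)
  qed
  \<comment> \<open>The left half is the image of \<open>g\<close> together with half of the gap. In
    the gap \<open>G\<close> is constant and the linear function is off by at most
    \<open>2/pi * hh * a (Suc n)\<close>.\<close>
  have half: "\<bar>?D t\<bar> \<le> 8 * \<theta> * a (Suc n)" if t: "0 \<le> t" "t \<le> pi/4" for t
  proof (cases "t \<le> g (pi/2)")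
    case True
    have "\<exists>s\<ge>0. s \<le> pi/2 \<and> g s = t"
      by (rule IVT') (use True t g_cont in auto)
    then show ?thesis using left by auto
  next
    case False
    have "G (Suc n) t = a (Suc n) / 2"
    proof (rule antisym)
      show "G (Suc n) t \<le> a (Suc n) / 2" using G_mono[OF t(2), of "Suc n"] G_pi_quarter by simp
      have "A (Suc n) \<inter> {0..pi/4} \<subseteq> A (Suc n) \<inter> {0..t}"
        unfolding A_Suc_Int_left_half
      proof
        fix x assume "x \<in> g ` A n"
        then obtain u where u: "u \<in> A n" "x = g u" by auto
        then have "x \<in> A (Suc n)" by simp
        moreover have "0 \<le> x" "x \<le> g (pi/2)"
          using u A_bounds[OF u(1)] g_bounds(1)[of u] g_le[of u "pi/2"] by auto
        ultimately show "x \<in> A (Suc n) \<inter> {0..t}" using False by auto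
      qed
      then have "G (Suc n) (pi/4) \<le> G (Suc n) t"
        unfolding G_def by (intro measure_mono_fmeasurable) (auto simp: fmeasurableD simp del: A.simps)
      then show "a (Suc n) / 2 \<le> G (Suc n) t" by (simp add: G_pi_quarter)
    qed
    then have "?D t = 2/pi * (pi/4 - t) * a (Suc n)" by (simp add: field_simps)
    moreover have "\<dots> \<le> 1 * \<theta> * a (Suc n)"
      using False t hh_le a_nonneg pi_gt3 by (intro mult_right_mono mult_mono) (auto simp: g_pi_half divide_le_eq)
    moreover have "0 \<le> 2/pi * (pi/4 - t) * a (Suc n)" using t a_nonneg by simp
    moreover have "0 \<le> \<theta> * a (Suc n)" using theta_pos a_nonneg by simp
    ultimately show ?thesis by (simp del: A.simps)
  qed
  show ?case
  proof (cases "t \<le> pi/4")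
    case True
    then show ?thesis using half Suc.prems by simp
  next
    case False
    have "G (Suc n) (pi/2 - t) = a (Suc n) - G (Suc n) t" by (rule G_refl) (use Suc.prems in auto)
    moreover have "2/pi * (pi/2 - t) * a (Suc n) = a (Suc n) - 2/pi * t * a (Suc n)"
      by (simp add: field_simps)
    ultimately have "?D t = - ?D (pi/2 - t)" by simp
    then show ?thesis using half[of "pi/2 - t"] False Suc.prems by simp
  qed
qed

text \<open>Growth of the multiplicative error per pull-back: \<open>1 / \<omega>\<close> for the
  deviation of \<open>g\<close> from halving, \<open>1 / (1 - \<theta>)\<close> for the mass lost
  between two levels.\<close>

definition R :: real where "R = 1 / (\<omega> * (1 - \<theta>))"

lemma R_ge_1: "1 \<le> R" "1 / \<omega> \<le> R"
proof -
  have 1: "\<omega> * (1 - \<theta>) \<le> \<omega> * 1" using theta_pos omega_pos by (intro mult_left_mono) auto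
  then show "1 / \<omega> \<le> R" unfolding R_def using omega_pos theta_le by (intro divide_left_mono) auto
  moreover have "1 \<le> 1 / \<omega>" using omega_pos omega_le_1 by simp
  ultimately show "1 \<le> R" by linarith
qed

lemma a_le_R: "a n \<le> \<omega> * R * a (Suc n)"
proof -
  have "\<omega> * R = 1 / (1 - \<theta>)" unfolding R_def using omega_pos theta_le by simp
  then show ?thesis using a_Suc_ge[of n] theta_le by (simp add: pos_le_divide_eq mult.commute)
qed

lemma g_pi_quarter_ge: "1 / 6 \<le> g (pi/4)"
proof -
  have "1 - \<theta> \<le> \<omega>" using omega_ge tau_sq_le by linarith
  then have "8 / 9 \<le> \<omega>" using theta_le by linarith
  then have "8 / 9 * (3 / 4) / 2 \<le> \<omega> * (pi/4) / 2"
    using pi_gt3 by (intro divide_right_mono mult_mono) auto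
  also have "\<dots> \<le> g (pi/4)" using g_ge_omega[of "pi/4"] by simp
  finally show ?thesis by simp
qed

text \<open>
  Every pull-back by the branch \<open>g\<close> halves the additive error and costs only a factor
  close to 1 in the multiplicative one, so equidistribution at macroscopic scale
  propagates down to the scale \<open>\<tau>\<close>.
\<close>

lemma G_equidistributed_micro:
  assumes "0 \<le> v" "v \<le> pi/2"
  shows "\<bar>G n v - 2/pi * v * a n\<bar> \<le> (((2/pi + 48 * \<theta>) * R ^ j - 2/pi) * v + 8 * \<theta> * (R/2) ^ j) * a n"
  using assms
proof (induction j arbitrary: n v)
  case 0
  have "0 \<le> 48 * \<theta> * v * a n" using 0 theta_pos a_nonneg by simp
  then show ?case using G_equidistributed[OF 0, of n] by (simp add: algebra_simps)
next
  case (Suc j)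
  \<comment> \<open>In units of \<open>a m\<close>, the induction hypothesis places
    \<open>G m s\<close> between \<open>(4/pi - E) * s - r\<close> and \<open>E * s + r\<close>,
    with slopes symmetric about \<open>2/pi\<close>. A pull-back replaces \<open>E\<close> by
    \<open>E * R\<close> and \<open>r\<close> by \<open>r * R / 2\<close>.\<close>
  define E where "E = (2/pi + 48 * \<theta>) * R ^ j"
  define r where "r = 8 * \<theta> * (R/2) ^ j"
  have E: "2/pi + 48 * \<theta> \<le> E"
  proof -
    have "(2/pi + 48 * \<theta>) * 1 \<le> E" unfolding E_def
      using R_ge_1 theta_pos by (intro mult_left_mono one_le_power) auto
    then show ?thesis by simp
  qed
  have r: "0 \<le> r" unfolding r_def using theta_pos R_ge_1 by simp
  have ER: "E \<le> E * R" "2/pi + 48 * \<theta> \<le> E * R"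
  proof -
    have "0 \<le> E" using E theta_pos pi_gt_zero by (smt (verit) divide_nonneg_pos)
    then have "E * 1 \<le> E * R" using R_ge_1 by (intro mult_left_mono) auto
    then show "E \<le> E * R" "2/pi + 48 * \<theta> \<le> E * R" using E by auto
  qed
  have goal: "((2/pi + 48 * \<theta>) * R ^ Suc j - 2/pi) * v + 8 * \<theta> * (R/2) ^ Suc j = (E * R - 2/pi) * v + r * R / 2"
    unfolding E_def r_def by (simp add: algebra_simps)
  have rR: "0 \<le> r * R / 2" using r R_ge_1 by simp
  consider "n = 0" | "g (pi/4) \<le> v" | m where "n = Suc m" "v < g (pi/4)" by (metis not_less not0_implies_Suc)
  then show ?case unfolding goal
  proof cases
    case 1
    then have "G n v - 2/pi * v * a n = 0" using Suc.prems by (simp add: G_0 a_0)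
    moreover have "0 \<le> ((E * R - 2/pi) * v + r * R / 2) * a n"
      using ER(2) theta_pos Suc.prems rR a_nonneg
      by (intro mult_nonneg_nonneg add_nonneg_nonneg) auto
    ultimately show "\<bar>G n v - 2/pi * v * a n\<bar> \<le> ((E * R - 2/pi) * v + r * R / 2) * a n" by simp
  next
    \<comment> \<open>For macroscopic \<open>v\<close> no pull-back is needed: 48 is chosen so that
      \<open>8 * \<theta> \<le> 48 * \<theta> * v\<close> when \<open>v \<ge> 1/6\<close>.\<close>
    case 2
    have "8 * \<theta> = 48 * \<theta> * (1 / 6)" by simp
    also have "\<dots> \<le> (E * R - 2/pi) * v"
      using ER(2) g_pi_quarter_ge 2 theta_pos by (intro mult_mono) auto
    also have "\<dots> \<le> (E * R - 2/pi) * v + r * R / 2" using rR by simp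
    finally have "8 * \<theta> * a n \<le> ((E * R - 2/pi) * v + r * R / 2) * a n"
      by (intro mult_right_mono a_nonneg)
    then show "\<bar>G n v - 2/pi * v * a n\<bar> \<le> ((E * R - 2/pi) * v + r * R / 2) * a n"
      using G_equidistributed[OF Suc.prems, of n] by linarith
  next
    case (3 m)
    have "\<exists>s\<ge>0. s \<le> pi/4 \<and> g s = v"
      by (rule IVT') (use 3 Suc.prems g_cont in auto)
    then obtain s where s: "0 \<le> s" "s \<le> pi/4" "g s = v" by auto
    have s': "s \<le> pi/2" using s pi_gt_zero by linarith
    have sv: "2 * v \<le> s" "\<omega> * s \<le> 2 * v"
      using g_bounds(2)[OF s(1) s'] g_ge_omega[OF s(1,2)] s(3) by auto
    have IH: "\<bar>G m s - 2/pi * s * a m\<bar> \<le> ((E - 2/pi) * s + r) * a m"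
      using Suc.IH[OF s(1) s', of m] unfolding E_def r_def .
    have am: "0 \<le> a m" "a n \<le> a m" "a m \<le> \<omega> * R * a n" "0 \<le> a n"
      using a_nonneg a_Suc_le[of m] a_le_R[of m] 3(1) by auto
    have wR: "\<omega> * R \<le> R" using omega_le_1 R_ge_1 by (simp add: mult_le_cancel_right2)
    have rm: "r / 2 * a m \<le> r * R / 2 * a n"
    proof -
      have "a m \<le> R * a n" using am(3) mult_right_mono[OF wR am(4)] by linarith
      then have "r / 2 * a m \<le> r / 2 * (R * a n)" using r by (intro mult_left_mono) auto
      then show ?thesis by simp
    qed
    have "G n v - 2/pi * v * a n \<le> ((E * R - 2/pi) * v + r * R / 2) * a n"
    proof -
      have "G n v \<le> G m s / 2" using G_Suc_le[OF s(1) s', of m] s(3) 3(1) by simp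
      also have "\<dots> \<le> (E * s / 2) * a m + r / 2 * a m"
      proof -
        have eq: "((E - 2/pi) * s + r) * a m = E * s * a m + r * a m - 2/pi * s * a m"
          by (simp add: algebra_simps)
        have "G m s - 2/pi * s * a m \<le> E * s * a m + r * a m - 2/pi * s * a m"
          using IH unfolding eq by (rule order_trans[OF abs_ge_self])
        then show ?thesis by simp
      qed
      also have "(E * s / 2) * a m \<le> E * s / 2 * (\<omega> * R * a n)"
        using am E theta_pos s pi_gt_zero
        by (intro mult_left_mono) (auto intro!: mult_nonneg_nonneg order_trans[OF _ E] add_nonneg_nonneg)
      also have "\<dots> = (\<omega> * s) * (E * R * a n / 2)" by simp
      also have "\<dots> \<le> (2 * v) * (E * R * a n / 2)"
        using sv am ER(2) theta_pos pi_gt_zero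
        by (intro mult_right_mono) (auto intro!: mult_nonneg_nonneg order_trans[OF _ ER(2)] add_nonneg_nonneg)
      finally show ?thesis using rm by (simp add: algebra_simps)
    qed
    moreover have "- (((E * R - 2/pi) * v + r * R / 2) * a n) \<le> G n v - 2/pi * v * a n"
    \<comment> \<open>If \<open>E > 4/pi\<close>, the claimed lower bound is nonpositive, hence
      trivial; otherwise \<open>4/pi - E\<close> is nonnegative and preserves the inequality
      \<open>2 * v \<le> s\<close>.\<close>
    proof (cases "E \<le> 4/pi")
      case True
      have "(4/pi - E) * (2 * v) * a n \<le> (4/pi - E) * s * a m"
        using True sv am Suc.prems by (intro mult_mono) auto
      also have "\<dots> = 2/pi * s * a m - (E - 2/pi) * s * a m" by (simp add: algebra_simps)
      also have "\<dots> \<le> G m s + r * a m"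
      proof -
        have "((E - 2/pi) * s + r) * a m = (E - 2/pi) * s * a m + r * a m" by (simp add: distrib_right)
        then have "- ((E - 2/pi) * s * a m + r * a m) \<le> G m s - 2/pi * s * a m"
          using IH by (simp only: abs_le_iff minus_le_iff)
        moreover have "- (x + y) \<le> z - u \<Longrightarrow> u - x \<le> z + y" for x y z u :: real by simp
        ultimately show ?thesis by blast
      qed
      finally have "\<omega> * ((4/pi - E) * (2 * v) * a n) \<le> \<omega> * (G m s + r * a m)"
        using omega_pos by (intro mult_left_mono) auto
      moreover have "\<omega> * G m s / 2 \<le> G n v" using G_Suc_ge_omega[OF s(1,2), of m] s(3) 3(1) by simp
      moreover have "\<omega> * (r * a m) \<le> 1 * (r * a m)"
        using omega_le_1 r am by (intro mult_right_mono) auto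
      moreover have "\<omega> * (P * v * x) \<le> y + r / 2 * z"
        if "\<omega> * (P * (2 * v) * x) \<le> \<omega> * (u + r * z)" "\<omega> * u / 2 \<le> y" "\<omega> * (r * z) \<le> 1 * (r * z)"
        for P x y z u :: real
        using that by (simp add: algebra_simps)
      ultimately have low: "\<omega> * ((4/pi - E) * v * a n) \<le> G n v + r / 2 * a m" by blast
      \<comment> \<open>The slopes compare because
        \<open>4/pi * (1 - \<omega>) \<le> E * (R - \<omega>)\<close>: here
        \<open>E \<ge> 2/pi\<close> and \<open>R - \<omega> \<ge> 1/\<omega> - \<omega> \<ge> 2 * (1
        - \<omega>)\<close>.\<close>
      have "(4/pi - E * R) * (v * a n) \<le> (\<omega> * (4/pi - E)) * (v * a n)"
      proof (rule mult_right_mono)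
        have "2 * (1 - \<omega>) \<le> (1 - \<omega>) * (1 / \<omega> + 1)"
          using omega_le_1 omega_pos by (subst mult.commute, intro mult_left_mono) auto
        also have "\<dots> = 1 / \<omega> - \<omega>" using omega_pos by (simp add: field_simps)
        also have "\<dots> \<le> R - \<omega>" using R_ge_1 by simp
        finally have "2/pi * (2 * (1 - \<omega>)) \<le> E * (R - \<omega>)"
          using E theta_pos omega_le_1 by (intro mult_mono) (auto intro: order_trans[OF _ E])
        then show "4/pi - E * R \<le> \<omega> * (4/pi - E)" by (simp add: algebra_simps)
      qed (use am Suc.prems in auto)
      with low rm have "(4/pi - E * R) * (v * a n) \<le> G n v + r * R / 2 * a n" by (simp add: mult.assoc)
      moreover have "((E * R - 2/pi) * v + r * R / 2) * a n
          = 2/pi * v * a n - (4/pi - E * R) * (v * a n) + r * R / 2 * a n"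
        by (simp add: field_simps)
      moreover have "- (x - y + z) \<le> u - x" if "y \<le> u + z" for x y z u :: real
        using that by simp
      ultimately show ?thesis by metis
    next
      case False
      have "4/pi * v * a n \<le> E * R * v * a n"
        using False ER am Suc.prems by (intro mult_right_mono) auto
      moreover have "0 \<le> r * R / 2 * a n" using rR am(4) by (rule mult_nonneg_nonneg)
      ultimately show ?thesis using G_nonneg[of n v] by (simp add: algebra_simps)
    qed
    ultimately show "\<bar>G n v - 2/pi * v * a n\<bar> \<le> ((E * R - 2/pi) * v + r * R / 2) * a n"
      by (simp add: abs_le_iff)
  qed
qed

text \<open>The error after \<open>2 * k + 2\<close> pull-backs, when halving has gained the factor
  \<open>4 ^ Suc k > 1 / \<tau>\<close> on the additive part. The denominator is a Bernoulli lower
  bound for the inverse of \<open>R ^ (2 * k + 2)\<close>, and 56 is 48 from the linear part plus 8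
  from the additive one. It tends to 0 with \<open>\<tau>\<close> since \<open>k * \<theta>\<close>
  does.\<close>

definition \<eta> :: real where
  "\<eta> = (2/pi + 56 * \<theta>) / (1 - 2 * real (2 * k + 2) * \<theta>) - 2/pi"

lemma eta_denom_pos: "0 < 1 - 2 * real (2 * k + 2) * \<theta>"
  using theta_k theta_pos by (simp add: algebra_simps)

lemma R_pow_le: "R ^ (2 * k + 2) \<le> 1 / (1 - 2 * real (2 * k + 2) * \<theta>)"
proof -
  let ?j = "2 * k + 2"
  have "1 + real ?j * (- (2 * \<theta>)) \<le> (1 + - (2 * \<theta>)) ^ ?j"
    by (rule Bernoulli_inequality) (use theta_le in auto)
  also have "\<dots> \<le> (\<omega> * (1 - \<theta>)) ^ ?j"
  proof (rule power_mono)
    have "(1 - \<theta>) * (1 - \<theta>) \<le> \<omega> * (1 - \<theta>)"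
      using omega_ge tau_sq_le theta_le by (intro mult_right_mono) auto
    moreover have "(1 - \<theta>) * (1 - \<theta>) = 1 - 2 * \<theta> + \<theta> * \<theta>" by algebra
    ultimately show "1 + - (2 * \<theta>) \<le> \<omega> * (1 - \<theta>)"
      using zero_le_square[of \<theta>] by linarith
  qed (use theta_le in auto)
  finally have "1 - 2 * real ?j * \<theta> \<le> (\<omega> * (1 - \<theta>)) ^ ?j" by (simp add: algebra_simps)
  then show ?thesis unfolding R_def power_one_over
    using eta_denom_pos by (intro divide_left_mono) auto
qed

lemma eta_nonneg: "0 \<le> \<eta>"
proof -
  have "2/pi \<le> 2/pi + 56 * \<theta>" using theta_pos by simp
  also have "\<dots> \<le> (2/pi + 56 * \<theta>) / (1 - 2 * real (2 * k + 2) * \<theta>)"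
    using eta_denom_pos theta_pos by (simp add: pos_le_divide_eq mult_left_le add_nonneg_nonneg)
  finally show ?thesis unfolding \<eta>_def by simp
qed

text \<open>The form suits the loss formula: integrated against \<open>wr'\<close>, both
  \<open>v\<close> and \<open>\<tau>\<close> contribute O(\<open>\<tau>\<close>).\<close>

lemma G_equidistributed_eta:
  assumes "0 \<le> v" "v \<le> pi/2"
  shows "\<bar>G n v - 2/pi * v * a n\<bar> \<le> \<eta> * (v + \<tau>) * a n"
proof -
  define j where "j = 2 * k + 2"
  define D where "D = 1 - 2 * real j * \<theta>"
  have Dpos: "0 < D" and Rj: "R ^ j \<le> 1 / D" and eta: "\<eta> = (2/pi + 56 * \<theta>) / D - 2/pi"
    unfolding D_def j_def \<eta>_def using eta_denom_pos R_pow_le by auto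
  have D1: "0 \<le> 1 / D" using Dpos by simp
  have Dle: "1 \<le> 1 / D" using Dpos theta_pos unfolding D_def by simp
  have c: "(2/pi + 48 * \<theta>) * R ^ j - 2/pi \<le> \<eta>"
  proof -
    have "(2/pi + 48 * \<theta>) * R ^ j \<le> (2/pi + 56 * \<theta>) * (1 / D)"
      using Rj theta_pos R_ge_1 by (intro mult_mono) auto
    then show ?thesis unfolding eta by simp
  qed
  have "(2::real) ^ j = 4 ^ Suc k"
    unfolding j_def by (simp add: power_mult power_add)
  then have "(R/2) ^ j \<le> R ^ j * \<tau>"
    using tau_gt R_ge_1 by (simp add: power_divide field_simps)
  also have "\<dots> \<le> 1 / D * \<tau>" using Rj tau_pos by (intro mult_right_mono) auto
  finally have "8 * \<theta> * (R/2) ^ j \<le> 8 * \<theta> * (1 / D * \<tau>)" using theta_pos by (intro mult_left_mono) auto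
  also have "\<dots> = 8 * \<theta> * (1/D) * \<tau>" by simp
  also have "\<dots> \<le> \<eta> * \<tau>"
  proof (intro mult_right_mono)
    have "2/pi * 1 \<le> 2/pi * (1/D)" using Dle by (intro mult_left_mono) auto
    moreover have "0 \<le> 48 * \<theta> * (1/D)" using theta_pos D1 by (intro mult_nonneg_nonneg) auto
    moreover have "\<eta> = 2/pi * (1/D) + 48 * \<theta> * (1/D) + 8 * \<theta> * (1/D) - 2/pi"
      unfolding eta by (simp add: add_divide_distrib)
    ultimately show "8 * \<theta> * (1/D) \<le> \<eta>" by linarith
  qed (use tau_pos in auto)
  finally have d: "8 * \<theta> * (R/2) ^ j \<le> \<eta> * \<tau>" .
  have "((2/pi + 48 * \<theta>) * R ^ j - 2/pi) * v \<le> \<eta> * v" using c assms by (intro mult_right_mono)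
  then have "((2/pi + 48 * \<theta>) * R ^ j - 2/pi) * v + 8 * \<theta> * (R/2) ^ j \<le> \<eta> * (v + \<tau>)"
    using d by (simp add: distrib_left)
  then have "(((2/pi + 48 * \<theta>) * R ^ j - 2/pi) * v + 8 * \<theta> * (R/2) ^ j) * a n \<le> \<eta> * (v + \<tau>) * a n"
    by (intro mult_right_mono a_nonneg)
  then show ?thesis using G_equidistributed_micro[OF assms, of n j] by linarith
qed

text \<open>\<open>G n\<close> is the distribution function of Lebesgue measure restricted to a set,
  hence 1-Lipschitz.\<close>

lemma G_integrable: "(\<lambda>v. wr' v * G n v) integrable_on {0..pi/2}"
proof (rule integrable_continuous_real, rule continuous_on_mult[OF wr'_cont])
  have "\<bar>G n y - G n x\<bar> \<le> \<bar>y - x\<bar>" for x y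
  proof -
    have *: "G n y - G n x \<le> y - x" if "x \<le> y" for x y
    proof -
      have "G n y \<le> measure lebesgue (A n \<inter> {0..x} \<union> {x..y})"
        unfolding G_def by (intro measure_mono_fmeasurable fmeasurable.Un) (auto simp: fmeasurableD)
      also have "\<dots> \<le> G n x + measure lebesgue {x..y}"
        unfolding G_def by (rule measure_Un_le) (auto simp: fmeasurableD)
      finally show ?thesis using that by simp
    qed
    show ?thesis using *[of x y] *[of y x] G_mono[of x y n] G_mono[of y x n] by linarith
  qed
  then show "continuous_on {0..pi/2} (G n)"
    by (intro lipschitz_on_continuous_on[of 1] lipschitz_onI) (auto simp: dist_real_def abs_minus_commute)
qed

text \<open>Subtracting the case \<open>n = 0\<close>, where equidistribution is exact.\<close>

lemma escape_rate: "\<bar>(a n - a (Suc n)) - 2/pi * arctan \<tau> * a n\<bar> \<le> 2 * \<eta> * \<tau> * a n"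
proof -
  let ?I = "{0..pi/2}"
  \<comment> \<open>The first step removes exactly the gap, of length \<open>2 * hh\<close>.\<close>
  have loss_0: "a 0 - a (Suc 0) = arctan \<tau>"
  proof -
    have "G (Suc 0) (pi/4) = pi/4 - hh"
      unfolding G_def A_Suc_Int_left_half
    proof -
      have "g ` {0..pi/2} = {g 0..g (pi/2)}"
        using continuous_injective_image_segment_1[OF g_cont, of 0 "pi/2"] g_inj g_le[of 0 "pi/2"]
        by (simp add: closed_segment_eq_real_ivl)
      then show "measure lebesgue (g ` A 0) = pi/4 - hh"
        using g_pi_half hh_bounds by simp
    qed
    then show ?thesis unfolding G_pi_quarter by (simp add: a_0 hh_def del: A.simps)
  qed
  have wr_pos: "0 \<le> wr (pi/2)" "wr (pi/2) \<le> 1" unfolding wr_w using w_nonneg w_le_1 by auto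
  have iv: "(\<lambda>v. wr' v * v) integrable_on ?I"
    by (intro integrable_continuous_real continuous_intros wr'_cont)
  have iw: "(wr' has_integral wr (pi/2)) ?I"
    using wr_has_integral[of 0 "pi/2"] by (simp add: wr_def)
  \<comment> \<open>At level 0 the distribution function is the identity, so the loss formula yields
    this integral without computing it.\<close>
  have I0: "arctan \<tau> = (1 - wr (pi/2)) * (pi/2) + integral ?I (\<lambda>v. wr' v * v)"
  proof -
    have "integral ?I (\<lambda>v. wr' v * G 0 v) = integral ?I (\<lambda>v. wr' v * v)"
      by (rule integral_cong) (simp add: G_0)
    moreover have "arctan \<tau> = (1 - wr (pi/2)) * a 0 + integral ?I (\<lambda>v. wr' v * G 0 v)"
      using loss_formula[of 0] loss_0 by (simp only:)
    ultimately show ?thesis by (simp only: a_0)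
  qed
  have "(a n - a (Suc n)) - 2/pi * arctan \<tau> * a n =
      integral ?I (\<lambda>v. wr' v * G n v) - 2/pi * a n * integral ?I (\<lambda>v. wr' v * v)"
    unfolding loss_formula[of n] I0 by (simp add: field_simps)
  also have "\<dots> = integral ?I (\<lambda>v. wr' v * G n v) - integral ?I (\<lambda>v. 2/pi * a n * (wr' v * v))"
    by simp
  also have "\<dots> = integral ?I (\<lambda>v. wr' v * G n v - 2/pi * a n * (wr' v * v))"
    by (intro Henstock_Kurzweil_Integration.integral_diff[symmetric] G_integrable
        integrable_on_mult_right iv)
  finally have eq: "(a n - a (Suc n)) - 2/pi * arctan \<tau> * a n =
    integral ?I (\<lambda>v. wr' v * G n v - 2/pi * a n * (wr' v * v))" .
  have "norm (integral ?I (\<lambda>v. wr' v * G n v - 2/pi * a n * (wr' v * v)))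
      \<le> integral ?I (\<lambda>v. \<eta> * a n * (wr' v * v) + \<eta> * a n * \<tau> * wr' v)"
  proof (rule integral_norm_bound_integral)
    show "(\<lambda>v. wr' v * G n v - 2/pi * a n * (wr' v * v)) integrable_on ?I"
      by (intro integrable_diff G_integrable integrable_on_mult_right iv)
    show "(\<lambda>v. \<eta> * a n * (wr' v * v) + \<eta> * a n * \<tau> * wr' v) integrable_on ?I"
      by (intro integrable_add integrable_on_mult_right iv has_integral_integrable[OF iw])
    fix v assume v: "v \<in> ?I"
    have "norm (wr' v * G n v - 2/pi * a n * (wr' v * v)) = wr' v * \<bar>G n v - 2/pi * v * a n\<bar>"
    proof -
      have "wr' v * G n v - 2/pi * a n * (wr' v * v) = wr' v * (G n v - 2/pi * v * a n)"
        by (simp add: algebra_simps)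
      then show ?thesis using wr'_nonneg[of v] v by (simp add: abs_mult)
    qed
    also have "\<dots> \<le> wr' v * (\<eta> * (v + \<tau>) * a n)"
      using v by (intro mult_left_mono G_equidistributed_eta wr'_nonneg) auto
    finally show "norm (wr' v * G n v - 2/pi * a n * (wr' v * v))
      \<le> \<eta> * a n * (wr' v * v) + \<eta> * a n * \<tau> * wr' v" by (simp add: algebra_simps)
  qed
  also have "\<dots> = \<eta> * a n * integral ?I (\<lambda>v. wr' v * v) + \<eta> * a n * \<tau> * integral ?I wr'"
    by (subst Henstock_Kurzweil_Integration.integral_add)
      (auto intro!: integrable_on_mult_right iv has_integral_integrable[OF iw])
  also have "\<dots> \<le> \<eta> * a n * \<tau> + \<eta> * a n * \<tau> * 1"
  \<comment> \<open>The first moment of \<open>wr'\<close> is at most \<open>arctan \<tau>\<close>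
    by \<open>I0\<close>; its total mass is \<open>wr (pi/2)\<close>.\<close>
  proof (intro add_mono mult_left_mono)
    have "0 \<le> (1 - wr (pi/2)) * (pi/2)" using wr_pos by simp
    then show "integral ?I (\<lambda>v. wr' v * v) \<le> \<tau>" using I0 arctan_le_self[of \<tau>] tau_pos by linarith
    show "integral ?I wr' \<le> 1" using integral_unique[OF iw] wr_pos by simp
  qed (use eta_nonneg a_nonneg tau_pos in auto)
  finally show ?thesis unfolding eq by (simp add: algebra_simps)
qed

end

section \<open>The escape rate, uniformly in the level, as \<open>\<tau>\<close> tends to 0\<close>

lemma exists_scale:
  assumes "0 < (x::real)" "x \<le> 1 / 4 ^ m"
  obtains k where "m \<le> k" "x \<le> 1 / 4 ^ k" "1 / 4 ^ Suc k < x"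
proof -
  have "\<exists>j. 1 / 4 ^ j < x" using real_arch_pow_inv[OF assms(1), of "1/4"] by (simp add: power_divide)
  define j where "j = (LEAST j. 1 / 4 ^ j < x)"
  have j: "1 / 4 ^ j < x" unfolding j_def by (rule LeastI_ex) fact
  have mj: "m < j"
  proof (rule ccontr)
    assume "\<not> m < j"
    then have "(1::real) / 4 ^ m \<le> 1 / 4 ^ j" by (intro divide_left_mono power_increasing) auto
    then show False using j assms by linarith
  qed
  then obtain k where k: "j = Suc k" by (cases j) auto
  have "x \<le> 1 / 4 ^ k" using not_less_Least[of k "\<lambda>j. 1 / 4 ^ j < x"] k unfolding j_def by force
  then show ?thesis using that[of k] mj j k by auto
qed

text \<open>Error budget: \<open>2 * \<eta>\<close> takes \<open>e/2\<close>, replacing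
  \<open>arctan \<tau>\<close> by \<open>\<tau>\<close> takes \<open>e/4\<close>. The second
  estimate, from \<open>1/2 - 2 * (8 * \<theta>) \<ge> 1/4\<close>, keeps mass where the Jacobian of
  \<open>\<beta> * cos (2 * u)\<close> does not degenerate.\<close>

lemma escape_rate_asymptotics:
  assumes "0 < e"
  obtains \<tau>\<^sub>0 :: real where "0 < \<tau>\<^sub>0" and
    "\<And>\<tau> n. 0 < \<tau> \<Longrightarrow> \<tau> \<le> \<tau>\<^sub>0 \<Longrightarrow>
      \<bar>(perturbed_tent.a \<tau> n - perturbed_tent.a \<tau> (Suc n)) - 2/pi * \<tau> * perturbed_tent.a \<tau> n\<bar>
        \<le> e * \<tau> * perturbed_tent.a \<tau> n" and
    "\<And>\<tau> n. 0 < \<tau> \<Longrightarrow> \<tau> \<le> \<tau>\<^sub>0 \<Longrightarrow> perturbed_tent.a \<tau> n / 4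
        \<le> perturbed_tent.G \<tau> n (3*pi/8) - perturbed_tent.G \<tau> n (pi/8)"
proof -
  \<comment> \<open>This is \<open>\<eta>\<close> with \<open>\<theta>\<close> unfolded, a function
    of \<open>k\<close> alone.\<close>
  have "(\<lambda>k::nat. (2/pi + 56 * (4 / 2 ^ k)) / (1 - 2 * real (2 * k + 2) * (4 / 2 ^ k)) - 2/pi :: real) \<longlonglongrightarrow> 0"
    by real_asymp
  then have "\<forall>\<^sub>F k in sequentially. (2/pi + 56 * (4 / 2 ^ k)) / (1 - 2 * real (2 * k + 2) * (4 / 2 ^ k)) - 2/pi < e / 4"
    by (rule order_tendstoD) (use assms in auto)
  then obtain K where K: "\<And>k. K \<le> k \<Longrightarrow>
      (2/pi + 56 * (4 / 2 ^ k)) / (1 - 2 * real (2 * k + 2) * (4 / 2 ^ k)) - 2/pi < e / 4"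
    unfolding eventually_sequentially by auto
  have "((\<lambda>\<tau>::real. arctan \<tau> / \<tau>) \<longlongrightarrow> 1) (at_right 0)" by real_asymp
  then have "\<forall>\<^sub>F \<tau> in at_right 0. 1 - e / 4 < arctan \<tau> / \<tau>"
    by (rule order_tendstoD) (use assms in auto)
  then obtain d :: real where d: "0 < d" "\<And>\<tau>. 0 < \<tau> \<Longrightarrow> \<tau> < d \<Longrightarrow> 1 - e / 4 < arctan \<tau> / \<tau>"
    unfolding eventually_at_right_field by auto
  define m where "m = max 8 K"
  show ?thesis
  proof
    show "0 < min (d/2) (1 / 4 ^ m)" using d by simp
  next
    fix \<tau> :: real and n assume t: "0 < \<tau>" "\<tau> \<le> min (d/2) (1 / 4 ^ m)"
    obtain k where k: "m \<le> k" "\<tau> \<le> 1 / 4 ^ k" "1 / 4 ^ Suc k < \<tau>"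
      using exists_scale[of \<tau> m] t by auto
    interpret perturbed_tent_scale \<tau> k by unfold_locales (use t k in \<open>auto simp: m_def\<close>)
    have "1 - e/4 < arctan \<tau> / \<tau>" using d t by auto
    then have ar: "\<tau> - e/4 * \<tau> \<le> arctan \<tau>" "arctan \<tau> \<le> \<tau>"
      using t arctan_le_self[of \<tau>] by (auto simp: field_simps)
    have "\<eta> \<le> e / 4" using K[of k] k(1) unfolding \<eta>_def \<theta>_def m_def by (simp add: max.bounded_iff less_imp_le)
    then have eta: "2 * \<eta> * \<tau> * a n \<le> 2 * (e/4) * \<tau> * a n"
      using t a_nonneg by (intro mult_right_mono mult_left_mono) auto
    have "\<bar>2/pi * arctan \<tau> * a n - 2/pi * \<tau> * a n\<bar> \<le> e/4 * \<tau> * a n"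
    proof -
      have "2/pi * arctan \<tau> * a n - 2/pi * \<tau> * a n = - (2/pi * ((\<tau> - arctan \<tau>) * a n))"
        by (simp add: algebra_simps)
      moreover have "0 \<le> 2/pi * ((\<tau> - arctan \<tau>) * a n)" using ar a_nonneg by simp
      moreover have "2/pi * ((\<tau> - arctan \<tau>) * a n) \<le> 1 * ((e/4 * \<tau>) * a n)"
        using ar a_nonneg pi_gt3 by (intro mult_mono) auto
      ultimately show ?thesis by simp
    qed
    moreover have "\<bar>x - z\<bar> \<le> B + C" if "\<bar>x - y\<bar> \<le> B" "\<bar>y - z\<bar> \<le> C" for x y z B C :: real
      using that by linarith
    note this[OF escape_rate[of n]]
    ultimately have "\<bar>(a n - a (Suc n)) - 2/pi * \<tau> * a n\<bar> \<le> 2 * \<eta> * \<tau> * a n + e/4 * \<tau> * a n"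
      by blast
    also have "\<dots> \<le> 2 * (e/4) * \<tau> * a n + e/4 * \<tau> * a n"
      using eta by (intro add_right_mono)
    also have "\<dots> = 3/4 * (e * \<tau> * a n)" by simp
    also have "\<dots> \<le> e * \<tau> * a n" using assms t a_nonneg[of n] by simp
    finally show "\<bar>(a n - a (Suc n)) - 2/pi * \<tau> * a n\<bar> \<le> e * \<tau> * a n" .
    have "\<bar>G n (3*pi/8) - 2/pi * (3*pi/8) * a n\<bar> \<le> 8 * \<theta> * a n"
      "\<bar>G n (pi/8) - 2/pi * (pi/8) * a n\<bar> \<le> 8 * \<theta> * a n"
      by (rule G_equidistributed; simp)+
    moreover have "8 * \<theta> * a n \<le> 1 / 8 * a n"
    proof (intro mult_right_mono a_nonneg)
      have "(2::real) ^ 8 \<le> 2 ^ k" using k_ge by (rule power_increasing) simp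
      then show "8 * \<theta> \<le> 1 / 8" unfolding \<theta>_def by (simp add: field_simps)
    qed
    ultimately show "a n / 4 \<le> G n (3*pi/8) - G n (pi/8)" by (simp add: abs_le_iff)
  qed
qed

section \<open>The Julia set and its cylinders\<close>

lemma abs_cos_diff_le: "\<bar>cos x - cos y\<bar> \<le> \<bar>x - y :: real\<bar>"
proof -
  have "cos x - cos y = 2 * sin ((x + y) / 2) * sin ((y - x) / 2)" by (rule cos_diff_cos)
  then have "\<bar>cos x - cos y\<bar> = 2 * (\<bar>sin ((x + y) / 2)\<bar> * \<bar>sin ((y - x) / 2)\<bar>)" by (simp add: abs_mult)
  also have "\<dots> \<le> 2 * (1 * \<bar>(y - x) / 2\<bar>)"
    by (intro mult_left_mono mult_mono abs_sin_le_one abs_sin_x_le_abs_x) auto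
  finally show ?thesis by simp
qed

section \<open>Expansion of confocal ellipses: the Julia set is real\<close>

locale real_julia =
  fixes \<epsilon> :: real
  assumes eps_pos: "0 < \<epsilon>"
begin

definition \<beta> :: real where "\<beta> = (1 + sqrt (9 + 4 * \<epsilon>)) / 2"

text \<open>The branches send \<open>-\<beta>\<close> to \<open>\<alpha>\<close> and
  \<open>-\<alpha>\<close>, so the gap lies between these two points. Its positivity keeps the
  branches away from the critical point 0 and bounds the distortion.\<close>

definition \<alpha> :: real where "\<alpha> = sqrt (2 + \<epsilon> - \<beta>)"

lemma beta_sq: "\<beta>\<^sup>2 = \<beta> + 2 + \<epsilon>"
proof -
  have "(sqrt (9 + 4 * \<epsilon>))\<^sup>2 = 9 + 4 * \<epsilon>" using eps_pos by simp
  then show ?thesis unfolding \<beta>_def by (simp add: power2_eq_square field_simps)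
qed

lemma beta_gt_2: "2 < \<beta>"
proof -
  have "3 < sqrt (9 + 4 * \<epsilon>)" using eps_pos by (intro real_less_rsqrt) simp
  then show ?thesis unfolding \<beta>_def by simp
qed

lemma alpha_sq: "\<alpha>\<^sup>2 = \<beta>\<^sup>2 - 2 * \<beta>" and alpha_pos: "0 < \<alpha>"
proof -
  have "\<beta> * 2 < \<beta> * \<beta>" using beta_gt_2 by (intro mult_strict_left_mono) auto
  then have "0 < 2 + \<epsilon> - \<beta>" using beta_sq by (simp add: power2_eq_square)
  then show "\<alpha>\<^sup>2 = \<beta>\<^sup>2 - 2 * \<beta>" "0 < \<alpha>" unfolding \<alpha>_def using beta_sq by auto
qed

lemma two_eps: "2 + \<epsilon> = \<alpha>\<^sup>2 + \<beta>" using alpha_sq beta_sq by simp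

definition F :: "complex \<Rightarrow> complex" where "F = quad_map (complex_of_real (- \<epsilon>))"

definition f :: "real \<Rightarrow> real" where "f x = x\<^sup>2 - 2 - \<epsilon>"

lemma F_of_real: "(F ^^ n) (complex_of_real x) = complex_of_real ((f ^^ n) x)"
  by (induction n) (auto simp: F_def f_def quad_map_def)

text \<open>
  \<open>S z = r\<close> describes the ellipse with foci \<open>\<plusminus>\<beta>\<close>; for the Chebyshev map \<open>\<epsilon> = 0\<close>
  the map \<open>F\<close> permutes these ellipses.
\<close>

definition S :: "complex \<Rightarrow> real" where
  "S z = cmod (z - complex_of_real \<beta>) + cmod (z + complex_of_real \<beta>)"

lemma S_ge: "2 * \<beta> \<le> S z"
proof -
  have "cmod ((z + complex_of_real \<beta>) - (z - complex_of_real \<beta>)) \<le> cmod (z + complex_of_real \<beta>) + cmod (z - complex_of_real \<beta>)"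
    by (rule norm_triangle_ineq4)
  moreover have "(z + complex_of_real \<beta>) - (z - complex_of_real \<beta>) = complex_of_real (2 * \<beta>)" by simp
  ultimately show ?thesis unfolding S_def using beta_gt_2 by (simp only: norm_of_real)
qed

lemma S_le: "S z \<le> 2 * cmod z + 2 * \<beta>"
  unfolding S_def using norm_triangle_ineq4[of z "complex_of_real \<beta>"]
    norm_triangle_ineq[of z "complex_of_real \<beta>"] beta_gt_2 by simp

text \<open>Since \<open>F z - \<beta> = (z - \<beta>) * (z + \<beta>)\<close> and
  \<open>F z + \<beta> = z^2 - \<alpha>^2\<close>, the parallelogram law gives
  \<open>S (F z) \<ge> (S z)^2 / 2 - 2 * \<beta>^2 + 2 * \<beta>\<close>. Subtracting
  \<open>2 * \<beta>\<close> leaves \<open>S z - 2 * \<beta>\<close> times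
  \<open>(S z + 2 * \<beta>) / 2\<close>, a factor of at least \<open>2 * \<beta>\<close>.\<close>

lemma S_expand: "2 * (S z - 2 * \<beta>) \<le> S (F z) - 2 * \<beta>"
proof -
  let ?b = "complex_of_real \<beta>"
  have par: "(cmod (z - ?b))\<^sup>2 + (cmod (z + ?b))\<^sup>2 = 2 * (cmod z)\<^sup>2 + 2 * \<beta>\<^sup>2"
    unfolding cmod_power2 by (simp add: power2_eq_square algebra_simps)
  have bb: "complex_of_real \<beta> * complex_of_real \<beta> = complex_of_real \<beta> + 2 + complex_of_real \<epsilon>"
    using arg_cong[OF beta_sq, of complex_of_real] by (simp add: power2_eq_square)
  have aa: "complex_of_real (\<alpha>\<^sup>2) = 2 + complex_of_real \<epsilon> - ?b"
    using arg_cong[OF two_eps, of complex_of_real] by simp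
  have F1: "F z - ?b = (z - ?b) * (z + ?b)"
    unfolding F_def quad_map_def using bb by (simp add: power2_eq_square algebra_simps)
  have F2: "F z + ?b = z\<^sup>2 - complex_of_real (\<alpha>\<^sup>2)"
    unfolding F_def quad_map_def aa by simp
  have "cmod (z\<^sup>2) \<le> cmod (z\<^sup>2 - complex_of_real (\<alpha>\<^sup>2)) + cmod (complex_of_real (\<alpha>\<^sup>2))"
    using norm_triangle_ineq[of "z\<^sup>2 - complex_of_real (\<alpha>\<^sup>2)" "complex_of_real (\<alpha>\<^sup>2)"] by simp
  then have 1: "(cmod z)\<^sup>2 - \<alpha>\<^sup>2 \<le> cmod (F z + ?b)" unfolding F2 by (simp only: norm_of_real norm_power) simp
  define Q where "Q = cmod (z - ?b) * cmod (z + ?b)"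
  have "cmod (F z - ?b) = Q" unfolding F1 Q_def by (rule norm_mult)
  then have 2: "S (F z) = Q + cmod (F z + ?b)" unfolding S_def by simp
  have "(S z)\<^sup>2 = 2 * (cmod z)\<^sup>2 + 2 * \<beta>\<^sup>2 + 2 * Q"
    unfolding S_def power2_sum par Q_def by simp
  then have "(S z)\<^sup>2 / 2 = (cmod z)\<^sup>2 + \<beta>\<^sup>2 + Q" by simp
  with 1 2 have "(S z)\<^sup>2 / 2 - \<beta>\<^sup>2 - \<alpha>\<^sup>2 \<le> S (F z)" by linarith
  then have "(S z)\<^sup>2 / 2 - 2 * \<beta>\<^sup>2 \<le> S (F z) - 2 * \<beta>" by (simp add: alpha_sq)
  moreover have "(S z)\<^sup>2 / 2 - 2 * \<beta>\<^sup>2 = (S z + 2 * \<beta>) / 2 * (S z - 2 * \<beta>)"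
    by (simp add: power2_eq_square algebra_simps)
  moreover have "2 * (S z - 2 * \<beta>) \<le> (S z + 2 * \<beta>) / 2 * (S z - 2 * \<beta>)"
    using S_ge[of z] beta_gt_2 by (intro mult_right_mono) auto
  ultimately show ?thesis by linarith
qed

lemma S_iterate: "2 ^ n * (S z - 2 * \<beta>) \<le> S ((F ^^ n) z) - 2 * \<beta>"
proof (induction n)
  case (Suc n)
  then show ?case using S_expand[of "(F ^^ n) z"] by simp
qed simp

lemma escapes:
  assumes "2 * \<beta> < S z"
  shows "filterlim (\<lambda>n. (F ^^ n) z) at_infinity sequentially"
proof -
  define s where "s = (S z - 2 * \<beta>) / 2"
  have s: "0 < s" using assms unfolding s_def by simp
  have le: "2 ^ n * s \<le> cmod ((F ^^ n) z)" for n
    using S_iterate[of n z] S_le[of "(F ^^ n) z"] unfolding s_def by simp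
  have "filterlim (\<lambda>n. 2 ^ n * s) at_top sequentially" using s by real_asymp
  then have "filterlim (\<lambda>n. cmod ((F ^^ n) z)) at_top sequentially"
    by (rule filterlim_at_top_mono) (simp add: le)
  then show ?thesis by (rule filterlim_norm_at_top_imp_at_infinity)
qed

text \<open>The range \<open>j \<le> n\<close> imposes \<open>n + 1\<close> conditions, so
  \<open>X 0\<close> is the whole interval, in step with \<open>A 0\<close>.\<close>

definition X :: "nat \<Rightarrow> real set" where "X n = {x. \<forall>j\<le>n. \<bar>(f ^^ j) x\<bar> \<le> \<beta>}"

text \<open>An orbit with \<open>S > 2 * \<beta>\<close> at any time escapes, and the degenerate
  ellipse \<open>S = 2 * \<beta>\<close> is the segment between the foci; so a point that does not
  escape has its whole orbit in that segment.\<close>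

lemma filled_julia: "filled_julia_set (complex_of_real (- \<epsilon>)) = complex_of_real ` (\<Inter>n. X n)"
proof (intro equalityI subsetI)
  fix z assume z: "z \<in> filled_julia_set (complex_of_real (- \<epsilon>))"
  have S: "S ((F ^^ n) z) = 2 * \<beta>" for n
  proof (rule ccontr)
    assume "S ((F ^^ n) z) \<noteq> 2 * \<beta>"
    then have "filterlim (\<lambda>m. (F ^^ m) ((F ^^ n) z)) at_infinity sequentially"
      using S_ge[of "(F ^^ n) z"] by (intro escapes) simp
    then have "filterlim (\<lambda>m. (F ^^ (m + n)) z) at_infinity sequentially" by (simp add: funpow_add)
    then have "filterlim (\<lambda>m. (F ^^ m) z) at_infinity sequentially"
      unfolding filterlim_iff
      by (simp add: eventually_sequentially_seg[where P = "\<lambda>m. P ((F ^^ m) z)" for P])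
    then show False using z unfolding filled_julia_set_def F_def by simp
  qed
  have seg: "\<exists>x. y = complex_of_real x \<and> \<bar>x\<bar> \<le> \<beta>" if "S y = 2 * \<beta>" for y
  proof -
    have "dist (complex_of_real (- \<beta>)) (complex_of_real \<beta>) = 2 * \<beta>"
      using beta_gt_2 unfolding dist_of_real by (simp add: dist_real_def)
    then have "between (complex_of_real (- \<beta>), complex_of_real \<beta>) y"
      using that unfolding between S_def by (simp add: dist_norm norm_minus_commute add.commute)
    then have "y \<in> complex_of_real ` closed_segment (- \<beta>) \<beta>"
      unfolding between_mem_segment closed_segment_of_real .
    then show ?thesis using beta_gt_2 by (auto simp: closed_segment_eq_real_ivl)
  qed
  obtain x where x: "z = complex_of_real x" using seg[of z] S[of 0] by auto
  have "\<bar>(f ^^ n) x\<bar> \<le> \<beta>" for n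
    using seg[OF S[of n]] unfolding x F_of_real by auto
  then show "z \<in> complex_of_real ` (\<Inter>n. X n)" unfolding x X_def by auto
next
  fix z assume "z \<in> complex_of_real ` (\<Inter>n. X n)"
  then obtain x where x: "z = complex_of_real x" "\<And>n. \<bar>(f ^^ n) x\<bar> \<le> \<beta>" by (auto simp: X_def)
  have bnd: "cmod ((F ^^ n) z) \<le> \<beta>" for n unfolding x(1) F_of_real using x(2) by simp
  have "\<not> filterlim (\<lambda>n. (F ^^ n) z) at_infinity sequentially"
  proof
    assume "filterlim (\<lambda>n. (F ^^ n) z) at_infinity sequentially"
    then have "filterlim (\<lambda>n. cmod ((F ^^ n) z)) at_top sequentially"
      by (rule filterlim_at_infinity_imp_norm_at_top)
    then have "\<forall>\<^sub>F n in sequentially. \<beta> + 1 \<le> cmod ((F ^^ n) z)" unfolding filterlim_at_top by blast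
    then obtain n where "\<beta> + 1 \<le> cmod ((F ^^ n) z)" unfolding eventually_sequentially by blast
    then show False using bnd[of n] by linarith
  qed
  then show "z \<in> filled_julia_set (complex_of_real (- \<epsilon>))"
    unfolding filled_julia_set_def F_def by simp
qed

lemma X_compact: "compact (X n)"
proof -
  have c: "continuous_on UNIV (f ^^ j)" for j
  proof (induction j)
    case (Suc j)
    then show ?case by (auto simp: f_def intro!: continuous_intros)
  qed (simp add: id_def)
  have "X n = (\<Inter>j\<in>{..n}. {x. \<bar>(f ^^ j) x\<bar> \<le> \<beta>})" unfolding X_def by auto
  then have "closed (X n)" by (auto intro!: closed_INT closed_Collect_le continuous_intros c)
  moreover have "X n \<subseteq> {- \<beta>..\<beta>}" unfolding X_def by (force simp: abs_le_iff)
  ultimately show ?thesis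
    using compact_eq_bounded_closed bounded_subset bounded_closed_interval by metis
qed

text \<open>A compact subset of the real line has no interior in the plane, so it is its own
  frontier.\<close>

lemma julia: "julia_set (complex_of_real (- \<epsilon>)) = complex_of_real ` (\<Inter>n. X n)"
proof -
  let ?L = "\<Inter>n. X n"
  have "compact ?L" by (rule compact_Inter) (auto simp: X_compact)
  then have "closed (complex_of_real ` ?L)"
    by (intro compact_imp_closed compact_continuous_image continuous_intros)
  moreover have "interior (complex_of_real ` ?L) = {}"
  proof -
    have "interior (complex_of_real ` ?L) \<subseteq> interior {z. Im z = 0}"
      by (rule interior_mono) auto
    also have "\<dots> = {}" using interior_hyperplane[of \<i> 0] by (simp add: inner_complex_def)
    finally show ?thesis by simp
  qed
  ultimately show ?thesis unfolding julia_set_def filled_julia frontier_def by simp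
qed

section \<open>Coding of the surviving set by words of signs\<close>

definition branch :: "bool \<Rightarrow> real \<Rightarrow> real" where
  "branch s y = (if s then 1 else - 1) * sqrt (y + 2 + \<epsilon>)"

text \<open>The first letter is applied last: it is the sign of the point, and a prefix of a word
  describes a larger cylinder.\<close>

fun cyl :: "bool list \<Rightarrow> real \<Rightarrow> real" where
  "cyl [] x = x"
| "cyl (s # w) x = branch s (cyl w x)"

definition words :: "nat \<Rightarrow> bool list set" where "words n = {w. length w = n}"

definition len :: "bool list \<Rightarrow> real" where "len w = \<bar>cyl w \<beta> - cyl w (- \<beta>)\<bar>"

definition b :: "nat \<Rightarrow> real" where "b n = measure lebesgue (X n)"

lemma cyl_append: "cyl (p @ v) x = cyl p (cyl v x)"
  by (induction p) auto

lemma words_finite [simp]: "finite (words n)"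
  unfolding words_def using finite_lists_length_eq[of "UNIV :: bool set" n] by simp

lemma words_card: "card (words n) = 2 ^ n"
  unfolding words_def using card_lists_length_eq[of "UNIV :: bool set" n] by simp

lemma branch_arg: assumes "\<bar>y\<bar> \<le> \<beta>" shows "\<alpha>\<^sup>2 \<le> y + 2 + \<epsilon>" "y + 2 + \<epsilon> \<le> \<beta>\<^sup>2" "0 < y + 2 + \<epsilon>"
  using assms two_eps beta_sq zero_less_power[OF alpha_pos, of 2] by linarith+

lemma branch_bounds:
  assumes "\<bar>y\<bar> \<le> \<beta>" shows "\<alpha> \<le> \<bar>branch s y\<bar>" "\<bar>branch s y\<bar> \<le> \<beta>" "f (branch s y) = y"
proof -
  have "sqrt (\<alpha>\<^sup>2) \<le> sqrt (y + 2 + \<epsilon>)" "sqrt (y + 2 + \<epsilon>) \<le> sqrt (\<beta>\<^sup>2)"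
    using branch_arg[OF assms] by (intro real_sqrt_le_mono; simp)+
  then show "\<alpha> \<le> \<bar>branch s y\<bar>" "\<bar>branch s y\<bar> \<le> \<beta>"
    unfolding branch_def using alpha_pos beta_gt_2 by (auto simp: abs_mult)
  show "f (branch s y) = y" unfolding branch_def f_def using branch_arg[OF assms] by simp
qed

lemma branch_sgn: "\<bar>y\<bar> \<le> \<beta> \<Longrightarrow> 0 < branch s y \<longleftrightarrow> s"
  unfolding branch_def using branch_arg(3)[of y] by auto

lemma cyl_bounds: "\<bar>x\<bar> \<le> \<beta> \<Longrightarrow> \<bar>cyl w x\<bar> \<le> \<beta>"
  by (induction w) (auto intro: branch_bounds)

text \<open>The sign of a point recovers the first letter, and applying \<open>f\<close> removes
  it.\<close>

lemma cyl_disjoint: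
  assumes "length w = length w'" "\<bar>x\<bar> \<le> \<beta>" "\<bar>y\<bar> \<le> \<beta>" "cyl w x = cyl w' y"
  shows "w = w' \<and> x = y"
  using assms
proof (induction w w' rule: list_induct2)
  case (Cons s w s' w')
  have 1: "\<bar>cyl w x\<bar> \<le> \<beta>" "\<bar>cyl w' y\<bar> \<le> \<beta>" using Cons.prems by (auto intro: cyl_bounds)
  have eq: "branch s (cyl w x) = branch s' (cyl w' y)" using Cons.prems by simp
  have "cyl w x = cyl w' y" using arg_cong[OF eq, of f] branch_bounds(3) 1 by simp
  moreover have "s = s'" using eq branch_sgn[OF 1(1), of s] branch_sgn[OF 1(2), of s'] by simp
  ultimately show ?case using Cons by simp
qed simp

lemma X_0: "X 0 = {- \<beta>..\<beta>}" unfolding X_def by (auto simp: abs_le_iff)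

lemma X_Suc: "X (Suc n) = (\<Union>s. branch s ` X n)"
proof (intro equalityI subsetI)
  fix x assume x: "x \<in> X (Suc n)"
  have "(f ^^ j) (f x) = (f ^^ Suc j) x" for j by (simp only: funpow_Suc_right comp_apply)
  then have "f x \<in> X n" using x unfolding X_def by auto
  moreover have "x = branch (0 < x) (f x)" unfolding branch_def f_def by auto
  ultimately show "x \<in> (\<Union>s. branch s ` X n)" by blast
next
  fix x assume "x \<in> (\<Union>s. branch s ` X n)"
  then obtain s y where y: "y \<in> X n" "x = branch s y" by auto
  have yb: "\<bar>y\<bar> \<le> \<beta>" using y(1) unfolding X_def by (auto dest!: spec[of _ 0])
  have "\<bar>(f ^^ j) x\<bar> \<le> \<beta>" if "j \<le> Suc n" for j
  proof (cases j)
    case 0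
    then show ?thesis using branch_bounds(2)[OF yb] y by simp
  next
    case (Suc i)
    then have "(f ^^ j) x = (f ^^ i) y"
      using branch_bounds(3)[OF yb] y by (simp only: funpow_Suc_right comp_apply)
    then show ?thesis using y(1) that Suc unfolding X_def by auto
  qed
  then show "x \<in> X (Suc n)" unfolding X_def by simp
qed

lemma X_words: "X n = (\<Union>w\<in>words n. cyl w ` {- \<beta>..\<beta>})"
proof (induction n)
  case 0
  then show ?case by (simp add: words_def X_0)
next
  case (Suc n)
  have w: "words (Suc n) = (\<Union>s. (#) s ` words n)"
    unfolding words_def by (auto simp: length_Suc_conv)
  show ?case unfolding X_Suc Suc.IH w by (auto simp: image_image image_UN)
qed

lemma cyl_cont: "continuous_on {- \<beta>..\<beta>} (cyl w)"
proof (induction w)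
  case (Cons s w)
  have "continuous_on {- \<beta>..\<beta>} (\<lambda>x. branch s (cyl w x))"
    unfolding branch_def by (intro continuous_intros Cons)
  then show ?case by (simp add: fun_eq_iff cong: continuous_on_cong)
qed (simp add: continuous_on_id)

lemma cyl_inj: "inj_on (cyl w) {- \<beta>..\<beta>}"
proof (rule inj_onI)
  fix x y assume "x \<in> {- \<beta>..\<beta>}" "y \<in> {- \<beta>..\<beta>}" "cyl w x = cyl w y"
  then show "x = y" using cyl_disjoint[of w w x y] by (simp add: abs_le_iff)
qed

lemma cyl_image: "cyl w ` {- \<beta>..\<beta>} = closed_segment (cyl w (- \<beta>)) (cyl w \<beta>)"
  using continuous_injective_image_segment_1[of "- \<beta>" \<beta> "cyl w"] cyl_cont[of w] cyl_inj[of w] beta_gt_2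
  by (simp add: closed_segment_eq_real_ivl)

lemma cyl_measure: "measure lebesgue (cyl w ` {- \<beta>..\<beta>}) = len w"
  unfolding cyl_image len_def closed_segment_eq_real_ivl by auto

lemma cyl_lmeasurable: "cyl w ` {- \<beta>..\<beta>} \<in> lmeasurable"
  unfolding cyl_image by (intro lmeasurable_compact compact_segment)

lemma measure_UN_cyl:
  assumes "W \<subseteq> words n"
  shows "measure lebesgue (\<Union>w\<in>W. cyl w ` {- \<beta>..\<beta>}) = (\<Sum>w\<in>W. len w)"
proof -
  have "measure lebesgue (\<Union>w\<in>W. cyl w ` {- \<beta>..\<beta>}) = (\<Sum>w\<in>W. measure lebesgue (cyl w ` {- \<beta>..\<beta>}))"
  proof (rule measure_negligible_finite_Union_image)
    show "finite W" using assms words_finite by (rule finite_subset)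
    show "pairwise (\<lambda>v w. negligible (cyl v ` {- \<beta>..\<beta>} \<inter> cyl w ` {- \<beta>..\<beta>})) W"
    proof (rule pairwiseI)
      fix v w assume vw: "v \<in> W" "w \<in> W" "v \<noteq> w"
      then have "length v = length w" using assms by (auto simp: words_def)
      from cyl_disjoint[OF this] vw(3)
      have "cyl v x \<noteq> cyl w y" if "x \<in> {- \<beta>..\<beta>}" "y \<in> {- \<beta>..\<beta>}" for x y
        using that by (metis abs_le_iff atLeastAtMost_iff minus_le_iff)
      then have "cyl v ` {- \<beta>..\<beta>} \<inter> cyl w ` {- \<beta>..\<beta>} = {}" by blast
      then show "negligible (cyl v ` {- \<beta>..\<beta>} \<inter> cyl w ` {- \<beta>..\<beta>})" by simp
    qed
  qed (rule cyl_lmeasurable)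
  then show ?thesis by (simp add: cyl_measure)
qed

lemma b_words: "b n = (\<Sum>w\<in>words n. len w)"
  unfolding b_def X_words by (rule measure_UN_cyl[OF subset_refl])

definition \<tau> :: real where "\<tau> = sqrt (\<beta> / 2 - 1)"

lemma tau_sq: "\<tau>\<^sup>2 = \<beta> / 2 - 1" unfolding \<tau>_def using beta_gt_2 by simp

end

sublocale real_julia \<subseteq> tent: perturbed_tent \<tau>
  by unfold_locales (use beta_gt_2 in \<open>simp add: \<tau>_def\<close>)

section \<open>The angular coordinate; contraction and distortion of cylinders\<close>

context real_julia
begin

text \<open>Since \<open>2 + \<epsilon> = \<beta>^2 - \<beta>\<close> and
  \<open>cos (2 * u) = 1 - 2 * (sin u)^2\<close>, the radicand is
  \<open>\<beta>^2 - 2 * \<beta> * (sin u)^2\<close>. This is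
  \<open>\<beta>^2 * (1 - (sin u / \<kappa>)^2)\<close> because
  \<open>\<beta> = 2 * \<kappa>^2\<close>, and its root is
  \<open>\<beta> * cos (2 * g u)\<close>.\<close>

lemma branch_conjugate:
  assumes "0 \<le> u" "u \<le> pi/2"
  shows "branch s (\<beta> * cos (2 * u)) = \<beta> * cos (2 * (if s then tent.g u else pi/2 - tent.g u))"
proof -
  have k: "\<beta> = 2 * tent.\<kappa>\<^sup>2" unfolding tent.kappa_sq tau_sq by simp
  have r: "\<bar>sin u / tent.\<kappa>\<bar> < 1" by (rule tent.sin_div_kappa)
  have g: "2 * tent.g u = arcsin (sin u / tent.\<kappa>)" unfolding tent.g_def by simp
  have c: "cos (2 * tent.g u) = sqrt (1 - (sin u / tent.\<kappa>)\<^sup>2)"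
    unfolding g using r by (intro cos_arcsin; linarith)
  have "\<beta> * cos (2 * u) + 2 + \<epsilon> = \<beta>\<^sup>2 * (1 - (sin u / tent.\<kappa>)\<^sup>2)"
  proof -
    have "\<beta>\<^sup>2 * (1 - (sin u / tent.\<kappa>)\<^sup>2) = \<beta>\<^sup>2 - \<beta> * (\<beta> / tent.\<kappa>\<^sup>2) * (sin u)\<^sup>2"
      by (simp add: power2_eq_square algebra_simps)
    also have "\<beta> / tent.\<kappa>\<^sup>2 = 2" using k tent.kappa_gt_1 by simp
    finally have eq: "\<beta>\<^sup>2 * (1 - (sin u / tent.\<kappa>)\<^sup>2) = \<beta>\<^sup>2 - \<beta> * 2 * (sin u)\<^sup>2" .
    show ?thesis unfolding eq cos_double_sin by (simp add: beta_sq algebra_simps)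
  qed
  then have "sqrt (\<beta> * cos (2 * u) + 2 + \<epsilon>) = \<beta> * cos (2 * tent.g u)"
    unfolding c using beta_gt_2 by (simp add: real_sqrt_mult)
  moreover have "cos (2 * (pi/2 - tent.g u)) = - cos (2 * tent.g u)"
    by (simp add: right_diff_distrib)
  ultimately show ?thesis unfolding branch_def by simp
qed

text \<open>Contraction by 1/2 per letter holds in the angular coordinate only; in \<open>x\<close>
  a branch has slope up to \<open>1 / (2 * \<alpha>)\<close>, which is unbounded for small
  \<open>\<epsilon>\<close>. Hence angular representatives are carried through the
  induction.\<close>

lemma cyl_conjugate:
  assumes "0 \<le> u" "u \<le> pi/2" "0 \<le> v" "v \<le> pi/2"
  shows "\<exists>u' v'. cyl w (\<beta> * cos (2 * u)) = \<beta> * cos (2 * u') \<and> cyl w (\<beta> * cos (2 * v)) = \<beta> * cos (2 * v') \<and>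
    0 \<le> u' \<and> u' \<le> pi/2 \<and> 0 \<le> v' \<and> v' \<le> pi/2 \<and> \<bar>u' - v'\<bar> \<le> \<bar>u - v\<bar> / 2 ^ length w"
proof (induction w)
  case Nil
  then show ?case using assms by auto
next
  case (Cons s w)
  then obtain u' v' where uv: "cyl w (\<beta> * cos (2 * u)) = \<beta> * cos (2 * u')" "cyl w (\<beta> * cos (2 * v)) = \<beta> * cos (2 * v')"
    "0 \<le> u'" "u' \<le> pi/2" "0 \<le> v'" "v' \<le> pi/2" "\<bar>u' - v'\<bar> \<le> \<bar>u - v\<bar> / 2 ^ length w" by blast
  let ?h = "\<lambda>u. if s then tent.g u else pi/2 - tent.g u"
  have h: "0 \<le> ?h x" "?h x \<le> pi/2" if "0 \<le> x" "x \<le> pi/2" for x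
    using tent.g_bounds[OF that] tent.hh_bounds by auto
  have "\<bar>tent.g u' - tent.g v'\<bar> \<le> \<bar>u' - v'\<bar> / 2"
    using tent.g_diff_le[of u' v'] tent.g_diff_le[of v' u'] tent.g_le[of u' v'] tent.g_le[of v' u'] uv
    by (cases "u' \<le> v'") auto
  then have "\<bar>?h u' - ?h v'\<bar> \<le> \<bar>u - v\<bar> / 2 ^ length (s # w)" using uv(7) by (auto simp: abs_minus_commute)
  then show ?case
    using uv h[OF uv(3,4)] h[OF uv(5,6)] branch_conjugate[OF uv(3,4), of s] branch_conjugate[OF uv(5,6), of s]
    by (intro exI[of _ "?h u'"] exI[of _ "?h v'"]) (simp del: if_image_distrib)
qed

lemma conjugate_onto:
  assumes "\<bar>x\<bar> \<le> \<beta>" obtains u where "0 \<le> u" "u \<le> pi/2" "x = \<beta> * cos (2 * u)"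
proof
  have "\<bar>x / \<beta>\<bar> \<le> 1" using assms beta_gt_2 by simp
  then have r: "- 1 \<le> x / \<beta>" "x / \<beta> \<le> 1" by linarith+
  show "0 \<le> arccos (x/\<beta>) / 2" "arccos (x/\<beta>) / 2 \<le> pi/2"
    using arccos_lbound[OF r] arccos_ubound[OF r] by auto
  show "x = \<beta> * cos (2 * (arccos (x/\<beta>) / 2))" using cos_arccos[OF r] beta_gt_2 by simp
qed

lemma cyl_contraction:
  assumes "\<bar>x\<bar> \<le> \<beta>" "\<bar>y\<bar> \<le> \<beta>"
  shows "\<bar>cyl w x - cyl w y\<bar> \<le> pi * \<beta> / 2 ^ length w"
proof -
  obtain u v where u: "0 \<le> u" "u \<le> pi/2" "x = \<beta> * cos (2 * u)" and v: "0 \<le> v" "v \<le> pi/2" "y = \<beta> * cos (2 * v)"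
    using conjugate_onto assms by metis
  obtain u' v' where uv: "cyl w x = \<beta> * cos (2 * u')" "cyl w y = \<beta> * cos (2 * v')"
    "\<bar>u' - v'\<bar> \<le> \<bar>u - v\<bar> / 2 ^ length w"
    using cyl_conjugate[OF u(1,2) v(1,2), of w] u(3) v(3) by blast
  have "\<bar>cyl w x - cyl w y\<bar> = \<beta> * \<bar>cos (2 * u') - cos (2 * v')\<bar>"
    unfolding uv right_diff_distrib[symmetric] abs_mult using beta_gt_2 by simp
  also have "\<dots> \<le> \<beta> * \<bar>2 * u' - 2 * v'\<bar>" using beta_gt_2 by (intro mult_left_mono abs_cos_diff_le) auto
  also have "\<dots> = 2 * \<beta> * \<bar>u' - v'\<bar>" by (simp add: right_diff_distrib[symmetric] abs_mult del: right_diff_distrib_numeral)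
  also have "\<dots> \<le> 2 * \<beta> * ((pi/2) / 2 ^ length w)"
  proof (rule mult_left_mono)
    have "\<bar>u - v\<bar> \<le> pi/2" using u v by linarith
    then have "\<bar>u - v\<bar> / 2 ^ length w \<le> (pi/2) / 2 ^ length w" by (rule divide_right_mono) simp
    then show "\<bar>u' - v'\<bar> \<le> (pi/2) / 2 ^ length w" using uv(3) by linarith
  qed (use beta_gt_2 in auto)
  finally show ?thesis by (simp add: mult_ac)
qed

text \<open>A difference of squares replaces the mean value theorem: the sum of the two branch
  values plays the part of the derivative of \<open>f\<close>.\<close>

lemma branch_diff:
  assumes "\<bar>x\<bar> \<le> \<beta>" "\<bar>y\<bar> \<le> \<beta>"
  shows "\<bar>branch s x - branch s y\<bar> * \<bar>branch s x + branch s y\<bar> = \<bar>x - y\<bar>"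
proof -
  have "(branch s x - branch s y) * (branch s x + branch s y) = (branch s x)\<^sup>2 - (branch s y)\<^sup>2"
    by (simp add: power2_eq_square algebra_simps)
  also have "\<dots> = x - y" using branch_bounds(3)[OF assms(1), of s] branch_bounds(3)[OF assms(2), of s]
    unfolding f_def by simp
  finally show ?thesis by (simp add: abs_mult[symmetric])
qed

text \<open>Values of one branch share their sign, so nothing cancels.\<close>

lemma branch_add:
  assumes "\<bar>x\<bar> \<le> \<beta>" "\<bar>y\<bar> \<le> \<beta>"
  shows "2 * \<alpha> \<le> \<bar>branch s x + branch s y\<bar>"
  using branch_bounds(1)[OF assms(1), of s] branch_bounds(1)[OF assms(2), of s]
    real_sqrt_gt_zero[OF branch_arg(3)[OF assms(1)]] real_sqrt_gt_zero[OF branch_arg(3)[OF assms(2)]]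
  unfolding branch_def by (cases s) simp_all

text \<open>Each letter changes the ratio of difference quotients by
  \<open>\<bar>p' + q'\<bar> / \<bar>p + q\<bar>\<close>, at most \<open>1 + ?t / \<alpha>\<close>
  because points of one cylinder are within \<open>?t\<close> of each other. As \<open>?t\<close>
  halves with every letter, the product is \<open>exp\<close> of a geometric sum below
  \<open>pi * \<beta> / \<alpha>\<close>. Products instead of quotients admit
  \<open>x = y\<close>.\<close>

lemma cyl_distortion:
  assumes "\<bar>x\<bar> \<le> \<beta>" "\<bar>y\<bar> \<le> \<beta>" "\<bar>x'\<bar> \<le> \<beta>" "\<bar>y'\<bar> \<le> \<beta>"
  shows "\<bar>cyl w x - cyl w y\<bar> * \<bar>x' - y'\<bar> \<le>
    exp (pi * \<beta> / \<alpha> * (1 - 1 / 2 ^ length w)) * (\<bar>cyl w x' - cyl w y'\<bar> * \<bar>x - y\<bar>)"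
proof (induction w)
  case (Cons s w)
  let ?K = "exp (pi * \<beta> / \<alpha> * (1 - 1 / 2 ^ length w))"
  let ?t = "pi * \<beta> / 2 ^ Suc (length w)"
  have b: "\<bar>cyl v z\<bar> \<le> \<beta>" if "z \<in> {x, y, x', y'}" for z v using that assms by (auto intro!: cyl_bounds)
  define p q p' q' where "p = branch s (cyl w x)" and "q = branch s (cyl w y)"
    and "p' = branch s (cyl w x')" and "q' = branch s (cyl w y')"
  have d: "\<bar>p - q\<bar> * \<bar>p + q\<bar> = \<bar>cyl w x - cyl w y\<bar>" "\<bar>p' - q'\<bar> * \<bar>p' + q'\<bar> = \<bar>cyl w x' - cyl w y'\<bar>"
    unfolding p_def q_def p'_def q'_def by (intro branch_diff b; simp)+
  have a: "2 * \<alpha> \<le> \<bar>p + q\<bar>"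
    unfolding p_def q_def by (intro branch_add b; simp)
  have "\<bar>p' - p\<bar> \<le> ?t" "\<bar>q' - q\<bar> \<le> ?t"
    using cyl_contraction[OF assms(3,1), of "s # w"] cyl_contraction[OF assms(4,2), of "s # w"]
    unfolding p_def q_def p'_def q'_def by auto
  then have "\<bar>p' + q'\<bar> \<le> \<bar>p + q\<bar> + 2 * ?t" by linarith
  also have "2 * ?t = 2 * \<alpha> * (?t / \<alpha>)" using alpha_pos by simp
  also have "\<dots> \<le> \<bar>p + q\<bar> * (?t / \<alpha>)"
    using a alpha_pos beta_gt_2 by (intro mult_right_mono) auto
  finally have "\<bar>p' + q'\<bar> \<le> \<bar>p + q\<bar> * (1 + ?t / \<alpha>)" by (simp add: distrib_left)
  also have "\<dots> \<le> \<bar>p + q\<bar> * exp (?t / \<alpha>)" by (intro mult_left_mono exp_ge_add_one_self) auto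
  finally have s: "\<bar>p' + q'\<bar> \<le> \<bar>p + q\<bar> * exp (?t / \<alpha>)" .
  have "\<bar>p + q\<bar> * (\<bar>p - q\<bar> * \<bar>x' - y'\<bar>) = \<bar>cyl w x - cyl w y\<bar> * \<bar>x' - y'\<bar>"
    unfolding d[symmetric] by (simp add: mult_ac)
  also have "\<dots> \<le> ?K * (\<bar>cyl w x' - cyl w y'\<bar> * \<bar>x - y\<bar>)" by (rule Cons.IH)
  also have "\<dots> = \<bar>p' + q'\<bar> * (?K * (\<bar>p' - q'\<bar> * \<bar>x - y\<bar>))"
    unfolding d[symmetric] by (simp add: mult_ac)
  also have "\<dots> \<le> \<bar>p + q\<bar> * exp (?t / \<alpha>) * (?K * (\<bar>p' - q'\<bar> * \<bar>x - y\<bar>))"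
    using s by (intro mult_right_mono) auto
  also have "\<dots> = \<bar>p + q\<bar> * (exp (?t / \<alpha>) * ?K * (\<bar>p' - q'\<bar> * \<bar>x - y\<bar>))" by (simp add: mult_ac)
  finally have "\<bar>p - q\<bar> * \<bar>x' - y'\<bar> \<le> exp (?t / \<alpha>) * ?K * (\<bar>p' - q'\<bar> * \<bar>x - y\<bar>)"
    using a alpha_pos by (simp add: mult_le_cancel_left)
  also have "exp (?t / \<alpha>) * ?K = exp (pi * \<beta> / \<alpha> * (1 - 1 / 2 ^ length (s # w)))"
  proof -
    have "c * x / 2 + c * (1 - x) = c * (1 - x / 2)" for c x :: real by (simp add: algebra_simps)
    from this[of "pi * \<beta> / \<alpha>" "1 / 2 ^ length w"] show ?thesis
      unfolding exp_add[symmetric] by (simp add: mult_ac)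
  qed
  finally show ?case unfolding p_def q_def p'_def q'_def by simp
qed simp

definition dist_const :: real where "dist_const = exp (pi * \<beta> / \<alpha>) / (2 * \<beta>)"

lemma dist_const_pos: "0 < dist_const" unfolding dist_const_def using beta_gt_2 by simp

lemma len_nonneg: "0 \<le> len w" unfolding len_def by simp

text \<open>Distortion of \<open>cyl p\<close>, applied to the endpoints of the cylinder of
  \<open>v\<close> and to \<open>\<plusminus>\<beta>\<close>; the distance
  \<open>2 * \<beta>\<close> of the latter is divided out in \<open>dist_const\<close>.\<close>

lemma len_append: "len (p @ v) \<le> dist_const * len p * len v"
proof -
  have "\<bar>cyl v \<beta>\<bar> \<le> \<beta>" "\<bar>cyl v (- \<beta>)\<bar> \<le> \<beta>" "\<bar>\<beta>\<bar> \<le> \<beta>" "\<bar>- \<beta>\<bar> \<le> \<beta>"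
    using beta_gt_2 by (auto intro!: cyl_bounds)
  from cyl_distortion[OF this, of p]
  have "len (p @ v) * (2 * \<beta>) \<le> exp (pi * \<beta> / \<alpha> * (1 - 1 / 2 ^ length p)) * (len p * len v)"
    using beta_gt_2 unfolding len_def cyl_append by simp
  also have "\<dots> \<le> exp (pi * \<beta> / \<alpha>) * (len p * len v)"
  proof (intro mult_right_mono)
    have "pi * \<beta> / \<alpha> * (1 - 1 / 2 ^ length p) \<le> pi * \<beta> / \<alpha>"
      using beta_gt_2 alpha_pos by (intro mult_left_le) auto
    then show "exp (pi * \<beta> / \<alpha> * (1 - 1 / 2 ^ length p)) \<le> exp (pi * \<beta> / \<alpha>)"
      by (simp only: exp_le_cancel_iff)
  qed (simp add: len_nonneg)
  finally show ?thesis unfolding dist_const_def using beta_gt_2 by (simp add: field_simps)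
qed

lemma len_le: "len w \<le> pi * \<beta> / 2 ^ length w"
  unfolding len_def using beta_gt_2 by (intro cyl_contraction) auto

section \<open>Total cylinder length \<open>b n\<close> against the angular measure
  \<open>a n\<close>\<close>

lemma X_conjugate: "X n = (\<lambda>u. \<beta> * cos (2 * u)) ` tent.A n"
proof (induction n)
  case 0
  have "(\<lambda>u. \<beta> * cos (2 * u)) ` {0..pi/2} = {- \<beta>..\<beta>}"
  proof (intro equalityI subsetI)
    fix x assume "x \<in> {- \<beta>..\<beta>}"
    then obtain u where "0 \<le> u" "u \<le> pi/2" "x = \<beta> * cos (2 * u)"
      using conjugate_onto[of x] by (auto simp: abs_le_iff)
    then show "x \<in> (\<lambda>u. \<beta> * cos (2 * u)) ` {0..pi/2}" by auto
  next
    fix x assume "x \<in> (\<lambda>u. \<beta> * cos (2 * u)) ` {0..pi/2}"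
    then obtain u where u: "x = \<beta> * cos (2 * u)" by auto
    have "\<bar>x\<bar> \<le> \<beta> * 1" unfolding u abs_mult using beta_gt_2 by (intro mult_mono abs_cos_le_one) auto
    then show "x \<in> {- \<beta>..\<beta>}" by (auto simp: abs_le_iff)
  qed
  then show ?case by (simp add: X_0)
next
  case (Suc n)
  have "branch s ` (\<lambda>u. \<beta> * cos (2 * u)) ` tent.A n =
     (\<lambda>u. \<beta> * cos (2 * u)) ` (\<lambda>u. if s then tent.g u else pi/2 - tent.g u) ` tent.A n" for s
    unfolding image_image
    by (rule image_cong[OF refl], rule branch_conjugate) (auto dest: tent.A_bounds)
  then show ?case
    unfolding X_Suc Suc.IH UN_bool_eq by (simp add: image_Un)
qed

lemma b_eq: "b n = integral (tent.A n) (\<lambda>u. 2 * \<beta> * sin (2 * u))"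
proof -
  have "b n = integral (tent.A n) (\<lambda>u. \<bar>- (2 * \<beta> * sin (2 * u))\<bar>)"
    unfolding b_def X_conjugate
  proof (rule measure_differentiable_image_compact[OF tent.A_compact])
    show "((\<lambda>u. \<beta> * cos (2 * u)) has_real_derivative - (2 * \<beta> * sin (2 * u))) (at u within tent.A n)" for u
      by (auto intro!: derivative_eq_intros)
    show "inj_on (\<lambda>u. \<beta> * cos (2 * u)) (tent.A n)"
    proof (rule inj_onI)
      fix x y assume xy: "x \<in> tent.A n" "y \<in> tent.A n" and eq: "\<beta> * cos (2 * x) = \<beta> * cos (2 * y)"
      have "cos (2 * x) = cos (2 * y)" using eq beta_gt_2 by simp
      then have "2 * x = 2 * y"
        by (rule cos_inj_pi[rotated -1]) (use tent.A_bounds[OF xy(1)] tent.A_bounds[OF xy(2)] in linarith)+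
      then show "x = y" by simp
    qed
  qed (auto intro!: continuous_intros)
  also have "\<dots> = integral (tent.A n) (\<lambda>u. 2 * \<beta> * sin (2 * u))"
  proof (rule integral_cong)
    fix u assume "u \<in> tent.A n"
    then have "0 \<le> sin (2 * u)" by (intro sin_ge_zero) (auto dest: tent.A_bounds)
    then show "\<bar>- (2 * \<beta> * sin (2 * u))\<bar> = 2 * \<beta> * sin (2 * u)" using beta_gt_2 by simp
  qed
  finally show ?thesis .
qed

lemma b_le: "b n \<le> 2 * \<beta> * tent.a n"
proof -
  have "integral (tent.A n) (\<lambda>u. 2 * \<beta> * sin (2 * u)) \<le> integral (tent.A n) (\<lambda>_. 2 * \<beta>)"
    using beta_gt_2
    by (intro integral_le integral_const_lmeasurable integrable_on_compact tent.A_compact continuous_intros)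
      (auto simp: mult_left_le)
  also have "\<dots> = 2 * \<beta> * tent.a n" unfolding tent.a_def by (rule integral_const_lmeasurable) simp
  finally show ?thesis unfolding b_eq .
qed

text \<open>The Jacobian \<open>2 * \<beta> * sin (2 * u)\<close> vanishes at both ends, so only the
  middle half is counted; there it is at least \<open>4 * (pi/8) \<ge> 1\<close>.\<close>

lemma b_ge: "tent.G n (3*pi/8) - tent.G n (pi/8) \<le> b n"
proof -
  let ?T = "tent.A n \<inter> {pi/8..3*pi/8}"
  have T: "compact ?T" by (intro compact_Int_closed tent.A_compact) auto
  have "tent.G n (3*pi/8) \<le> measure lebesgue (tent.A n \<inter> {0..pi/8} \<union> ?T)"
    unfolding tent.G_def
    by (intro measure_mono_fmeasurable fmeasurable.Un) (auto simp: fmeasurableD)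
  also have "\<dots> \<le> tent.G n (pi/8) + measure lebesgue ?T"
    unfolding tent.G_def by (rule measure_Un_le) (auto simp: fmeasurableD)
  finally have "tent.G n (3*pi/8) - tent.G n (pi/8) \<le> measure lebesgue ?T" by simp
  also have "\<dots> = integral ?T (\<lambda>_. 1)" by (simp add: integral_const_lmeasurable)
  also have "\<dots> \<le> integral ?T (\<lambda>u. 2 * \<beta> * sin (2 * u))"
  proof (rule integral_le)
    show "(\<lambda>_. 1 :: real) integrable_on ?T" "(\<lambda>u. 2 * \<beta> * sin (2 * u)) integrable_on ?T"
      by (intro integrable_on_compact T continuous_intros)+
    fix u assume u: "u \<in> ?T"
    have "(pi/4) / 2 \<le> sin (2 * u)"
    proof (cases "2 * u \<le> pi/2")
      case True
      have "sin (pi/4) \<le> sin (2 * u)" using u True by (intro sin_monotone_2pi_le) auto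
      moreover have "(pi/4) / 2 \<le> sin (pi/4)" by (rule half_le_sin) auto
      ultimately show ?thesis by simp
    next
      case False
      have "sin (pi/4) \<le> sin (pi - 2 * u)" using u False by (intro sin_monotone_2pi_le) auto
      moreover have "(pi/4) / 2 \<le> sin (pi/4)" by (rule half_le_sin) auto
      ultimately show ?thesis by simp
    qed
    then have "4 * (1/4) \<le> 2 * \<beta> * sin (2 * u)" using beta_gt_2 pi_gt3 by (intro mult_mono) auto
    then show "1 \<le> 2 * \<beta> * sin (2 * u)" by simp
  qed
  also have "\<dots> \<le> integral (tent.A n) (\<lambda>u. 2 * \<beta> * sin (2 * u))"
  proof -
    have "0 \<le> 2 * \<beta> * sin (2 * u)" if "u \<in> tent.A n" for u
      using beta_gt_2 tent.A_bounds[OF that] by (intro mult_nonneg_nonneg sin_ge_zero) auto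
    then show ?thesis
      by (intro integral_subset_le integrable_on_compact T tent.A_compact continuous_intros) auto
  qed
  finally show ?thesis unfolding b_eq .
qed

end

section \<open>Hausdorff dimension\<close>

text \<open>Jensen through Young: \<open>x powr s * m powr (1 - s) \<le> s * x + (1 - s) * m\<close>
  with \<open>m\<close> the mean, summed over \<open>W\<close>.\<close>

lemma sum_powr_le:
  assumes "finite W" "\<And>i. i \<in> W \<Longrightarrow> 0 \<le> x i" "0 < s" "s \<le> (1::real)"
  shows "(\<Sum>i\<in>W. x i powr s) \<le> real (card W) powr (1 - s) * (\<Sum>i\<in>W. x i) powr s"
proof (cases "(\<Sum>i\<in>W. x i) = 0")
  case True
  then have "\<And>i. i \<in> W \<Longrightarrow> x i = 0" using assms sum_nonneg_eq_0_iff by blast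
  then show ?thesis by simp
next
  case False
  define N where "N = real (card W)"
  define m where "m = (\<Sum>i\<in>W. x i) / N"
  have "W \<noteq> {}" using False by auto
  then have N: "0 < N" unfolding N_def using assms by (simp add: card_gt_0_iff)
  have sum_pos: "0 < (\<Sum>i\<in>W. x i)" using False sum_nonneg[of W x] assms(2) by fastforce
  then have m: "0 < m" unfolding m_def using N by simp
  have "x i powr s * m powr (1 - s) \<le> s * x i + (1 - s) * m" if "i \<in> W" for i
  proof (cases "x i = 0")
    case False
    then show ?thesis using assms that m by (intro Youngs_inequality_0) (auto simp: less_le)
  qed (use assms m in simp)
  then have "(\<Sum>i\<in>W. x i powr s * m powr (1 - s)) \<le> (\<Sum>i\<in>W. s * x i + (1 - s) * m)" by (rule sum_mono)
  also have "\<dots> = s * (\<Sum>i\<in>W. x i) + N * ((1 - s) * m)"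
    by (simp add: sum.distrib N_def sum_distrib_left)
  also have "(\<Sum>i\<in>W. x i) = N * m" unfolding m_def using N by simp
  also have "s * (N * m) + N * ((1 - s) * m) = N * m" by (simp add: algebra_simps)
  finally have "(\<Sum>i\<in>W. x i powr s) * m powr (1 - s) \<le> N * m" by (simp add: sum_distrib_right)
  moreover have "m = m powr s * m powr (1 - s)" using m by (simp add: powr_add[symmetric])
  ultimately have "(\<Sum>i\<in>W. x i powr s) * m powr (1 - s) \<le> (N * m powr s) * m powr (1 - s)"
    by (metis mult.assoc)
  then have "(\<Sum>i\<in>W. x i powr s) \<le> N * m powr s" using m by simp
  also have "\<dots> = N powr 1 * N powr (- s) * (\<Sum>i\<in>W. x i) powr s"
    unfolding m_def using N sum_pos by (simp add: powr_divide powr_minus field_simps)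
  also have "\<dots> = N powr (1 - s) * (\<Sum>i\<in>W. x i) powr s" by (simp only: powr_add[symmetric]) simp
  finally show ?thesis unfolding N_def .
qed

section \<open>Upper bound: covering by cylinders\<close>

context real_julia
begin

abbreviation J :: "complex set" where "J \<equiv> julia_set (complex_of_real (- \<epsilon>))"

text \<open>The finitely many cylinders of level \<open>n\<close> are enumerated and padded with
  empty sets, which cost nothing.\<close>

lemma premeasure_le_cyl:
  assumes "0 < s" "pi * \<beta> / 2 ^ n \<le> \<rho>"
  shows "hausdorff_premeasure s \<rho> J \<le> ennreal (\<Sum>w\<in>words n. len w powr s)"
proof -
  obtain h where h: "bij_betw h {0..<card (words n)} (words n)"
    using ex_bij_betw_nat_finite[OF words_finite] by blast
  define N where "N = card (words n)"
  define U where "U i = (if i < N then complex_of_real ` cyl (h i) ` {- \<beta>..\<beta>} else {})" for i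
  have hw: "h i \<in> words n" if "i < N" for i using h that unfolding N_def bij_betw_def by auto
  have diam: "bounded (U i) \<and> diameter (U i) \<le> (if i < N then len (h i) else 0)" for i
  proof (cases "i < N")
    case True
    have U: "U i = complex_of_real ` closed_segment (cyl (h i) (- \<beta>)) (cyl (h i) \<beta>)"
      unfolding U_def using True by (simp add: cyl_image)
    have "diameter (U i) \<le> len (h i)"
      by (rule diameter_le) (auto simp: U closed_segment_eq_real_ivl len_def len_nonneg
          simp flip: of_real_diff split: if_splits)
    moreover have "bounded (U i)"
      unfolding U by (intro compact_imp_bounded compact_continuous_image continuous_intros compact_segment)
    ultimately show ?thesis using True by simp
  qed (simp add: U_def)
  have dlen: "diameter (U i) \<le> \<rho>" for i
  proof (cases "i < N")
    case True
    then have "len (h i) \<le> pi * \<beta> / 2 ^ n" using len_le[of "h i"] hw[OF True] by (simp add: words_def)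
    then show ?thesis using diam[of i] True assms by simp
  next
    case False
    have "0 \<le> pi * \<beta> / 2 ^ n" using beta_gt_2 by simp
    then have "0 \<le> \<rho>" using assms by linarith
    then show ?thesis using diam[of i] False by simp
  qed
  have "J \<subseteq> (\<Union>i. U i)"
  proof
    fix z assume "z \<in> J"
    then obtain x where x: "z = complex_of_real x" "x \<in> X n" unfolding julia by auto
    then obtain w where w: "w \<in> words n" "x \<in> cyl w ` {- \<beta>..\<beta>}" unfolding X_words by auto
    have "w \<in> h ` {0..<N}" using h w(1) unfolding N_def bij_betw_def by simp
    then obtain i where i: "i < N" "w = h i" by auto
    have "z \<in> U i" unfolding U_def using i w x by simp
    then show "z \<in> (\<Union>i. U i)" by blast
  qed
  then have "hausdorff_premeasure s \<rho> J \<le> (\<Sum>i. hausdorff_gauge s (U i))"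
    unfolding hausdorff_premeasure_def using diam dlen by (intro INF_lower) auto
  also have "\<dots> = (\<Sum>i\<in>{0..<N}. hausdorff_gauge s (U i))"
    by (rule suminf_finite) (auto simp: U_def hausdorff_gauge_def)
  also have "\<dots> \<le> (\<Sum>i\<in>{0..<N}. ennreal (len (h i) powr s))"
  proof (rule sum_mono)
    fix i assume i: "i \<in> {0..<N}"
    have "diameter (U i) powr s \<le> len (h i) powr s"
      using diam[of i] i assms by (intro powr_mono2 diameter_ge_0) auto
    then show "hausdorff_gauge s (U i) \<le> ennreal (len (h i) powr s)"
      unfolding hausdorff_gauge_def using assms by (auto intro: ennreal_leI)
  qed
  also have "\<dots> = ennreal (\<Sum>i\<in>{0..<N}. len (h i) powr s)" by (rule sum_ennreal) simp
  also have "(\<Sum>i\<in>{0..<N}. len (h i) powr s) = (\<Sum>w\<in>words n. len w powr s)"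
    unfolding N_def by (rule sum.reindex_bij_betw[OF h])
  finally show ?thesis .
qed

lemma dim_le:
  assumes s: "0 < s" "s \<le> 1" and l: "0 < l" "\<And>n. tent.a (Suc n) \<le> l * tent.a n"
    and small: "2 powr (1 - s) * l powr s < 1"
  shows "hausdorff_dim J \<le> ennreal s"
proof -
  define q where "q = 2 powr (1 - s) * l powr s"
  have q: "0 < q" "q < 1" unfolding q_def using small l by auto
  have a: "tent.a n \<le> pi/2 * l ^ n" for n
  proof (induction n)
    case (Suc n)
    have "tent.a (Suc n) \<le> l * tent.a n" by (rule l)
    also have "\<dots> \<le> l * (pi/2 * l ^ n)" using Suc l by (intro mult_left_mono) auto
    finally show ?case by (simp add: mult_ac)
  qed (simp add: tent.a_0)
  have sum_le: "(\<Sum>w\<in>words n. len w powr s) \<le> (pi * \<beta>) powr s * q ^ n" for n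
  proof -
    have b: "b n \<le> pi * \<beta> * l ^ n"
    proof -
      have "b n \<le> 2 * \<beta> * tent.a n" by (rule b_le)
      also have "\<dots> \<le> 2 * \<beta> * (pi/2 * l ^ n)" using a[of n] beta_gt_2 by (intro mult_left_mono) auto
      finally show ?thesis by (simp add: mult_ac)
    qed
    have "(\<Sum>w\<in>words n. len w powr s) \<le> real (card (words n)) powr (1 - s) * b n powr s"
      unfolding b_words using s by (intro sum_powr_le) (auto simp: len_nonneg)
    also have "\<dots> \<le> real (card (words n)) powr (1 - s) * (pi * \<beta> * l ^ n) powr s"
      using b s by (intro mult_left_mono powr_mono2) (auto simp: b_def)
    also have "\<dots> = (pi * \<beta>) powr s * q ^ n"
    proof -
      have "real (card (words n)) powr (1 - s) = (2 powr (1 - s)) ^ n"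
        by (simp add: words_card powr_realpow[symmetric] powr_powr mult.commute)
      moreover have "(pi * \<beta> * l ^ n) powr s = (pi * \<beta>) powr s * (l powr s) ^ n"
        using beta_gt_2 l by (simp add: powr_mult powr_realpow[symmetric] powr_powr mult.commute)
      ultimately show ?thesis unfolding q_def by (simp add: power_mult_distrib)
    qed
    finally show ?thesis .
  qed
  have "hausdorff_premeasure s \<rho> J = 0" if "0 < \<rho>" for \<rho>
  proof -
    have "(\<lambda>n. pi * \<beta> / 2 ^ n) \<longlonglongrightarrow> 0" by real_asymp
    then have "\<forall>\<^sub>F n in sequentially. pi * \<beta> / 2 ^ n < \<rho>" by (rule order_tendstoD) (rule that)
    then have ev: "\<forall>\<^sub>F n in sequentially. hausdorff_premeasure s \<rho> J \<le> ennreal ((pi * \<beta>) powr s * q ^ n)"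
    proof eventually_elim
      case (elim n)
      have "hausdorff_premeasure s \<rho> J \<le> ennreal (\<Sum>w\<in>words n. len w powr s)"
        by (rule premeasure_le_cyl) (use s elim in auto)
      also have "\<dots> \<le> ennreal ((pi * \<beta>) powr s * q ^ n)" by (intro ennreal_leI sum_le)
      finally show ?case .
    qed
    have "(\<lambda>n. (pi * \<beta>) powr s * q ^ n) \<longlonglongrightarrow> (pi * \<beta>) powr s * 0"
      using q by (intro tendsto_mult tendsto_const LIMSEQ_power_zero) auto
    then have "(\<lambda>n. ennreal ((pi * \<beta>) powr s * q ^ n)) \<longlonglongrightarrow> ennreal 0"
      by (intro tendsto_ennrealI) simp
    then have "hausdorff_premeasure s \<rho> J \<le> ennreal 0"
      by (rule tendsto_lowerbound[OF _ ev]) simp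
    then show ?thesis by simp
  qed
  then have "hausdorff_measure s J = 0" unfolding hausdorff_measure_def by simp
  then show ?thesis unfolding hausdorff_dim_def using s by (intro Inf_lower) auto
qed

lemma beta_in_X: "\<beta> \<in> X n"
proof -
  have "f \<beta> = \<beta>" unfolding f_def by (simp add: beta_sq)
  then have "(f ^^ j) \<beta> = \<beta>" for j by (induction j) auto
  then show ?thesis unfolding X_def using beta_gt_2 by simp
qed

text \<open>\<open>\<beta>\<close> is a fixed point, so every cylinder contains a point of the limit
  set; a neighbourhood property of the limit set thereby reaches all cylinders.\<close>

lemma cyl_beta_in_X: "cyl w \<beta> \<in> (\<Inter>n. X n)"
proof (induction w)
  case Nil
  then show ?case using beta_in_X by simp
next
  case (Cons s w)
  have "cyl (s # w) \<beta> \<in> X n" for n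
  proof -
    have "cyl (s # w) \<beta> \<in> X (Suc n)" unfolding X_Suc using Cons by auto
    then show ?thesis unfolding X_def by auto
  qed
  then show ?case by blast
qed

end

section \<open>Lower bound: mass distribution on finite levels\<close>

lemma exists_dyadic_scale:
  assumes "0 < (r::real)" "r \<le> 1" obtains m where "1 / 2 ^ m \<le> r" "2 ^ m \<le> 2 / r"
proof -
  have ex: "\<exists>j. 1 / 2 ^ j \<le> r"
    using real_arch_pow_inv[OF assms(1), of "1/2"] by (auto simp: power_divide intro: less_imp_le)
  define m where "m = (LEAST j. 1 / 2 ^ j \<le> r)"
  have "2 ^ m \<le> 2 / r"
  proof (cases m)
    case 0
    then show ?thesis using assms by simp
  next
    case (Suc k)
    then have "\<not> 1 / 2 ^ k \<le> r" using not_less_Least[of k "\<lambda>j. 1 / 2 ^ j \<le> r"] unfolding m_def by simp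
    then show ?thesis using assms Suc by (simp add: field_simps)
  qed
  moreover have "1 / 2 ^ m \<le> r" unfolding m_def by (rule LeastI_ex[OF ex])
  ultimately show ?thesis by (rule that[rotated])
qed

text \<open>Both estimates come from the escape rate and concern the angular measure
  \<open>a\<close>; \<open>middle\<close> carries them over to \<open>b\<close>.\<close>

locale real_julia_lower = real_julia +
  fixes s :: real
  assumes s_pos: "0 < s" and s_le: "s \<le> 1"
    and a_ge: "\<And>n. 2 powr (s - 1) * tent.a n \<le> tent.a (Suc n)"
    and middle: "\<And>n. tent.a n / 4 \<le> tent.G n (3*pi/8) - tent.G n (pi/8)"
begin

lemma a_add: "tent.a m \<le> (2 powr (1 - s)) ^ k * tent.a (m + k)"
proof (induction k)
  case (Suc k)
  have 1: "tent.a (m + k) \<le> 2 powr (1 - s) * tent.a (m + Suc k)"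
    using a_ge[of "m + k"] by (simp add: powr_diff field_simps)
  note Suc
  also have "(2 powr (1 - s)) ^ k * tent.a (m + k) \<le> (2 powr (1 - s)) ^ k * (2 powr (1 - s) * tent.a (m + Suc k))"
    using 1 by (intro mult_left_mono) auto
  finally show ?case by (simp add: mult_ac)
qed simp

lemma a_pos: "0 < tent.a n"
  using a_add[of 0 n] pi_gt_zero tent.a_nonneg[of n] by (cases "tent.a n = 0") (auto simp: tent.a_0)

lemma b_pos: "0 < b n"
  using b_ge[of n] middle[of n] a_pos[of n] by linarith

text \<open>The constant combines \<open>b m \<le> 2 * \<beta> * a m\<close> with
  \<open>a n \<le> 4 * b n\<close>.\<close>

lemma b_add: "b m \<le> 8 * \<beta> * (2 powr (1 - s)) ^ k * b (m + k)"
proof -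
  have "b m \<le> 2 * \<beta> * tent.a m" by (rule b_le)
  also have "\<dots> \<le> 2 * \<beta> * ((2 powr (1 - s)) ^ k * (4 * b (m + k)))"
  proof (intro mult_left_mono)
    have "tent.a (m + k) \<le> 4 * b (m + k)" using b_ge[of "m + k"] middle[of "m + k"] by linarith
    then have "(2 powr (1 - s)) ^ k * tent.a (m + k) \<le> (2 powr (1 - s)) ^ k * (4 * b (m + k))"
      by (intro mult_left_mono) auto
    then show "tent.a m \<le> (2 powr (1 - s)) ^ k * (4 * b (m + k))" using a_add[of m k] by linarith
  qed (use beta_gt_2 in auto)
  finally show ?thesis by (simp add: mult_ac)
qed

text \<open>The factors in order: distortion; total length, divided by \<open>r\<close>, of the
  level-\<open>m\<close> cylinders near an interval of radius \<open>r\<close>;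
  \<open>8 * \<beta>\<close> from \<open>b_add\<close> times 2 for rounding \<open>r\<close> to a
  power of 2.\<close>

definition C :: real where "C = dist_const * (2 + 2 * (pi * \<beta>)) * (16 * \<beta>)"

lemma C_pos: "0 < C"
  unfolding C_def using dist_const_pos beta_gt_2 by (intro mult_pos_pos add_pos_pos) auto

text \<open>Each word is split at the level \<open>m\<close> with \<open>1 / 2 ^ m\<close> about
  \<open>r\<close>. The prefixes near the interval have total length O(\<open>r\<close>), by
  distortion the continuations contribute \<open>b (n - m)\<close>, and \<open>b_add\<close> makes
  this O(\<open>r powr (s - 1)\<close>) times \<open>b n\<close>. Staying at finite levels avoids a
  limit measure.\<close>

lemma frostman:
  assumes r: "0 < r" "r \<le> 1"
  shows "\<forall>\<^sub>F n in sequentially.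
    (\<Sum>w | w \<in> words n \<and> cyl w ` {- \<beta>..\<beta>} \<subseteq> {x - r<..<x + r}. len w) \<le> C * r powr s * b n"
proof -
  let ?I = "{- \<beta>..\<beta>}" and ?V = "{x - r<..<x + r}"
  obtain m where m: "1 / 2 ^ m \<le> r" "2 ^ m \<le> 2 / r" using exists_dyadic_scale[OF r] .
  define P where "P = {p \<in> words m. cyl p ` ?I \<inter> ?V \<noteq> {}}"
  have P: "P \<subseteq> words m" unfolding P_def by auto
  have finP: "finite P" using P words_finite finite_subset by blast
  define D where "D = pi * \<beta>"
  have D: "0 < D" unfolding D_def using beta_gt_2 by simp
  have sumP: "(\<Sum>p\<in>P. len p) \<le> (2 + 2 * D) * r"
  proof -
    \<comment> \<open>A prefix cylinder has length at most \<open>D / 2 ^ m \<le> D * r\<close>, so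
      it stays within \<open>D * r\<close> of \<open>?V\<close>; disjointness then bounds the sum of
      lengths.\<close>
    have "(\<Union>p\<in>P. cyl p ` ?I) \<subseteq> {x - r - D * r..x + r + D * r}"
    proof
      fix z assume "z \<in> (\<Union>p\<in>P. cyl p ` ?I)"
      then obtain p y where py: "p \<in> P" "z = cyl p y" "y \<in> ?I" by blast
      then obtain y' where "y' \<in> ?I" "cyl p y' \<in> ?V" "p \<in> words m" unfolding P_def by blast
      note p = this(3) py(2,3) this(1,2)
      have "\<bar>cyl p y - cyl p y'\<bar> \<le> D / 2 ^ length p"
        unfolding D_def using p by (intro cyl_contraction) (auto simp: abs_le_iff)
      also have "\<dots> = D * (1 / 2 ^ m)" using p by (simp add: words_def)
      also have "\<dots> \<le> D * r" using m D by (intro mult_left_mono) auto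
      finally show "z \<in> {x - r - D * r..x + r + D * r}" using p(2,5) by auto
    qed
    then have "measure lebesgue (\<Union>p\<in>P. cyl p ` ?I) \<le> measure lebesgue {x - r - D * r..x + r + D * r}"
      using finP by (intro measure_mono_fmeasurable) (auto intro!: sets.finite_UN fmeasurableD cyl_lmeasurable)
    also have "\<dots> = (2 + 2 * D) * r" using r D by (simp add: algebra_simps)
    finally show ?thesis unfolding measure_UN_cyl[OF P] .
  qed
  show ?thesis
    unfolding eventually_sequentially
  proof (intro exI allI impI)
    fix n assume n: "m \<le> n"
    let ?W = "{w. w \<in> words n \<and> cyl w ` ?I \<subseteq> ?V}"
    have "?W \<subseteq> (\<lambda>(p, v). p @ v) ` (P \<times> words (n - m))"
    proof
      fix w assume w: "w \<in> ?W"
      have "cyl w \<beta> \<in> cyl w ` ?I" using beta_gt_2 by (intro imageI) simp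
      then have "cyl w \<beta> \<in> ?V" using w by blast
      moreover have "cyl w \<beta> = cyl (take m w) (cyl (drop m w) \<beta>)" by (simp flip: cyl_append)
      moreover have "cyl (drop m w) \<beta> \<in> ?I" using cyl_bounds[of \<beta> "drop m w"] beta_gt_2 by (auto simp: abs_le_iff)
      ultimately have "cyl (take m w) (cyl (drop m w) \<beta>) \<in> cyl (take m w) ` ?I \<inter> ?V" by auto
      then have "take m w \<in> P" using w n unfolding P_def words_def by auto
      moreover have "drop m w \<in> words (n - m)" using w unfolding words_def by auto
      moreover have "w = (\<lambda>(p, v). p @ v) (take m w, drop m w)" by simp
      ultimately show "w \<in> (\<lambda>(p, v). p @ v) ` (P \<times> words (n - m))" by blast
    qed
    then have "(\<Sum>w\<in>?W. len w) \<le> (\<Sum>w\<in>(\<lambda>(p, v). p @ v) ` (P \<times> words (n - m)). len w)"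
      using finP by (intro sum_mono2) (auto simp: len_nonneg)
    also have "\<dots> = (\<Sum>(p, v)\<in>P \<times> words (n - m). len (p @ v))"
      using P by (subst sum.reindex) (auto simp: inj_on_def words_def case_prod_unfold subset_iff)
    also have "\<dots> \<le> (\<Sum>(p, v)\<in>P \<times> words (n - m). dist_const * len p * len v)"
      by (intro sum_mono) (auto simp: len_append)
    also have "\<dots> = dist_const * (\<Sum>p\<in>P. len p) * b (n - m)"
      unfolding sum.cartesian_product[symmetric] b_words mult.assoc sum_product
      by (simp add: sum_distrib_left)
    also have "\<dots> \<le> dist_const * ((2 + 2 * D) * r) * (16 * \<beta> * r powr (s - 1) * b n)"
    proof (intro mult_mono mult_left_mono sumP)
      have "(2 powr (1 - s)) ^ m = (2 ^ m) powr (1 - s)"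
        by (simp add: powr_realpow[symmetric] powr_powr mult.commute)
      also have "\<dots> \<le> (2 / r) powr (1 - s)" using m s_le by (intro powr_mono2) auto
      also have "\<dots> = 2 powr (1 - s) * r powr (s - 1)"
        using r powr_minus_divide[of r "1 - s"] by (simp add: powr_divide)
      also have "\<dots> \<le> 2 powr 1 * r powr (s - 1)" using s_pos by (intro mult_right_mono powr_mono) auto
      finally have "8 * \<beta> * (2 powr (1 - s)) ^ m * b n \<le> 8 * \<beta> * (2 * r powr (s - 1)) * b n"
        using beta_gt_2 b_pos[of n] by (intro mult_right_mono mult_left_mono) auto
      then show "b (n - m) \<le> 16 * \<beta> * r powr (s - 1) * b n"
        using order_trans[OF b_add[of "n - m" m]] n by simp
    qed (use dist_const_pos b_pos[of "n - m"] D r in \<open>auto intro!: mult_nonneg_nonneg sum_nonneg len_nonneg\<close>)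
    also have "\<dots> = C * (r powr 1 * r powr (s - 1)) * b n" unfolding C_def D_def using r by (simp add: mult_ac)
    also have "r powr 1 * r powr (s - 1) = r powr s" by (simp only: powr_add[symmetric]) simp
    finally show "(\<Sum>w\<in>?W. len w) \<le> C * r powr s * b n" .
  qed
qed

text \<open>A Lebesgue number \<open>e\<close> of the cover and a level with cylinders shorter than
  \<open>e\<close> put each cylinder, through its point \<open>cyl w \<beta>\<close>, inside a
  single interval. The Frostman bounds then add up to at least \<open>b n\<close>, which
  cancels.\<close>

lemma finite_cover_bound:
  fixes E :: "'i set" and x r :: "'i \<Rightarrow> real"
  assumes E: "finite E" "\<And>i. i \<in> E \<Longrightarrow> 0 < r i \<and> r i \<le> 1"
    and cov: "(\<Inter>n. X n) \<subseteq> (\<Union>i\<in>E. {x i - r i<..<x i + r i})"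
  shows "1 \<le> C * (\<Sum>i\<in>E. r i powr s)"
proof -
  let ?V = "\<lambda>i. {x i - r i<..<x i + r i}"
  have comp: "compact (\<Inter>n. X n)" by (rule compact_Inter) (auto simp: X_compact)
  have "\<exists>e>0. \<forall>y\<in>(\<Inter>n. X n). \<exists>i\<in>E. ball y e \<subseteq> ?V i"
  proof (rule Heine_Borel_lemma[OF comp cov])
    fix e :: real
    assume "0 < e" "\<And>y. y \<in> (\<Inter>n. X n) \<Longrightarrow> \<exists>B\<in>?V ` E. ball y e \<subseteq> B"
    then show ?thesis by (metis (no_types, lifting) imageE)
  next
    fix B assume "B \<in> ?V ` E"
    then show "open B" by auto
  qed
  then obtain e where e': "0 < e \<and> (\<forall>y\<in>(\<Inter>n. X n). \<exists>i\<in>E. ball y e \<subseteq> ?V i)" ..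
  have e: "0 < e" using e' by (rule conjunct1)
  have e2: "\<forall>y\<in>(\<Inter>n. X n). \<exists>i\<in>E. ball y e \<subseteq> ?V i" using e' by (rule conjunct2)
  have "(\<lambda>n. pi * \<beta> / 2 ^ n) \<longlonglongrightarrow> 0" by real_asymp
  then have "\<forall>\<^sub>F n in sequentially. pi * \<beta> / 2 ^ n < e" by (rule order_tendstoD) (rule e)
  moreover have "\<forall>\<^sub>F n in sequentially. \<forall>i\<in>E.
      (\<Sum>w | w \<in> words n \<and> cyl w ` {- \<beta>..\<beta>} \<subseteq> ?V i. len w) \<le> C * r i powr s * b n"
    using E by (intro eventually_ball_finite ballI frostman) auto
  ultimately have "\<forall>\<^sub>F n in sequentially. pi * \<beta> / 2 ^ n < e \<and> (\<forall>i\<in>E.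
      (\<Sum>w | w \<in> words n \<and> cyl w ` {- \<beta>..\<beta>} \<subseteq> ?V i. len w) \<le> C * r i powr s * b n)"
    by (rule eventually_conj)
  from eventually_happens'[OF sequentially_bot this] obtain n where
    n': "pi * \<beta> / 2 ^ n < e \<and> (\<forall>i\<in>E.
      (\<Sum>w | w \<in> words n \<and> cyl w ` {- \<beta>..\<beta>} \<subseteq> ?V i. len w) \<le> C * r i powr s * b n)" ..
  have n: "pi * \<beta> / 2 ^ n < e" using n' by (rule conjunct1)
  let ?Q = "\<lambda>w i. cyl w ` {- \<beta>..\<beta>} \<subseteq> ?V i"
  have ex: "\<exists>i\<in>E. ?Q w i" if w: "w \<in> words n" for w
  proof -
    obtain i where i: "i \<in> E" "ball (cyl w \<beta>) e \<subseteq> ?V i" using e2 cyl_beta_in_X[of w] by fast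
    have "cyl w ` {- \<beta>..\<beta>} \<subseteq> ball (cyl w \<beta>) e"
    proof
      fix z assume "z \<in> cyl w ` {- \<beta>..\<beta>}"
      then obtain y where y: "z = cyl w y" "y \<in> {- \<beta>..\<beta>}" by auto
      have "\<bar>cyl w \<beta> - cyl w y\<bar> \<le> pi * \<beta> / 2 ^ length w"
        using y beta_gt_2 by (intro cyl_contraction) (auto simp: abs_le_iff)
      then show "z \<in> ball (cyl w \<beta>) e" using n w y by (simp add: words_def dist_real_def)
    qed
    then show ?thesis using i by blast
  qed
  have "b n = (\<Sum>w\<in>words n. len w)" by (rule b_words)
  also have "\<dots> \<le> (\<Sum>w\<in>words n. \<Sum>i\<in>E. if ?Q w i then len w else 0)"
  proof (rule sum_mono)
    fix w assume "w \<in> words n"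
    then obtain i where i: "i \<in> E" "?Q w i" using ex by blast
    then have "len w = (if ?Q w i then len w else 0)" by simp
    also have "\<dots> \<le> (\<Sum>i\<in>E. if ?Q w i then len w else 0)"
      by (rule member_le_sum) (use i E in \<open>auto simp: len_nonneg\<close>)
    finally show "len w \<le> (\<Sum>i\<in>E. if ?Q w i then len w else 0)" .
  qed
  also have "\<dots> = (\<Sum>i\<in>E. \<Sum>w\<in>words n. if ?Q w i then len w else 0)" by (rule sum.swap)
  also have "\<dots> = (\<Sum>i\<in>E. \<Sum>w | w \<in> words n \<and> ?Q w i. len w)"
    by (rule sum.cong[OF refl]) (rule sum.inter_filter[symmetric], simp)
  also have "\<dots> \<le> (\<Sum>i\<in>E. C * r i powr s * b n)"
    by (rule sum_mono) (rule bspec[OF conjunct2[OF n']])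
  also have "\<dots> = C * (\<Sum>i\<in>E. r i powr s) * b n" by (simp add: sum_distrib_left sum_distrib_right)
  finally show ?thesis using b_pos[of n] by simp
qed

text \<open>Each covering set that meets \<open>J\<close> is replaced by an open interval centred in
  it, and compactness leaves finitely many. Then
  \<open>1 \<le> 2 * C * (\<Sum>i\<in>E. d i powr s) + 1/2\<close>.\<close>

lemma premeasure_ge: "ennreal (1 / (4 * C)) \<le> hausdorff_premeasure s (1/2) J"
  unfolding hausdorff_premeasure_def
proof (rule INF_greatest)
  fix U assume "U \<in> {U :: nat \<Rightarrow> complex set. J \<subseteq> (\<Union>i. U i) \<and> (\<forall>i. bounded (U i) \<and> diameter (U i) \<le> 1/2)}"
  then have U: "J \<subseteq> (\<Union>i. U i)" "\<And>i. bounded (U i)" "\<And>i. diameter (U i) \<le> 1/2" by auto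
  define d where "d i = diameter (U i)" for i
  have d: "0 \<le> d i" "d i \<le> 1/2" for i unfolding d_def using U diameter_ge_0 by auto
  \<comment> \<open>\<open>z\<close> is the total cost granted to sets of diameter 0, which offer no
    positive radius; \<open>C * z \<le> 1/2\<close> keeps it harmless. The other sets get twice
    their diameter, at most 1, as radius.\<close>
  define z where "z = min 1 (1 / (2 * C))"
  have z: "0 < z" "z \<le> 1" "C * z \<le> 1 / 2"
  proof -
    have "C * z \<le> C * (1 / (2 * C))" unfolding z_def using C_pos by (intro mult_left_mono) auto
    then show "C * z \<le> 1/2" using C_pos by simp
  qed (use C_pos in \<open>auto simp: z_def\<close>)
  define r where "r i = (if 0 < d i then 2 * d i else (z / 2 ^ Suc i) powr (1 / s))" for i
  have r: "0 < r i" "r i \<le> 1" "d i < r i" "r i powr s \<le> 2 * d i powr s + z * (1/2) ^ Suc i" for i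
  proof -
    have "z \<le> 2 ^ Suc i" using z(2) one_le_power[of "2::real" "Suc i"] by linarith
    then have z': "0 < z / 2 ^ Suc i" "z / 2 ^ Suc i \<le> 1" using z(1) by (auto simp: divide_le_eq)
    show "0 < r i" unfolding r_def using z' z(1) by simp
    show "d i < r i" unfolding r_def using z' z(1) d[of i] by auto
    have "(z / 2 ^ Suc i) powr (1 / s) \<le> 1" using z' z(1) s_pos by (intro powr_le1) auto
    then show "r i \<le> 1" unfolding r_def using d[of i] by simp
    show "r i powr s \<le> 2 * d i powr s + z * (1/2) ^ Suc i"
    proof (cases "0 < d i")
      case True
      have "r i powr s = 2 powr s * d i powr s" unfolding r_def using True by (simp add: powr_mult)
      also have "\<dots> \<le> 2 powr 1 * d i powr s" using s_le by (intro mult_right_mono powr_mono) auto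
      finally show ?thesis using z by (simp add: add_increasing2)
    next
      case False
      then have "r i powr s = z * (1/2) ^ Suc i"
        unfolding r_def using z' z(1) s_pos by (simp add: powr_powr power_divide)
      moreover have "0 \<le> 2 * d i powr s" by simp
      ultimately show ?thesis by linarith
    qed
  qed
  define K where "K = {i. U i \<inter> J \<noteq> {}}"
  have "\<exists>y. complex_of_real y \<in> U i" if "i \<in> K" for i using that unfolding K_def julia by blast
  then obtain x where x: "\<And>i. i \<in> K \<Longrightarrow> complex_of_real (x i) \<in> U i" by metis
  have cov: "(\<Inter>n. X n) \<subseteq> (\<Union>i\<in>K. {x i - r i<..<x i + r i})"
  proof
    fix y assume y: "y \<in> (\<Inter>n. X n)"
    then have yJ: "complex_of_real y \<in> J" unfolding julia by blast
    then obtain i where i: "complex_of_real y \<in> U i" using U by blast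
    then have iK: "i \<in> K" using yJ unfolding K_def by blast
    have "dist (complex_of_real y) (complex_of_real (x i)) \<le> d i"
      unfolding d_def by (rule diameter_bounded_bound[OF U(2) i x[OF iK]])
    then have "\<bar>y - x i\<bar> < r i" using r(3)[of i] by (simp add: dist_of_real dist_real_def)
    then show "y \<in> (\<Union>i\<in>K. {x i - r i<..<x i + r i})" using iK by (auto intro!: bexI[of _ i])
  qed
  have comp: "compact (\<Inter>n. X n)" by (rule compact_Inter) (auto simp: X_compact)
  obtain E where E: "E \<subseteq> K" "finite E" "(\<Inter>n. X n) \<subseteq> (\<Union>i\<in>E. {x i - r i<..<x i + r i})"
    using compactE_image[OF comp _ cov] by auto
  have "1 \<le> C * (\<Sum>i\<in>E. r i powr s)" by (rule finite_cover_bound) (use E r in auto)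
  also have "\<dots> \<le> C * (\<Sum>i\<in>E. 2 * d i powr s + z * (1/2) ^ Suc i)"
    using C_pos r by (intro mult_left_mono sum_mono) auto
  also have "\<dots> = 2 * C * (\<Sum>i\<in>E. d i powr s) + C * z * (\<Sum>i\<in>E. (1/2) ^ Suc i)"
    by (simp add: sum.distrib sum_distrib_left algebra_simps)
  also have "C * z * (\<Sum>i\<in>E. (1/2) ^ Suc i) \<le> 1/2 * 1"
  proof (intro mult_mono z)
    have "(\<Sum>i\<in>E. (1/2) ^ Suc i) \<le> (\<Sum>i. (1/2 :: real) ^ Suc i)"
      using E(2) power_half_series by (intro sum_le_suminf) (auto simp: sums_iff)
    also have "\<dots> = 1" using power_half_series by (simp add: sums_iff)
    finally show "(\<Sum>i\<in>E. (1/2 :: real) ^ Suc i) \<le> 1" .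
  qed (auto intro!: sum_nonneg)
  finally have "1 / (4 * C) \<le> (\<Sum>i\<in>E. d i powr s)" using C_pos by (simp add: field_simps)
  then have "ennreal (1 / (4 * C)) \<le> ennreal (\<Sum>i\<in>E. d i powr s)" by (rule ennreal_leI)
  also have "\<dots> = (\<Sum>i\<in>E. hausdorff_gauge s (U i))"
  proof -
    have "hausdorff_gauge s (U i) = ennreal (d i powr s)" if "i \<in> E" for i
      using x[of i] E(1) that s_pos unfolding hausdorff_gauge_def d_def by auto
    then show ?thesis by (simp add: sum_ennreal)
  qed
  also have "\<dots> \<le> (\<Sum>i. hausdorff_gauge s (U i))" using E(2) by (intro sum_le_suminf) auto
  finally show "ennreal (1 / (4 * C)) \<le> (\<Sum>i. hausdorff_gauge s (U i))" .
qed

lemma dim_ge: "ennreal s \<le> hausdorff_dim J"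
  unfolding hausdorff_dim_def
proof (rule Inf_greatest)
  fix y assume "y \<in> {ennreal t |t. 0 \<le> t \<and> hausdorff_measure t J = 0}"
  then obtain t where t: "y = ennreal t" "0 \<le> t" "hausdorff_measure t J = 0" by blast
  have "s \<le> t"
  proof (rule ccontr)
    assume "\<not> s \<le> t"
    then have ts: "t < s" by simp
    \<comment> \<open>Below diameter 1 the gauge does not increase with the exponent; for
      \<open>t = 0\<close> the cost 1 of a nonempty set still dominates.\<close>
    have g: "hausdorff_gauge s V \<le> hausdorff_gauge t V" if "bounded V" "diameter V \<le> 1/2" for V :: "complex set"
    proof -
      have "0 \<le> diameter V" by (rule diameter_ge_0[OF that(1)])
      then have "diameter V powr s \<le> diameter V powr t" "diameter V powr s \<le> 1"
        using that ts s_pos by (auto intro!: powr_mono' powr_le1)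
      then show ?thesis unfolding hausdorff_gauge_def using s_pos t(2)
        by (auto intro: ennreal_leI)
    qed
    have "hausdorff_premeasure s (1/2) J \<le> hausdorff_premeasure t (1/2) J"
      unfolding hausdorff_premeasure_def
    proof (rule INF_mono)
      fix U assume "U \<in> {U :: nat \<Rightarrow> complex set. J \<subseteq> (\<Union>i. U i) \<and> (\<forall>i. bounded (U i) \<and> diameter (U i) \<le> 1/2)}"
      then show "\<exists>V\<in>{U :: nat \<Rightarrow> complex set. J \<subseteq> (\<Union>i. U i) \<and> (\<forall>i. bounded (U i) \<and> diameter (U i) \<le> 1/2)}.
          (\<Sum>i. hausdorff_gauge s (V i)) \<le> (\<Sum>i. hausdorff_gauge t (U i))"
        by (intro bexI[of _ U] suminf_le g) auto
    qed
    also have "\<dots> \<le> hausdorff_measure t J" unfolding hausdorff_measure_def by (rule SUP_upper) simp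
    finally have "ennreal (1 / (4 * C)) \<le> 0" using premeasure_ge t(3) by simp
    then show False using C_pos by (simp add: ennreal_eq_0_iff divide_le_0_iff)
  qed
  then show "ennreal s \<le> y" unfolding t(1) by (rule ennreal_leI)
qed

end

text \<open>The escape rate is known up to \<open>e * \<tau>\<close>, while \<open>sL\<close> and
  \<open>sU\<close> allow \<open>2 * e * \<tau>\<close>; the spare \<open>e * \<tau>\<close> absorbs
  the terms of order \<open>\<tau>^2\<close>, because \<open>\<tau> < e / 2\<close>. Finally
  \<open>2 / ln 2 \<le> 3\<close>.\<close>

lemma julia_dim_bounds:
  assumes "0 < e" "e \<le> 1 / 4"
  shows "\<forall>\<^sub>F \<epsilon> in at_right 0. \<bar>julia_dim (complex_of_real (- \<epsilon>))
    - (1 - 2/pi * real_julia.\<tau> \<epsilon> / ln 2)\<bar> \<le> 3 * e * real_julia.\<tau> \<epsilon>"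
proof -
  obtain t0 :: real where t0: "0 < t0" and
    rate: "\<And>\<tau> n. 0 < \<tau> \<Longrightarrow> \<tau> \<le> t0 \<Longrightarrow>
      \<bar>(perturbed_tent.a \<tau> n - perturbed_tent.a \<tau> (Suc n)) - 2/pi * \<tau> * perturbed_tent.a \<tau> n\<bar>
        \<le> e * \<tau> * perturbed_tent.a \<tau> n" and
    mid: "\<And>\<tau> n. 0 < \<tau> \<Longrightarrow> \<tau> \<le> t0 \<Longrightarrow> perturbed_tent.a \<tau> n / 4
        \<le> perturbed_tent.G \<tau> n (3*pi/8) - perturbed_tent.G \<tau> n (pi/8)"
    using escape_rate_asymptotics[OF assms(1)] by metis
  have "((\<lambda>\<epsilon>. sqrt ((1 + sqrt (9 + 4 * \<epsilon>)) / 2 / 2 - 1)) \<longlongrightarrow> 0) (at_right 0)" by real_asymp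
  then have "\<forall>\<^sub>F \<epsilon> in at_right 0. sqrt ((1 + sqrt (9 + 4 * \<epsilon>)) / 2 / 2 - 1) < min t0 (e / 2)"
    by (rule order_tendstoD) (use t0 assms in auto)
  moreover have "\<forall>\<^sub>F \<epsilon>::real in at_right 0. 0 < \<epsilon>" by (simp add: eventually_at_right_less)
  ultimately show ?thesis
  proof eventually_elim
    case (elim \<epsilon>)
    interpret real_julia \<epsilon> by unfold_locales (rule elim)
    have small: "\<tau> < t0" "\<tau> < e / 2" using elim(1) unfolding \<tau>_def \<beta>_def by auto
    have pos: "0 < \<tau>" by (rule tent.tau_pos)
    have rate': "\<bar>(tent.a n - tent.a (Suc n)) - 2/pi * \<tau> * tent.a n\<bar> \<le> e * \<tau> * tent.a n" for n
      using rate[OF pos, of n] small by simp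
    define p where "p = 2/pi"
    have p: "0 < p" "p \<le> 2/3" unfolding p_def using pi_gt3 by (auto simp: field_simps)
    have p_ge: "1 / 2 \<le> p" unfolding p_def using pi_less_4 by (simp add: field_simps)
    have l2: "2/3 \<le> ln (2::real)" by (rule ln2_ge_two_thirds)
    have up: "tent.a (Suc n) \<le> (1 - (p - e) * \<tau>) * tent.a n" for n
      using rate'[of n] unfolding p_def[symmetric] by (simp add: abs_le_iff algebra_simps)
    have lo: "(1 - (p + e) * \<tau>) * tent.a n \<le> tent.a (Suc n)" for n
      using rate'[of n] unfolding p_def[symmetric] by (simp add: abs_le_iff algebra_simps)
    have t: "\<tau> < 1 / 6" using small assms by simp
    define sU where "sU = 1 - (p - 2 * e) * \<tau> / ln 2"
    define sL where "sL = 1 - (p + 2 * e) * \<tau> / ln 2"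
    have L: "ennreal sL \<le> hausdorff_dim J \<and> 0 \<le> sL"
    proof -
      have "(p + 2 * e) * \<tau> \<le> 4/3 * (1/6)" using p t pos assms by (intro mult_mono) auto
      then have "(p + 2 * e) * \<tau> < ln 2" using l2 by linarith
      then have "(p + 2 * e) * \<tau> / ln 2 < 1" by simp
      moreover have "0 \<le> (p + 2 * e) * \<tau> / ln 2" using p pos assms by simp
      ultimately have sL: "0 < sL" "sL \<le> 1" unfolding sL_def by auto
      have "2 powr (sL - 1) = exp (- ((p + 2 * e) * \<tau>))"
        unfolding sL_def powr_def by simp
      also have "\<dots> \<le> 1 - (p + e) * \<tau>"
      proof -
        define x y where "x = (p + 2 * e) * \<tau>" and "y = (p + e) * \<tau>"
        have x: "0 < x" unfolding x_def using p pos assms by simp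
        \<comment> \<open>Here \<open>x - y = e * \<tau>\<close>; the inequality says that
          \<open>1 / (1 + x)\<close>, which bounds \<open>exp (- x)\<close>, is at most
          \<open>1 - y\<close>.\<close>
        have "x * y \<le> x - y"
        proof -
          have "(p + 2 * e) * (p + e) * \<tau> \<le> (4/3 * 1) * (e / 2)"
            using p pos assms small by (intro mult_mono) auto
          also have "\<dots> \<le> e" using assms by simp
          finally have "((p + 2 * e) * (p + e) * \<tau>) * \<tau> \<le> e * \<tau>" using pos by (intro mult_right_mono) auto
          then show ?thesis unfolding x_def y_def by (simp add: algebra_simps)
        qed
        then have "1 \<le> (1 - y) * (1 + x)" by (simp add: algebra_simps)
        then have "1 / (1 + x) \<le> 1 - y" using x by (simp add: pos_divide_le_eq)
        moreover have "exp (- x) \<le> 1 / (1 + x)"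
          using exp_ge_add_one_self[of x] x by (simp add: exp_minus divide_inverse le_imp_inverse_le)
        ultimately show ?thesis unfolding x_def y_def by linarith
      qed
      finally have ge: "2 powr (sL - 1) \<le> 1 - (p + e) * \<tau>" .
      interpret lower: real_julia_lower \<epsilon> sL
      proof unfold_locales
        show "2 powr (sL - 1) * tent.a n \<le> tent.a (Suc n)" for n
          using mult_right_mono[OF ge tent.a_nonneg[of n]] lo[of n] by linarith
        show "tent.a n / 4 \<le> tent.G n (3*pi/8) - tent.G n (pi/8)" for n
          using mid[OF pos, of n] small by simp
      qed (use sL in auto)
      show ?thesis using lower.dim_ge sL by simp
    qed
    have U: "hausdorff_dim J \<le> ennreal sU \<and> 0 \<le> sU"
    proof -
      have "(p - 2 * e) * \<tau> / ln 2 < 1"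
      proof -
        have "(p - 2 * e) * \<tau> \<le> 1 * \<tau>" using p pos assms by (intro mult_right_mono) auto
        then have "(p - 2 * e) * \<tau> < ln 2" using t l2 by linarith
        then show ?thesis by simp
      qed
      then have sU_pos: "0 < sU" unfolding sU_def by simp
      define l where "l = 1 - (p - e) * \<tau>"
      have l_pos: "0 < l"
      proof -
        have "(p - e) * \<tau> \<le> 1 * \<tau>" using p pos assms by (intro mult_right_mono) auto
        then show ?thesis unfolding l_def using t by simp
      qed
      have "ln l \<le> - ((p - e) * \<tau>)" using ln_le_minus_one[OF l_pos] unfolding l_def by simp
      then have "sU * ln l \<le> sU * (- ((p - e) * \<tau>))" using sU_pos by (intro mult_left_mono) auto
      moreover have "(1 - sU) * ln 2 = (p - 2 * e) * \<tau>" unfolding sU_def by simp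
      \<comment> \<open>Equivalent to \<open>(p - 2 * e) * (p - e) * \<tau> / ln 2 < e\<close>,
        again by \<open>\<tau> < e / 2\<close>.\<close>
      moreover have "(p - 2 * e) * \<tau> < sU * ((p - e) * \<tau>)"
      proof -
        have "(p - 2 * e) * (p - e) * \<tau> \<le> (2/3 * 1) * (e / 2)"
          using p p_ge pos assms small by (intro mult_mono) auto
        also have "\<dots> < e * ln 2"
        proof -
          have "e * (2/3) \<le> e * ln 2" using l2 assms by (intro mult_left_mono) auto
          then show ?thesis using assms by linarith
        qed
        finally have "(p - 2 * e) * \<tau> / ln 2 * (p - e) < e"
          by (simp add: pos_divide_less_eq mult_ac)
        then have "p - 2 * e < sU * (p - e)" unfolding sU_def by (simp add: algebra_simps)
        then show ?thesis using pos by (simp add: mult.assoc[symmetric])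
      qed
      ultimately have neg: "(1 - sU) * ln 2 + sU * ln l < 0" by simp
      have "2 powr (1 - sU) * l powr sU = exp ((1 - sU) * ln 2 + sU * ln l)"
        using l_pos by (simp add: powr_def exp_add)
      also have "\<dots> < 1" using neg by simp
      finally have "2 powr (1 - sU) * l powr sU < 1" .
      moreover have "sU \<le> 1" unfolding sU_def using p_ge pos assms by simp
      ultimately have "hausdorff_dim J \<le> ennreal sU"
        using up l_pos sU_pos unfolding l_def by (intro dim_le) auto
      then show ?thesis using sU_pos by simp
    qed
    have "sL \<le> julia_dim (complex_of_real (- \<epsilon>))" "julia_dim (complex_of_real (- \<epsilon>)) \<le> sU"
    proof -
      \<comment> \<open>Finiteness makes \<open>enn2real\<close> lossless.\<close>
      have "hausdorff_dim J < top" using U by (metis ennreal_less_top le_less_trans)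
      then have eq: "ennreal (julia_dim (complex_of_real (- \<epsilon>))) = hausdorff_dim J"
        unfolding julia_dim_def by simp
      have nn: "0 \<le> julia_dim (complex_of_real (- \<epsilon>))" unfolding julia_dim_def by simp
      show "sL \<le> julia_dim (complex_of_real (- \<epsilon>))" using L eq nn by (metis ennreal_le_iff)
      show "julia_dim (complex_of_real (- \<epsilon>)) \<le> sU" using U eq by (metis ennreal_le_iff)
    qed
    moreover have "2 * e * \<tau> / ln 2 \<le> 3 * e * \<tau>"
    proof -
      have "2 * e * \<tau> \<le> 3 * e * \<tau> * (2/3)" by simp
      also have "\<dots> \<le> 3 * e * \<tau> * ln 2" using l2 pos assms by (intro mult_left_mono) auto
      finally show ?thesis by (simp add: pos_divide_le_eq)
    qed
    moreover have "sL = 1 - p * \<tau> / ln 2 - 2 * e * \<tau> / ln 2" "sU = 1 - p * \<tau> / ln 2 + 2 * e * \<tau> / ln 2"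
      unfolding sL_def sU_def by (auto simp: add_divide_distrib diff_divide_distrib algebra_simps)
    ultimately show ?case unfolding p_def[symmetric] by (simp add: abs_le_iff)
  qed
qed

theorem corollary1p2:
  shows "(\<lambda>\<delta>::real. julia_dim (complex_of_real \<delta>)
             - (1 - sqrt 6 / (3 * pi * ln 2) * sqrt \<bar>\<delta>\<bar>))
           \<in> o[at_left 0](\<lambda>\<delta>. sqrt \<bar>\<delta>\<bar>)"
proof (rule landau_o.smallI)
  fix c :: real assume c: "0 < c"
  \<comment> \<open>Half of \<open>c\<close> pays for \<open>3 * e * \<tau>\<close>, since
    eventually \<open>\<tau> \<le> sqrt \<epsilon>\<close>; the other half pays for the limit of
    \<open>\<tau> / sqrt \<epsilon>\<close>.\<close>
  define e where "e = min (1/4) (c / 6)"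
  have e: "0 < e" "e \<le> 1/4" "e \<le> c / 6" unfolding e_def using c by auto
  let ?t = "\<lambda>\<epsilon>. sqrt ((1 + sqrt (9 + 4 * \<epsilon>)) / 2 / 2 - 1)"
  \<comment> \<open>\<open>?t\<close> is \<open>\<tau>\<close>, and
    \<open>\<tau>^2 = (sqrt (9 + 4 * \<epsilon>) - 3) / 4\<close> behaves like
    \<open>\<epsilon> / 6\<close>; this is the source of \<open>sqrt 6\<close>.\<close>
  have "((\<lambda>\<epsilon>. ?t \<epsilon> / sqrt \<epsilon>) \<longlongrightarrow> (1 / 6) powr (1 / 2)) (at_right 0)" by real_asymp
  then have t: "((\<lambda>\<epsilon>. ?t \<epsilon> / sqrt \<epsilon>) \<longlongrightarrow> 1 / sqrt 6) (at_right 0)"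
    by (simp add: powr_half_sqrt real_sqrt_divide)
  then have lim: "((\<lambda>\<epsilon>. 2/pi / ln 2 * (?t \<epsilon> / sqrt \<epsilon>)) \<longlongrightarrow> 2/pi / ln 2 * (1 / sqrt 6)) (at_right 0)"
    by (intro tendsto_mult tendsto_const)
  have k: "2/pi / ln 2 * (1 / sqrt 6) = sqrt 6 / (3 * pi * ln 2)"
    by (simp add: field_simps)
  have "\<forall>\<^sub>F \<epsilon> in at_right 0. dist (2/pi / ln 2 * (?t \<epsilon> / sqrt \<epsilon>)) (sqrt 6 / (3 * pi * ln 2)) < c / 2"
    using lim unfolding k by (rule tendstoD) (use c in auto)
  moreover have "\<forall>\<^sub>F \<epsilon> in at_right 0. ?t \<epsilon> / sqrt \<epsilon> < 1"
    by (rule order_tendstoD(2)[OF t]) simp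
  moreover have "\<forall>\<^sub>F \<epsilon>::real in at_right 0. 0 < \<epsilon>" by (simp add: eventually_at_right_less)
  moreover note julia_dim_bounds[OF e(1,2)]
  ultimately have "\<forall>\<^sub>F \<epsilon> in at_right 0. \<bar>julia_dim (complex_of_real (- \<epsilon>))
      - (1 - sqrt 6 / (3 * pi * ln 2) * sqrt \<epsilon>)\<bar> \<le> c * sqrt \<epsilon>"
  proof eventually_elim
    case (elim \<epsilon>)
    interpret real_julia \<epsilon> by unfold_locales (rule elim)
    have t: "?t \<epsilon> = \<tau>" unfolding \<tau>_def \<beta>_def ..
    have s: "0 < sqrt \<epsilon>" using elim by simp
    have "\<tau> \<le> sqrt \<epsilon>" using elim(2) s unfolding t by simp
    then have 1: "3 * e * \<tau> \<le> 3 * (c / 6) * sqrt \<epsilon>"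
      using e tent.tau_pos by (intro mult_mono) auto
    have "\<bar>2/pi / ln 2 * (\<tau> / sqrt \<epsilon>) - sqrt 6 / (3 * pi * ln 2)\<bar> * sqrt \<epsilon> \<le> c / 2 * sqrt \<epsilon>"
      using elim(1) s unfolding t dist_real_def by (intro mult_right_mono) auto
    also have "\<bar>2/pi / ln 2 * (\<tau> / sqrt \<epsilon>) - sqrt 6 / (3 * pi * ln 2)\<bar> * sqrt \<epsilon>
        = \<bar>(2/pi / ln 2 * (\<tau> / sqrt \<epsilon>) - sqrt 6 / (3 * pi * ln 2)) * sqrt \<epsilon>\<bar>"
      using s by (simp add: abs_mult)
    also have "(2/pi / ln 2 * (\<tau> / sqrt \<epsilon>) - sqrt 6 / (3 * pi * ln 2)) * sqrt \<epsilon>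
        = 2/pi * \<tau> / ln 2 - sqrt 6 / (3 * pi * ln 2) * sqrt \<epsilon>"
      using s by (simp add: left_diff_distrib)
    finally have 2: "\<bar>2/pi * \<tau> / ln 2 - sqrt 6 / (3 * pi * ln 2) * sqrt \<epsilon>\<bar> \<le> c / 2 * sqrt \<epsilon>" .
    have "\<bar>x - (1 - z)\<bar> \<le> B + C" if "\<bar>x - (1 - y)\<bar> \<le> B" "\<bar>y - z\<bar> \<le> C" for x y z B C :: real
      using that by linarith
    from this[OF elim(4) 2]
    have "\<bar>julia_dim (complex_of_real (- \<epsilon>)) - (1 - sqrt 6 / (3 * pi * ln 2) * sqrt \<epsilon>)\<bar>
      \<le> 3 * e * \<tau> + c / 2 * sqrt \<epsilon>" .
    also have "\<dots> \<le> 3 * (c / 6) * sqrt \<epsilon> + c / 2 * sqrt \<epsilon>" using 1 by simp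
    also have "\<dots> = c * sqrt \<epsilon>" by simp
    finally show ?case .
  qed
  then have "\<forall>\<^sub>F \<delta> in at_left 0. \<bar>julia_dim (complex_of_real \<delta>)
      - (1 - sqrt 6 / (3 * pi * ln 2) * sqrt (- \<delta>))\<bar> \<le> c * sqrt (- \<delta>)"
    unfolding at_left_minus[of "0::real"] eventually_filtermap by simp
  moreover have "\<forall>\<^sub>F \<delta>::real in at_left 0. \<delta> < 0" by (simp add: eventually_at_filter)
  ultimately show "\<forall>\<^sub>F \<delta> in at_left 0. norm (julia_dim (complex_of_real \<delta>)
      - (1 - sqrt 6 / (3 * pi * ln 2) * sqrt \<bar>\<delta>\<bar>)) \<le> c * norm (sqrt \<bar>\<delta>\<bar>)"
  proof eventually_elim
    case (elim \<delta>)
    then show ?case by simp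
  qed
qed

end
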